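(* Assume that $f$ is bounded, that $X$ has a continuous distribution (no atoms), and that $\operatorname{Var}(Y)>0$. Then the following holds. (Consistency) Almost surely, $$\lim_{n\to\infty}\widehat\rho_n^{\mathrm{Sobol'}}=\rho^{\mathrm{Sobol'}}=\frac{\mathbb E\left[\mathbb E[Y\mid X]^2\right]-\mathbb E[Y]^2}{\mathbb E[Y^2]-\mathbb E[Y]^2}.$$ (Fluctuations) Define $$\Delta_n:=\mathbb E\left[\left(\varphi(X_1)-\varphi(X_{N_n(1)})\right)^2\right]=\frac1n\,\mathbb E\left[\sum_{i=1}^n\left(\varphi(X_{\sigma_n(i-1)})-\varphi(X_{\sigma_n(i)})\right)^2\right].$$ Then $\Delta_n\to0$ as $n\to\infty$ and $$\sqrt n\left[\widehat\rho_n^{\mathrm{Sobol'}}-\left(\rho^{\mathrm{Sobol'}}-\frac{\Delta_n}{2\operatorname{Var}(Y)}\right)\right]\xrightarrow{\ \mathcal L\ }\mathcal N(0,\sigma^2_{\mathrm{Sobol'}}),$$ where $$\sigma^2_{\mathrm{Sobol'}}:=v(f)^\top\left(\Sigma_0(f,f)+\Sigma_1(f,f)\right)v(f),\qquad v(f):=\frac1{\operatorname{Var}(Y)}\begin{pmatrix}1\\ 2\,\mathbb E[Y](\rho^{\mathrm{Sobol'}}-1)\\ -\rho^{\mathrm{Sobol'}}\end{pmatrix}.$$ In particular, if $\lim_{n\to\infty}\sqrt n\,\Delta_n=0$, then $$\sqrt n\left[\widehat\rho_n^{\mathrm{Sobol'}}-\rho^{\mathrm{Sobol'}}\right]\xrightarrow{\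 \mathcal L\ }\mathcal N(0,\sigma^2_{\mathrm{Sobol'}}).$$ The condition $\lim_{n\to\infty}\sqrt n\,\Delta_n=0$ is implied, for example, by $\varphi=\mathbb E[Y\mid X=\cdot]$ having bounded quadratic variation ($2$-variation).
   Context: Model: $X$ and $\varepsilon$ are independent real random variables, $f:\mathbb R\times\mathbb R\to\mathbb R$ is measurable, $Y=f(X,\varepsilon)$. Let $(X_i)_{i\ge1}$ be i.i.d. copies of $X$ and $(\varepsilon_i)_{i\ge1}$ i.i.d. copies of $\varepsilon$, the two sequences being independent, and $Y_i=f(X_i,\varepsilon_i)$. $\mathbb E_\varepsilon$ and $\operatorname{Cov}_\varepsilon$ denote expectation and covariance with respect to $\varepsilon$ only, with $X$ (or $x$) held fixed (i.e. conditionally on $X$). Set $\varphi(x):=\mathbb E_\varepsilon[f(x,\varepsilon)]=\mathbb E[Y\mid X=x]$. Ranks: since $X$ has no atoms, almost surely there is a unique permutation $\sigma_n$ of $\{1,\dots,n\}$ with $X_{\sigma_n(1)}<\cdots<X_{\sigma_n(n)}$. It is extended $n$-periodically, so $\sigma_n(0)=\sigma_n(n)$ and $\sigma_n(n+1)=\sigma_n(1)$. For $j\in\{1,\dots,n\}$, $N_n(j):=\sigma_n(\sigma_n^{-1}(j)+1)$ where $\sigma_n^{-1}(j)\in\{1,\dots,n\}$: the index of the right neighbour of $X_j$ in the ordered sample, the successor of the largest observation being the smallest one. Sobol' index and its rank estimator: $$\rho^{\mathrm{Sobol'}}:=\frac{\operatorname{Var}(\mathbb E[Y\mid X])}{\operatorname{Var}(Y)},\qquad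 \widehat\rho_n^{\mathrm{Sobol'}}:=\frac{\frac1n\sum_{i=1}^nY_iY_{N_n(i)}-\left(\frac1n\sum_{i=1}^nY_i\right)^2}{\frac1n\sum_{i=1}^nY_i^2-\left(\frac1n\sum_{i=1}^nY_i\right)^2}.$$ Matrices: for bounded measurable $f,g:\mathbb R\times\mathbb R\to\mathbb R$ define the $3\times3$ matrices $$\Sigma_0(f,g):=\operatorname{Cov}\left(\begin{pmatrix}\mathbb E_\varepsilon[f(X,\varepsilon)]^2\\ \mathbb E_\varepsilon[f(X,\varepsilon)]\\ \mathbb E_\varepsilon[f^2(X,\varepsilon)]\end{pmatrix},\begin{pmatrix}\mathbb E_\varepsilon[g(X,\varepsilon)]^2\\ \mathbb E_\varepsilon[g(X,\varepsilon)]\\ \mathbb E_\varepsilon[g^2(X,\varepsilon)]\end{pmatrix}\right),$$ $$\Sigma_a(X,f,g):=\begin{pmatrix}2\mathbb E_\varepsilon[f(X,\varepsilon)]\\ 1\\ 1\end{pmatrix}\begin{pmatrix}2\mathbb E_\varepsilon[g(X,\varepsilon)]\\ 1\\ 1\end{pmatrix}^\top+\operatorname{Cov}_\varepsilon[f(X,\varepsilon),g(X,\varepsilon)]\begin{pmatrix}1\\ 0\\ 0\end{pmatrix}\begin{pmatrix}1\\ 0\\ 0\end{pmatrix}^\top,$$ $$\Sigma_b(X,f,g):=\operatorname{Cov}_\varepsilon\left(\begin{pmatrix} f(X,\varepsilon)\\ f(X,\varepsilon)\\ f^2(X,\varepsilon)\end{pmatrix},\begin{pmatrix} g(X,\varepsilon)\\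 g(X,\varepsilon)\\ g^2(X,\varepsilon)\end{pmatrix}\right),\qquad \Sigma_1(f,g):=\mathbb E\left[\Sigma_a(X,f,g)\odot\Sigma_b(X,f,g)\right],$$ where $\odot$ is the entrywise (Hadamard) product and $\operatorname{Cov}(U,V)$ of two vectors is the matrix $(\operatorname{Cov}(U_i,V_j))_{i,j}$. A function $\varphi:\mathbb R\to\mathbb R$ has bounded $2$-variation if $\sup\sum_{i}(\varphi(x_{i+1})-\varphi(x_i))^2<\infty$, the supremum being over all finite increasing sequences $x_1<x_2<\cdots<x_m$. $\xrightarrow{\mathcal L}$ denotes convergence in law; $\mathcal N(0,0)$ is the Dirac mass at $0$. *)

theory Defs
  imports "HOL-Probability.Probability"
begin

definition covariance :: "'a measure \<Rightarrow> ('a \<Rightarrow> real) \<Rightarrow> ('a \<Rightarrow> real) \<Rightarrow> real" where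
  "covariance M U V =
     prob_space.expectation M
       (\<lambda>\<omega>. (U \<omega> - prob_space.expectation M U) * (V \<omega> - prob_space.expectation M V))"

definition cov_matrix :: "'a measure \<Rightarrow> ('a \<Rightarrow> real ^ 'n) \<Rightarrow> ('a \<Rightarrow> real ^ 'm) \<Rightarrow> real ^ 'm ^ 'n" where
  "cov_matrix M U V = (\<chi> i j. covariance M (\<lambda>\<omega>. U \<omega> $ i) (\<lambda>\<omega>. V \<omega> $ j))"

definition outer_product :: "real ^ 'n \<Rightarrow> real ^ 'm \<Rightarrow> real ^ 'm ^ 'n" where
  "outer_product u v = (\<chi> i j. u $ i * v $ j)"

definition hadamard :: "real ^ 'm ^ 'n \<Rightarrow> real ^ 'm ^ 'n \<Rightarrow> real ^ 'm ^ 'n" where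
  "hadamard A B = (\<chi> i j. A $ i $ j * B $ i $ j)"

text \<open>
  The normal law with mean \<open>m\<close> and \<^emph>\<open>variance\<close> \<open>v \<ge> 0\<close>, whereas \<^const>\<open>normal_density\<close>
  takes the standard deviation. For \<open>v = 0\<close> it is the Dirac mass at \<open>m\<close>.
\<close>
definition normal_law :: "real \<Rightarrow> real \<Rightarrow> real measure" where
  "normal_law m v =
     (if v = 0 then return borel m
      else density lborel (\<lambda>x. ennreal (normal_density m (sqrt v) x)))"

definition bounded_2_variation :: "(real \<Rightarrow> real) \<Rightarrow> bool" where
  "bounded_2_variation h \<longleftrightarrow>
     bdd_above {(\<Sum>i = 1..<m. (h (x (Suc i)) - h (x i))\<^sup>2) | (m :: nat) x.
                  strict_mono_on {1..m} x}"

text \<open>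
  Samples are sequences of which only the indices \<open>1, \<dots>, n\<close> matter. On the null event of ties
  the sorting permutation does not exist and is set to the identity, so that everything computed
  from it is a genuine random variable.
\<close>
definition sorts :: "nat \<Rightarrow> (nat \<Rightarrow> real) \<Rightarrow> (nat \<Rightarrow> nat) \<Rightarrow> bool" where
  "sorts n x \<sigma> \<longleftrightarrow> \<sigma> permutes {1..n} \<and> strict_mono_on {1..n} (\<lambda>i. x (\<sigma> i))"

definition sort_perm :: "nat \<Rightarrow> (nat \<Rightarrow> real) \<Rightarrow> nat \<Rightarrow> nat" where
  "sort_perm n x = (if \<exists>!\<sigma>. sorts n x \<sigma> then (THE \<sigma>. sorts n x \<sigma>) else id)"

text \<open>The \<open>n\<close>-periodic extension of the sorting permutation from \<open>{1..n}\<close> to all indices.\<close>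
definition sort_perm_periodic :: "nat \<Rightarrow> (nat \<Rightarrow> real) \<Rightarrow> nat \<Rightarrow> nat" where
  "sort_perm_periodic n x k = sort_perm n x (if k mod n = 0 then n else k mod n)"

definition right_neighbour :: "nat \<Rightarrow> (nat \<Rightarrow> real) \<Rightarrow> nat \<Rightarrow> nat" where
  "right_neighbour n x j = sort_perm_periodic n x (inv (sort_perm n x) j + 1)"

definition cond_exp_given :: "'a measure \<Rightarrow> ('a \<Rightarrow> real) \<Rightarrow> ('a \<Rightarrow> real) \<Rightarrow> 'a \<Rightarrow> real" where
  "cond_exp_given M X Y = real_cond_exp M (vimage_algebra (space M) X borel) Y"

definition sobol_index :: "'a measure \<Rightarrow> ('a \<Rightarrow> real) \<Rightarrow> ('a \<Rightarrow> real) \<Rightarrow> real" where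
  "sobol_index M X Y =
     prob_space.variance M (cond_exp_given M X Y) / prob_space.variance M Y"

definition rank_estimator :: "nat \<Rightarrow> (nat \<Rightarrow> real) \<Rightarrow> (nat \<Rightarrow> real) \<Rightarrow> real" where
  "rank_estimator n x y =
     (1 / real n * (\<Sum>i = 1..n. y i * y (right_neighbour n x i))
        - (1 / real n * (\<Sum>i = 1..n. y i))\<^sup>2)
     / (1 / real n * (\<Sum>i = 1..n. (y i)\<^sup>2) - (1 / real n * (\<Sum>i = 1..n. y i))\<^sup>2)"

text \<open>
  \<open>exp_eps M \<epsilon> f x\<close> is the expectation of \<open>f (x, \<epsilon>)\<close> with respect to \<open>\<epsilon>\<close> only, \<open>x\<close> being fixed.
  As a function of \<open>x\<close>, it is the regression function \<open>\<phi>\<close>.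
\<close>
definition exp_eps :: "'a measure \<Rightarrow> ('a \<Rightarrow> real) \<Rightarrow> (real \<times> real \<Rightarrow> real) \<Rightarrow> real \<Rightarrow> real" where
  "exp_eps M eps f x = prob_space.expectation M (\<lambda>\<omega>. f (x, eps \<omega>))"

definition Delta :: "'a measure \<Rightarrow> (nat \<Rightarrow> 'a \<Rightarrow> real) \<Rightarrow> (real \<Rightarrow> real) \<Rightarrow> nat \<Rightarrow> real" where
  "Delta M Xs h n =
     prob_space.expectation M
       (\<lambda>\<omega>. (h (Xs 1 \<omega>) - h (Xs (right_neighbour n (\<lambda>i. Xs i \<omega>) 1) \<omega>))\<^sup>2)"

definition Sigma_0 ::
  "'a measure \<Rightarrow> ('a \<Rightarrow> real) \<Rightarrow> ('a \<Rightarrow> real) \<Rightarrow> (real \<times> real \<Rightarrow> real) \<Rightarrow> (real \<times> real \<Rightarrow> real)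
     \<Rightarrow> real ^ 3 ^ 3" where
  "Sigma_0 M X eps f g =
     cov_matrix M
       (\<lambda>\<omega>. vector [(exp_eps M eps f (X \<omega>))\<^sup>2, exp_eps M eps f (X \<omega>),
                    exp_eps M eps (\<lambda>z. (f z)\<^sup>2) (X \<omega>)] :: real ^ 3)
       (\<lambda>\<omega>. vector [(exp_eps M eps g (X \<omega>))\<^sup>2, exp_eps M eps g (X \<omega>),
                    exp_eps M eps (\<lambda>z. (g z)\<^sup>2) (X \<omega>)] :: real ^ 3)"

definition Sigma_a ::
  "'a measure \<Rightarrow> ('a \<Rightarrow> real) \<Rightarrow> real \<Rightarrow> (real \<times> real \<Rightarrow> real) \<Rightarrow> (real \<times> real \<Rightarrow> real)
     \<Rightarrow> real ^ 3 ^ 3" where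
  "Sigma_a M eps x f g =
     outer_product (vector [2 * exp_eps M eps f x, 1, 1]) (vector [2 * exp_eps M eps g x, 1, 1])
     + covariance M (\<lambda>\<omega>. f (x, eps \<omega>)) (\<lambda>\<omega>. g (x, eps \<omega>))
         *\<^sub>R outer_product (vector [1, 0, 0]) (vector [1, 0, 0])"

definition Sigma_b ::
  "'a measure \<Rightarrow> ('a \<Rightarrow> real) \<Rightarrow> real \<Rightarrow> (real \<times> real \<Rightarrow> real) \<Rightarrow> (real \<times> real \<Rightarrow> real)
     \<Rightarrow> real ^ 3 ^ 3" where
  "Sigma_b M eps x f g =
     cov_matrix M
       (\<lambda>\<omega>. vector [f (x, eps \<omega>), f (x, eps \<omega>), (f (x, eps \<omega>))\<^sup>2] :: real ^ 3)
       (\<lambda>\<omega>. vector [g (x, eps \<omega>), g (x, eps \<omega>), (g (x, eps \<omega>))\<^sup>2] :: real ^ 3)"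

definition Sigma_1 ::
  "'a measure \<Rightarrow> ('a \<Rightarrow> real) \<Rightarrow> ('a \<Rightarrow> real) \<Rightarrow> (real \<times> real \<Rightarrow> real) \<Rightarrow> (real \<times> real \<Rightarrow> real)
     \<Rightarrow> real ^ 3 ^ 3" where
  "Sigma_1 M X eps f g =
     (\<chi> i j. prob_space.expectation M
        (\<lambda>\<omega>. hadamard (Sigma_a M eps (X \<omega>) f g) (Sigma_b M eps (X \<omega>) f g) $ i $ j))"

definition sobol_vec ::
  "'a measure \<Rightarrow> ('a \<Rightarrow> real) \<Rightarrow> ('a \<Rightarrow> real) \<Rightarrow> (real \<times> real \<Rightarrow> real) \<Rightarrow> real ^ 3" where
  "sobol_vec M X eps f =
     (let Y = (\<lambda>\<omega>. f (X \<omega>, eps \<omega>)); \<rho> = sobol_index M X Y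
      in (1 / prob_space.variance M Y)
           *\<^sub>R vector [1, 2 * prob_space.expectation M Y * (\<rho> - 1), - \<rho>])"

definition sobol_variance ::
  "'a measure \<Rightarrow> ('a \<Rightarrow> real) \<Rightarrow> ('a \<Rightarrow> real) \<Rightarrow> (real \<times> real \<Rightarrow> real) \<Rightarrow> real" where
  "sobol_variance M X eps f =
     sobol_vec M X eps f
       \<bullet> ((Sigma_0 M X eps f f + Sigma_1 M X eps f f) *v sobol_vec M X eps f)"

end

theory Submission
  imports Defs
begin

text \<open>
  The estimator is a smooth function of the averages of \<open>Y\<^sub>i Y\<^sub>N\<^sub>(\<^sub>i\<^sub>)\<close>, \<open>Y\<^sub>i\<close> and \<open>Y\<^sub>i\<^sup>2\<close>.
  A linear combination \<open>T\<close> of the three sums with weights \<open>a\<close>, \<open>b\<close>, \<open>c\<close> decomposes as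
  \<open>T = B + (\<Sum>i. h(X\<^sub>i)) - a/2 * Q\<close>, where \<open>Q = (\<Sum>i. (\<phi>(X\<^sub>i) - \<phi>(X\<^sub>N\<^sub>(\<^sub>i\<^sub>)))\<^sup>2)\<close> and \<open>B\<close> is centred given the
  covariates.

  Along the cyclic order the indicator of a half-line changes at most twice. The sets whose indicator
  changes \<open>o(n)\<close> times form a sigma-algebra, and \<open>L\<^sup>1\<close>-approximation yields
  \<open>(1/n) E (\<Sum>i. \<bar>g(X\<^sub>i) - g(X\<^sub>N\<^sub>(\<^sub>i\<^sub>))\<bar>) \<rightarrow> 0\<close> for every integrable \<open>g\<close>. In particular \<open>E Q = n \<Delta>\<^sub>n = o(n)\<close>. Since
  deleting one observation changes \<open>Q\<close> by at most the two squared increments at it, the Efron--Stein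
  inequality gives \<open>Var Q = O(E Q) = o(n)\<close>: only the mean of \<open>Q\<close> survives, as the bias.

  Given the covariates, \<open>B\<close> is a sum of bounded variables each of which depends on the noise of two
  observations. The characteristic function \<open>\<psi>\<close> of a normalised sum of locally dependent
  variables solves \<open>\<psi>'(t) = - t \<sigma>\<^sup>2 \<psi>(t)\<close> up to \<open>O(n\<^sup>-\<^sup>1\<^sup>/\<^sup>2)\<close>, which gives a central limit theorem with a
  bound that is uniform in the covariates.

  \<open>T\<close> changes by a bounded amount when an observation is added and its variance is \<open>O(n)\<close>, so almost
  sure convergence along \<open>n = k\<^sup>2\<close>, which is a matter of summable second moments, extends to all \<open>n\<close>.
\<close>

section \<open>The cyclic successor in a finite sample\<close>

text \<open>Since the successor map permutes the sample, the sum of the products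
  \<open>\<phi>(X_i) \<phi>(X_N(i))\<close> is the sum of the \<open>\<phi>(X_i)^2\<close> minus
  \<open>Q / 2\<close>: hence the factor 1/2 and the sign of the bias. The noise sits on the links
  of a random cycle, and the conditional limit theorem needs an error free of the covariates in
  order to be integrated over them. What still depends on the covariates is the conditional variance
  of \<open>B\<close>, a function of neighbouring values; as neighbours are close, it tends in mean
  to a constant. So the conditional characteristic function of \<open>B\<close> becomes
  deterministic and factors out, and the variances of \<open>B\<close> and of the sum of the
  \<open>h(X_i)\<close> add up; they are the contributions of \<open>Sigma_1\<close> and
  \<open>Sigma_0\<close>. The ratio is linearised inside characteristic functions. A small
  denominator has probability O(1/n), and there the trivial bound 2 is enough; elsewhere the
  remainder is a product of two deviations, or a deviation times \<Delta>_n. This is where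
  \<Delta>_n \<rightarrow> 0 enters the centred statement, without any rate.\<close>

text \<open>
  The right neighbour of \<open>i\<close> among the observations with index in \<open>A\<close>; an arbitrary index set is
  needed because observations will be deleted. In the presence of ties the least admissible index
  is taken, which keeps the function measurable.
\<close>

definition is_cyc_next :: "nat set \<Rightarrow> (nat \<Rightarrow> real) \<Rightarrow> nat \<Rightarrow> nat \<Rightarrow> bool" where
  "is_cyc_next A x i k \<longleftrightarrow> k \<in> A \<and>
     ((x i < x k \<and> (\<forall>l\<in>A. x i < x l \<longrightarrow> x k \<le> x l)) \<or>
      ((\<forall>l\<in>A. x l \<le> x i) \<and> (\<forall>l\<in>A. x k \<le> x l)))"

definition cyc_next :: "nat set \<Rightarrow> (nat \<Rightarrow> real) \<Rightarrow> nat \<Rightarrow> nat" where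
  "cyc_next A x i = (LEAST k. is_cyc_next A x i k)"

lemma ex_min_on:
  fixes x :: "nat \<Rightarrow> real"
  assumes "finite S" "S \<noteq> {}"
  obtains k where "k \<in> S" "\<And>l. l \<in> S \<Longrightarrow> x k \<le> x l"
proof -
  have "Min (x ` S) \<in> x ` S" using assms by (intro Min_in) auto
  then obtain k where "k \<in> S" "x k = Min (x ` S)" by auto
  with assms show ?thesis by (intro that[of k]) auto
qed

lemma ex_is_cyc_next:
  assumes "finite A" "A \<noteq> {}"
  shows "\<exists>k. is_cyc_next A x i k"
proof (cases "{l\<in>A. x i < x l} = {}")
  case True
  obtain k where "k \<in> A" "\<And>l. l \<in> A \<Longrightarrow> x k \<le> x l"
    using ex_min_on[OF assms] by blast
  then have "is_cyc_next A x i k" using True unfolding is_cyc_next_def by force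
  then show ?thesis ..
next
  case False
  have "finite {l\<in>A. x i < x l}" using assms by simp
  then obtain k where "k \<in> {l\<in>A. x i < x l}" "\<And>l. l \<in> {l\<in>A. x i < x l} \<Longrightarrow> x k \<le> x l"
    using ex_min_on[OF _ False] by blast
  then show ?thesis unfolding is_cyc_next_def by auto
qed

lemma is_cyc_next_unique:
  assumes "inj_on x A" "is_cyc_next A x i k" "is_cyc_next A x i l"
  shows "k = l"
proof -
  have kl: "k \<in> A" "l \<in> A" using assms(2,3) unfolding is_cyc_next_def by auto
  moreover have "x k = x l"
  proof (cases "x i < x k")
    case True
    then have "x i < x l" using assms(2,3) kl unfolding is_cyc_next_def by (meson leD)
    with True have "x k \<le> x l" "x l \<le> x k"
      using assms(2,3) kl unfolding is_cyc_next_def by (meson leD)+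
    then show ?thesis by simp
  next
    case False
    then have "\<not> x i < x l" using assms(2,3) kl unfolding is_cyc_next_def by (meson leD)
    with False have "x k \<le> x l" "x l \<le> x k"
      using assms(2,3) kl unfolding is_cyc_next_def by meson+
    then show ?thesis by simp
  qed
  ultimately show ?thesis using assms(1) by (auto dest: inj_onD)
qed

lemma is_cyc_next_cyc_next:
  "finite A \<Longrightarrow> A \<noteq> {} \<Longrightarrow> is_cyc_next A x i (cyc_next A x i)"
  unfolding cyc_next_def by (rule LeastI_ex) (rule ex_is_cyc_next)

text \<open>Off ties the successor is unique, so every later identification of
  \<open>cyc_next\<close> consists in exhibiting one candidate for \<open>is_cyc_next\<close>; the
  \<open>LEAST\<close> never has to be computed.\<close>

lemma cyc_next_eqI:
  assumes "inj_on x A" "finite A" "is_cyc_next A x i k"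
  shows "cyc_next A x i = k"
proof -
  have "A \<noteq> {}" using assms(3) by (auto simp: is_cyc_next_def)
  then show ?thesis
    using is_cyc_next_unique[OF assms(1) is_cyc_next_cyc_next[OF assms(2)] assms(3)] by simp
qed

lemma cyc_next_in: "finite A \<Longrightarrow> A \<noteq> {} \<Longrightarrow> cyc_next A x i \<in> A"
  using is_cyc_next_cyc_next is_cyc_next_def by blast

lemma cyc_next_cong:
  assumes "\<And>j. j \<in> A \<Longrightarrow> x j = y j" "i \<in> A"
  shows "cyc_next A x i = cyc_next A y i"
proof -
  have "is_cyc_next A x i k \<longleftrightarrow> is_cyc_next A y i k" for k
    unfolding is_cyc_next_def using assms by auto
  then show ?thesis unfolding cyc_next_def by presburger
qed

text \<open>The successor of the smaller of two observations lies above it and not above the larger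
  one, whereas the successor of the larger one lies strictly above it or is the minimum of the
  sample.\<close>

lemma inj_on_cyc_next:
  assumes A: "finite A" and inj: "inj_on x A"
  shows "inj_on (cyc_next A x) A"
proof (rule inj_onI)
  have *: "\<not> (x i < x j)" if "i \<in> A" "j \<in> A" "cyc_next A x i = cyc_next A x j" for i j
  proof
    assume less: "x i < x j"
    have "is_cyc_next A x i (cyc_next A x i)" "is_cyc_next A x j (cyc_next A x i)"
      using is_cyc_next_cyc_next[OF A, of x i] is_cyc_next_cyc_next[OF A, of x j] that by auto
    then show False using less that(1,2) unfolding is_cyc_next_def
      by (meson leD le_less_trans less_le_trans)
  qed
  fix i j assume "i \<in> A" "j \<in> A" "cyc_next A x i = cyc_next A x j"
  then have "x i = x j" using *[of i j] *[of j i] by auto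
  then show "i = j" using \<open>i \<in> A\<close> \<open>j \<in> A\<close> inj by (auto dest: inj_onD)
qed

lemma bij_betw_cyc_next:
  assumes A: "finite A" and inj: "inj_on x A"
  shows "bij_betw (cyc_next A x) A A"
proof (cases "A = {}")
  case False
  then have "cyc_next A x ` A \<subseteq> A" using cyc_next_in[OF A] by auto
  then show ?thesis using inj_on_cyc_next[OF A inj] A
    by (simp add: bij_betw_def endo_inj_surj)
qed (simp add: bij_betw_def)

lemma cyc_next_neq:
  assumes A: "finite A" and inj: "inj_on x A" and card: "card A \<ge> 2" and i: "i \<in> A"
  shows "cyc_next A x i \<noteq> i"
proof
  assume "cyc_next A x i = i"
  then have "is_cyc_next A x i i" using is_cyc_next_cyc_next[OF A, of x i] i by auto
  then have "\<forall>l\<in>A. x l = x i" unfolding is_cyc_next_def by force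
  then have "A \<subseteq> {i}" using inj i by (auto dest: inj_onD)
  then have "card A \<le> 1" using card_mono[of "{i}" A] by simp
  then show False using card by simp
qed

text \<open>A cycle of length two leaves no room for a third observation. This is the source of the
  condition \<open>n \<ge> 3\<close> below: two observations are then joined by at most one link,
  which makes distinct noise terms uncorrelated.\<close>

lemma cyc_next_cyc_next_neq:
  assumes A: "finite A" and inj: "inj_on x A" and card: "card A \<ge> 3" and i: "i \<in> A"
  shows "cyc_next A x (cyc_next A x i) \<noteq> i"
proof
  let ?k = "cyc_next A x i"
  assume eq: "cyc_next A x ?k = i"
  have k: "?k \<in> A" using cyc_next_in[OF A] i by auto
  have r1: "is_cyc_next A x i ?k" using is_cyc_next_cyc_next[OF A, of x i] i by auto
  have r2: "is_cyc_next A x ?k i" using is_cyc_next_cyc_next[OF A, of x ?k] eq i by auto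
  have neq: "x i \<noteq> x ?k" using cyc_next_neq[OF A inj _ i] card inj i k by (auto dest: inj_onD)
  have "x l = x i \<or> x l = x ?k" if "l \<in> A" for l
    using r1 r2 neq that i k unfolding is_cyc_next_def by (smt (verit))
  then have "A \<subseteq> {i, ?k}" using inj i k by (auto dest: inj_onD)
  then have "card A \<le> card {i, ?k}" by (intro card_mono) auto
  also have "\<dots> \<le> 2" by (simp add: card_insert_le_m1)
  finally show False using card by simp
qed

lemma sum_cyc_next:
  fixes g :: "nat \<Rightarrow> 'b::comm_monoid_add"
  assumes "finite A" "inj_on x A"
  shows "(\<Sum>i\<in>A. g (cyc_next A x i)) = (\<Sum>i\<in>A. g i)"
  using sum.reindex_bij_betw[OF bij_betw_cyc_next[OF assms], of g] .

text \<open>Deleting \<open>i\<close> replaces the link from \<open>p\<close> to \<open>i\<close>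
  and the link leaving \<open>i\<close> by a single link, and all others stay; with two points the
  new link is the loop at \<open>p\<close>. An arbitrary link function \<open>G\<close> serves both
  the squared increments in \<open>Q\<close> and the products in the estimator.\<close>

lemma sum_cyc_next_delete:
  fixes G :: "nat \<Rightarrow> nat \<Rightarrow> real"
  assumes A: "finite A" and inj: "inj_on x A" and card: "card A \<ge> 2" and i: "i \<in> A"
    and p: "p \<in> A" "cyc_next A x p = i"
  shows "(\<Sum>j\<in>A. G j (cyc_next A x j)) - (\<Sum>j\<in>A - {i}. G j (cyc_next (A - {i}) x j))
    = G p i + G i (cyc_next A x i) - G p (cyc_next A x i)"
proof -
  let ?n = "cyc_next A x i" and ?B = "A - {i}"
  have ne: "A \<noteq> {}" using i by auto
  have pi: "p \<noteq> i" using cyc_next_neq[OF A inj card p(1)] p(2) by auto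
  have ni: "?n \<noteq> i" using cyc_next_neq[OF A inj card i] .
  have nA: "?n \<in> A" using cyc_next_in[OF A ne] .
  have injB: "inj_on x ?B" using inj by (rule inj_on_subset) auto
  \<comment> \<open>By injectivity only \<open>p\<close> points to \<open>i\<close>; a successor
    that survives the deletion is still a successor in the smaller set.\<close>
  have 1: "cyc_next ?B x j = cyc_next A x j" if "j \<in> ?B - {p}" for j
  proof (rule cyc_next_eqI[OF injB])
    have "cyc_next A x j \<noteq> i"
      using inj_onD[OF inj_on_cyc_next[OF A inj], of j p] that p by auto
    then show "is_cyc_next ?B x j (cyc_next A x j)"
      using is_cyc_next_cyc_next[OF A ne, of x j] that unfolding is_cyc_next_def by blast
  qed (use A in auto)
  have 2: "cyc_next ?B x p = ?n"
  proof (rule cyc_next_eqI[OF injB])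
    have r1: "is_cyc_next A x p i" using is_cyc_next_cyc_next[OF A ne, of x p] p by simp
    have r2: "is_cyc_next A x i ?n" using is_cyc_next_cyc_next[OF A ne, of x i] .
    have d: "x l \<noteq> x i" if "l \<in> A" "l \<noteq> i" for l using inj that i by (auto dest: inj_onD)
    have d1: "x p \<noteq> x i" "x ?n \<noteq> x i" using d p(1) pi nA ni by auto
    have d2: "x i < x l \<or> x l < x i" if "l \<in> ?B" for l using d[of l] that by force
    \<comment> \<open>Three positions of the gap: \<open>i\<close> lies strictly between
      \<open>p\<close> and \<open>?n\<close>, or \<open>i\<close> is the maximum, or
      \<open>i\<close> is the minimum and \<open>p\<close> the maximum. In the last two cases the
      new link is the wrap-around.\<close>
    show "is_cyc_next ?B x p ?n"
    proof (cases "x p < x i")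
      case True
      then have a: "x i \<le> x l" if "l \<in> A" "x p < x l" for l
        using r1 i that unfolding is_cyc_next_def by force
      show ?thesis
      proof (cases "x i < x ?n")
        case T2: True
        then have "x ?n \<le> x l" if "l \<in> A" "x i < x l" for l
          using r2 nA that unfolding is_cyc_next_def by force
        then show ?thesis unfolding is_cyc_next_def using True T2 a d2 nA ni by force
      next
        case False
        then have "\<forall>l\<in>A. x l \<le> x i" "\<forall>l\<in>A. x ?n \<le> x l"
          using r2 unfolding is_cyc_next_def by auto
        then show ?thesis unfolding is_cyc_next_def using a d2 nA ni
          by (metis Diff_iff leD leI singletonD)
      qed
    next
      case False
      then have b: "\<forall>l\<in>A. x l \<le> x p" "\<forall>l\<in>A. x i \<le> x l"
        using r1 unfolding is_cyc_next_def by auto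
      then have "x i < x ?n" using d1 nA by force
      then have "x ?n \<le> x l" if "l \<in> A" "x i < x l" for l
          using r2 nA that unfolding is_cyc_next_def by force
      then show ?thesis unfolding is_cyc_next_def using b d2 nA ni by force
    qed
  qed (use A in auto)
  have "(\<Sum>j\<in>A. G j (cyc_next A x j)) = G i ?n + (\<Sum>j\<in>?B. G j (cyc_next A x j))"
    using A i by (simp add: sum.remove)
  also have "(\<Sum>j\<in>?B. G j (cyc_next A x j)) = G p i + (\<Sum>j\<in>?B - {p}. G j (cyc_next A x j))"
    using A p pi by (subst sum.remove[of ?B p]) auto
  finally have 3: "(\<Sum>j\<in>A. G j (cyc_next A x j)) = G i ?n + G p i + (\<Sum>j\<in>?B - {p}. G j (cyc_next A x j))"
    by simp
  have "(\<Sum>j\<in>?B. G j (cyc_next ?B x j)) = G p ?n + (\<Sum>j\<in>?B - {p}. G j (cyc_next ?B x j))"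
    using A p pi 2 by (subst sum.remove[of ?B p]) auto
  also have "(\<Sum>j\<in>?B - {p}. G j (cyc_next ?B x j)) = (\<Sum>j\<in>?B - {p}. G j (cyc_next A x j))"
    by (intro sum.cong refl) (simp only: 1)
  finally show ?thesis using 3 by simp
qed

text \<open>The half-line is left only at the largest observation in it, and entered only from the
  maximum of the sample; \<open>?S1\<close> and \<open>?S2\<close> collect the two kinds of links,
  each with at most one element.\<close>

lemma cyc_next_atMost_crossings:
  fixes t :: real
  assumes A: "finite A" and inj: "inj_on x A"
  shows "(\<Sum>i\<in>A. \<bar>indicator {..t} (x i) - indicator {..t} (x (cyc_next A x i))\<bar>) \<le> (2::real)"
proof (cases "A = {}")
  case False
  let ?S1 = "{i\<in>A. x i \<le> t \<and> t < x (cyc_next A x i)}"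
  let ?S2 = "{i\<in>A. t < x i \<and> x (cyc_next A x i) \<le> t}"
  note r = is_cyc_next_cyc_next[OF A False, of x, unfolded is_cyc_next_def]
  have "i = j" if "i \<in> ?S1" "j \<in> ?S1" for i j
  proof -
    have "\<not> x i < x j" "\<not> x j < x i" using that r[of i] r[of j] by force+
    then show ?thesis using that inj by (auto simp: inj_on_def)
  qed
  then have c1: "card ?S1 \<le> 1" using A by (intro card_le_Suc0_iff_eq[THEN iffD2, folded One_nat_def]) auto
  have "i = j" if "i \<in> ?S2" "j \<in> ?S2" for i j
  proof -
    have "\<not> x i < x j" "\<not> x j < x i" using that r[of i] r[of j] by force+
    then show ?thesis using that inj by (auto simp: inj_on_def)
  qed
  then have c2: "card ?S2 \<le> 1" using A by (intro card_le_Suc0_iff_eq[THEN iffD2, folded One_nat_def]) auto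
  have "(\<Sum>i\<in>A. \<bar>indicator {..t} (x i) - indicator {..t} (x (cyc_next A x i))\<bar>)
      = (\<Sum>i\<in>A. (if i \<in> ?S1 then 1 else 0) + (if i \<in> ?S2 then 1 else (0::real)))"
    by (intro sum.cong) (auto simp: indicator_def)
  also have "\<dots> = real (card ?S1) + real (card ?S2)"
    using A by (simp add: sum.distrib sum.If_cases Int_def)
  finally show ?thesis using c1 c2 by linarith
qed auto

text \<open>Relabelling the observations commutes with taking successors. Together with the
  invariance of the product law under permutations this is the exchangeability behind the two
  expressions for \<open>Delta\<close>.\<close>

lemma cyc_next_permute:
  assumes A: "finite A" and inj: "inj_on x A" and p: "p permutes A" and i: "i \<in> A"
  shows "p (cyc_next A (\<lambda>j. x (p j)) i) = cyc_next A x (p i)"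
proof -
  have pA: "p ` A = A" using p by (rule permutes_image)
  have inj': "inj_on (\<lambda>j. x (p j)) A"
    using comp_inj_on[of p A x] permutes_inj_on[OF p] inj pA by (simp add: comp_def)
  have "is_cyc_next A x (p i) (p k)" if "is_cyc_next A (\<lambda>j. x (p j)) i k" for k
    using that pA unfolding is_cyc_next_def by (smt (verit, best) imageE image_eqI)
  then have "is_cyc_next A x (p i) (p (cyc_next A (\<lambda>j. x (p j)) i))"
    using is_cyc_next_cyc_next[OF A] i by blast
  from cyc_next_eqI[OF inj A this] show ?thesis by simp
qed

section \<open>Sorting permutations and the right neighbour\<close>

lemma is_cyc_next_sorts:
  assumes s: "sorts n x \<sigma>" and k: "k \<in> {1..n}"
  shows "is_cyc_next {1..n} x (\<sigma> k) (\<sigma> (if k = n then 1 else k + 1))"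
proof -
  have p: "\<sigma> permutes {1..n}" and m: "strict_mono_on {1..n} (\<lambda>i. x (\<sigma> i))"
    using s by (auto simp: sorts_def)
  have le: "x (\<sigma> a) \<le> x (\<sigma> b)" if "a \<in> {1..n}" "b \<in> {1..n}" "a \<le> b" for a b
    using strict_mono_on_leD[OF m that] .
  have less: "a < b" if "a \<in> {1..n}" "b \<in> {1..n}" "x (\<sigma> a) < x (\<sigma> b)" for a b
    using le[of b a] that by force
  have ex: "\<exists>j\<in>{1..n}. l = \<sigma> j" if "l \<in> {1..n}" for l
    using permutes_image[OF p] that by auto
  have in': "\<sigma> j \<in> {1..n}" if "j \<in> {1..n}" for j
    using permutes_in_image[OF p, of j] that by auto
  show ?thesis
  proof (cases "k = n")
    case True
    have "x l \<le> x (\<sigma> k)" "x (\<sigma> 1) \<le> x l" if l: "l \<in> {1..n}" for l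
    proof -
      obtain j where "j \<in> {1..n}" "l = \<sigma> j" using ex[OF l] by auto
      then show "x l \<le> x (\<sigma> k)" "x (\<sigma> 1) \<le> x l" using le[of j k] le[of 1 j] k True by auto
    qed
    then show ?thesis using True in'[of 1] k unfolding is_cyc_next_def by auto
  next
    case False
    then have k1: "k + 1 \<in> {1..n}" using k by auto
    have "x (\<sigma> (k + 1)) \<le> x l" if l: "l \<in> {1..n}" "x (\<sigma> k) < x l" for l
    proof -
      obtain j where j: "j \<in> {1..n}" "l = \<sigma> j" using ex[OF l(1)] by auto
      then have "k < j" using less[of k j] k l by auto
      then show ?thesis using le[of "k + 1" j] k1 j by auto
    qed
    moreover have "x (\<sigma> k) < x (\<sigma> (k + 1))" using strict_mono_onD[OF m k k1] by simp
    ultimately show ?thesis using False in'[OF k1] unfolding is_cyc_next_def by auto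
  qed
qed

lemma sorts_imp_inj: "sorts n x \<sigma> \<Longrightarrow> inj_on x {1..n}"
proof -
  assume s: "sorts n x \<sigma>"
  then have p: "\<sigma> permutes {1..n}" and "inj_on (x \<circ> \<sigma>) {1..n}"
    by (auto simp: sorts_def comp_def dest: strict_mono_on_imp_inj_on)
  then show ?thesis using inj_on_imageI[of x \<sigma> "{1..n}"] permutes_image[OF p] by simp
qed

text \<open>Existence: position \<open>k\<close> receives the index of entry \<open>k - 1\<close> of
  the sorted list of values, lists being numbered from 0. Uniqueness: two sorting permutations both
  put the maximum at position \<open>n\<close>, and from there both follow the unique cyclic
  successor, first to position 1 and then onwards.\<close>

lemma ex1_sorts:
  assumes inj: "inj_on x {1..n}"
  shows "\<exists>!\<sigma>. sorts n x \<sigma>"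
proof (rule ex_ex1I)
  let ?A = "{1..n}"
  let ?L = "sorted_list_of_set (x ` ?A)"
  define \<sigma> where "\<sigma> k = (if k \<in> ?A then the_inv_into ?A x (?L ! (k - 1)) else k)" for k
  have len: "length ?L = n" using card_image[OF inj] by simp
  have set: "set ?L = x ` ?A" by simp
  have L: "?L ! (k - 1) \<in> x ` ?A" if "k \<in> ?A" for k
  proof -
    have "?L ! (k - 1) \<in> set ?L" using that len by (intro nth_mem) auto
    then show ?thesis using set by simp
  qed
  have x\<sigma>: "x (\<sigma> k) = ?L ! (k - 1)" "\<sigma> k \<in> ?A" if "k \<in> ?A" for k
    using f_the_inv_into_f[OF inj L[OF that]] the_inv_into_into[OF inj L[OF that] order_refl] that
    unfolding \<sigma>_def by presburger+
  have sm: "strict_mono_on ?A (\<lambda>i. x (\<sigma> i))"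
  proof (rule strict_mono_onI)
    fix r s assume "r \<in> ?A" "s \<in> ?A" "r < s"
    then show "x (\<sigma> r) < x (\<sigma> s)" using x\<sigma>[of r] x\<sigma>[of s] len
      strict_sorted_list_of_set[of "x ` ?A"] by (auto simp: sorted_wrt_iff_nth_less)
  qed
  have "inj_on \<sigma> ?A" using strict_mono_on_imp_inj_on[OF sm] unfolding inj_on_def by metis
  moreover have "\<sigma> ` ?A \<subseteq> ?A" using x\<sigma>(2) by blast
  ultimately have "bij_betw \<sigma> ?A ?A" unfolding bij_betw_def
    using endo_inj_surj[OF finite_atLeastAtMost] by blast
  then have "\<sigma> permutes ?A" by (rule bij_imp_permutes) (auto simp: \<sigma>_def)
  then show "\<exists>\<sigma>. sorts n x \<sigma>" using sm unfolding sorts_def by auto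
next
  fix \<sigma> \<tau> assume s: "sorts n x \<sigma>" "sorts n x \<tau>"
  then have ps: "\<sigma> permutes {1..n}" "\<tau> permutes {1..n}" by (auto simp: sorts_def)
  have "\<sigma> (Suc k) = \<tau> (Suc k)" if "Suc k \<le> n" for k
    using that
  proof (induction k)
    case 0
    have "is_cyc_next {1..n} x (\<sigma> n) (\<sigma> 1)" "is_cyc_next {1..n} x (\<tau> n) (\<tau> 1)"
      using is_cyc_next_sorts[OF s(1), of n] is_cyc_next_sorts[OF s(2), of n] 0 by auto
    moreover have *: "\<forall>l\<in>{1..n}. x l \<le> x (\<rho> n)" if r: "sorts n x \<rho>" for \<rho>
    proof
      fix l assume l: "l \<in> {1..n}"
      have "\<rho> permutes {1..n}" using r by (simp add: sorts_def)
      then have "l \<in> \<rho> ` {1..n}" using l permutes_image[of \<rho> "{1..n}"] by simp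
      then obtain j where "j \<in> {1..n}" "l = \<rho> j" by blast
      then show "x l \<le> x (\<rho> n)" using r strict_mono_on_leD[of "{1..n}" "\<lambda>i. x (\<rho> i)" j n]
        by (auto simp: sorts_def)
    qed
    moreover have "\<sigma> n \<in> {1..n}" "\<tau> n \<in> {1..n}"
      using permutes_in_image[OF ps(1), of n] permutes_in_image[OF ps(2), of n] 0 by auto
    ultimately have "\<sigma> n = \<tau> n" using *[OF s(1)] *[OF s(2)] inj
      by (meson antisym inj_onD)
    then show ?case using is_cyc_next_unique[OF inj, of "\<sigma> n" "\<sigma> 1" "\<tau> 1"]
      \<open>is_cyc_next {1..n} x (\<sigma> n) (\<sigma> 1)\<close> \<open>is_cyc_next {1..n} x (\<tau> n) (\<tau> 1)\<close> by simp
  next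
    case (Suc k)
    then show ?case
      using is_cyc_next_sorts[OF s(1), of "Suc k"] is_cyc_next_sorts[OF s(2), of "Suc k"]
        is_cyc_next_unique[OF inj, of "\<sigma> (Suc k)"] by auto
  qed
  then have "\<sigma> k = \<tau> k" if "k \<in> {1..n}" for k using that by (cases k) auto
  moreover have "\<sigma> k = \<tau> k" if "k \<notin> {1..n}" for k
    using ps that by (simp add: permutes_def)
  ultimately show "\<sigma> = \<tau>" by blast
qed

lemma sort_perm_sorts: "inj_on x {1..n} \<Longrightarrow> sorts n x (sort_perm n x)"
  using ex1_sorts theI'[of "sorts n x"] by (simp add: sort_perm_def)

lemma sort_perm_ties: "\<not> inj_on x {1..n} \<Longrightarrow> sort_perm n x = id"
  using sorts_imp_inj by (auto simp: sort_perm_def)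

lemma sort_perm_permutes: "sort_perm n x permutes {1..n}"
  using sort_perm_sorts[of x n] sort_perm_ties[of x n] permutes_id
  by (cases "inj_on x {1..n}") (auto simp: sorts_def)

text \<open>A tie makes \<open>sort_perm\<close> the identity, which is still a permutation, so the
  formula holds for every sample; ties matter only once positions are compared with values.\<close>

lemma right_neighbour_sort_perm:
  assumes k: "k \<in> {1..n}"
  shows "right_neighbour n x (sort_perm n x k) = sort_perm n x (if k = n then 1 else k + 1)"
proof -
  have "inv (sort_perm n x) (sort_perm n x k) = k"
    using permutes_inverses(2)[OF sort_perm_permutes] by simp
  moreover have "(if (k + 1) mod n = 0 then n else (k + 1) mod n) = (if k = n then 1 else k + 1)"
  proof (cases "k = n")
    case True
    \<comment> \<open>For \<open>n = 1\<close> the residue of \<open>k + 1\<close> is 0, which is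
      read as position \<open>n = 1\<close>; for larger \<open>n\<close> it is 1.\<close>
    then show ?thesis using k by (cases "n = 1") (auto simp: mod_Suc)
  next
    case False
    then have "k + 1 < n \<or> k + 1 = n" using k by auto
    then show ?thesis using False by auto
  qed
  ultimately show ?thesis
    unfolding right_neighbour_def sort_perm_periodic_def by presburger
qed

text \<open>The bridge from sorted positions to the successor in the order of the values. The branch
  for ties is a cyclic shift of the indices; being explicit, it keeps the right neighbour measurable
  on the whole space.\<close>

lemma right_neighbour_eq:
  assumes j: "j \<in> {1..n}"
  shows "right_neighbour n x j
    = (if inj_on x {1..n} then cyc_next {1..n} x j else if j = n then 1 else j + 1)"
proof (cases "inj_on x {1..n}")
  case True
  have "j \<in> sort_perm n x ` {1..n}"
    using permutes_image[OF sort_perm_permutes[of n x]] j by simp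
  then obtain k where k: "k \<in> {1..n}" "j = sort_perm n x k" by blast
  have "cyc_next {1..n} x j = right_neighbour n x j"
    using cyc_next_eqI[OF True _ is_cyc_next_sorts[OF sort_perm_sorts[OF True] k(1)]]
      right_neighbour_sort_perm[OF k(1), of x] k(2) by simp
  then show ?thesis using True by simp
next
  case False
  then show ?thesis using right_neighbour_sort_perm[OF j, of x] sort_perm_ties[OF False] by simp
qed

text \<open>The shift \<open>c\<close> sends a position to the cyclically next one, so the positions
  \<open>c k - 1\<close> and \<open>c k\<close> hold a point and its right neighbour. In the
  wrap-around pair \<open>c k - 1\<close> is 0, which the periodic extension reads as
  \<open>n\<close>.\<close>

lemma sum_sort_perm_periodic:
  fixes G :: "nat \<Rightarrow> nat \<Rightarrow> real"
  assumes n: "n \<ge> 1"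
  shows "(\<Sum>i = 1..n. G (sort_perm_periodic n x (i - 1)) (sort_perm_periodic n x i))
    = (\<Sum>i = 1..n. G i (right_neighbour n x i))"
proof -
  let ?s = "sort_perm n x"
  have bij: "bij_betw ?s {1..n} {1..n}" using sort_perm_permutes by (rule permutes_imp_bij)
  define c where "c k = (if k = n then 1 else k + 1)" for k :: nat
  have c: "bij_betw c {1..n} {1..n}"
    by (rule bij_betw_byWitness[where f' = "\<lambda>k. if k = 1 then n else k - 1"])
       (use n in \<open>auto simp: c_def split: if_splits\<close>)
  have sp: "sort_perm_periodic n x i = ?s i" if "i \<in> {1..n}" for i
    using that by (cases "i = n") (auto simp: sort_perm_periodic_def)
  have sp1: "sort_perm_periodic n x (c k - 1) = ?s k" if "k \<in> {1..n}" for k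
    using that by (cases "k = n") (auto simp: sort_perm_periodic_def c_def)
  have "(\<Sum>i = 1..n. G i (right_neighbour n x i)) = (\<Sum>k = 1..n. G (?s k) (right_neighbour n x (?s k)))"
    by (rule sum.reindex_bij_betw[OF bij, symmetric])
  also have "\<dots> = (\<Sum>k = 1..n. G (sort_perm_periodic n x (c k - 1)) (sort_perm_periodic n x (c k)))"
  proof (intro sum.cong refl)
    fix k assume k: "k \<in> {1..n}"
    then have "c k \<in> {1..n}" using bij_betwE[OF c] by auto
    then show "G (?s k) (right_neighbour n x (?s k)) =
      G (sort_perm_periodic n x (c k - 1)) (sort_perm_periodic n x (c k))"
      using k sp sp1 right_neighbour_sort_perm[OF k, of x] by (simp add: c_def)
  qed
  also have "\<dots> = (\<Sum>i = 1..n. G (sort_perm_periodic n x (i - 1)) (sort_perm_periodic n x i))"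
    by (rule sum.reindex_bij_betw[OF c])
  finally show ?thesis by simp
qed

text \<open>Along the sorted sample the increments between consecutive points form one of the sums
  in the 2-variation. The closing increment from the largest to the smallest point obeys the same
  bound, by the sequence that consists of these two points. The total is at most twice the
  2-variation, whatever \<open>n\<close>.\<close>

lemma sum_cyc_next_bounded_2_variation:
  assumes "bounded_2_variation h"
  obtains K where "\<And>n x. inj_on x {1..n} \<Longrightarrow>
    (\<Sum>i = 1..n. (h (x i) - h (x (cyc_next {1..n} x i)))\<^sup>2) \<le> K"
proof -
  obtain K where K: "(\<Sum>i = 1..<m. (h (x (Suc i)) - h (x i))\<^sup>2) \<le> K"
    if "strict_mono_on {1..m} x" for m x
    using assms unfolding bounded_2_variation_def bdd_above_def by blast
  have "(\<Sum>i = 1..n. (h (x i) - h (x (cyc_next {1..n} x i)))\<^sup>2) \<le> 2 * K"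
    if inj: "inj_on x {1..n}" for n x
  proof (cases "n = 0")
    case True
    then show ?thesis using K[of 0 "\<lambda>x. x"] by (simp add: strict_mono_on_def)
  next
    case False
    let ?s = "sort_perm n x"
    have bij: "bij_betw ?s {1..n} {1..n}" using sort_perm_permutes by (rule permutes_imp_bij)
    have sm: "strict_mono_on {1..n} (\<lambda>i. x (?s i))" using sort_perm_sorts[OF inj] by (simp add: sorts_def)
    have "(\<Sum>i = 1..n. (h (x i) - h (x (cyc_next {1..n} x i)))\<^sup>2)
       = (\<Sum>k = 1..n. (h (x (?s k)) - h (x (cyc_next {1..n} x (?s k))))\<^sup>2)"
      by (rule sum.reindex_bij_betw[OF bij, symmetric])
    also have "\<dots> = (\<Sum>k = 1..n. (h (x (?s k)) - h (x (?s (if k = n then 1 else k + 1))))\<^sup>2)"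
    proof (intro sum.cong refl)
      fix k assume k: "k \<in> {1..n}"
      then have "?s k \<in> {1..n}" using bij_betwE[OF bij] by auto
      then show "(h (x (?s k)) - h (x (cyc_next {1..n} x (?s k))))\<^sup>2
        = (h (x (?s k)) - h (x (?s (if k = n then 1 else k + 1))))\<^sup>2"
        using right_neighbour_eq[of "?s k" n x] right_neighbour_sort_perm[OF k, of x] inj by simp
    qed
    also have "\<dots> = (\<Sum>k\<in>insert n {1..<n}. (h (x (?s k)) - h (x (?s (if k = n then 1 else k + 1))))\<^sup>2)"
      using False by (intro sum.cong) auto
    also have "(\<Sum>k\<in>insert n {1..<n}. (h (x (?s k)) - h (x (?s (if k = n then 1 else k + 1))))\<^sup>2)
      = (h (x (?s n)) - h (x (?s 1)))\<^sup>2 + (\<Sum>k = 1..<n. (h (x (?s (Suc k))) - h (x (?s k)))\<^sup>2)"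
      by (subst sum.insert) (auto intro!: sum.cong simp: power2_commute)
    also have "(\<Sum>k = 1..<n. (h (x (?s (Suc k))) - h (x (?s k)))\<^sup>2) \<le> K"
      by (rule K[OF sm])
    also have "(h (x (?s n)) - h (x (?s 1)))\<^sup>2 \<le> K"
    proof (cases "n = 1")
      case True
      then show ?thesis using K[of 0 "\<lambda>x. x"] by (simp add: strict_mono_on_def)
    next
      case F: False
      then have "x (?s 1) < x (?s n)" using strict_mono_onD[OF sm, of 1 n] False by simp
      then show ?thesis
        using K[of 2 "\<lambda>i. if i = 1 then x (?s 1) else x (?s n)"]
        by (force simp: strict_mono_on_def numeral_2_eq_2)
    qed
    finally show ?thesis by simp
  qed
  then show ?thesis by (rule that)
qed

lemma measurable_cyc_next [measurable]:
  assumes [measurable]: "finite A" "\<And>j. j \<in> A \<Longrightarrow> (\<lambda>\<omega>. x \<omega> j) \<in> borel_measurable M"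
    "(\<lambda>\<omega>. x \<omega> i) \<in> borel_measurable M"
  shows "(\<lambda>\<omega>. cyc_next A (x \<omega>) i) \<in> measurable M (count_space UNIV)"
proof -
  have *: "Measurable.pred M (\<lambda>\<omega>. is_cyc_next A (x \<omega>) i k)" for k
  proof (cases "k \<in> A")
    case True
    note [measurable] = assms(2)[OF True] 
    show ?thesis unfolding is_cyc_next_def using True
      by simp (measurable)
  qed (simp add: is_cyc_next_def)
  then show ?thesis unfolding cyc_next_def by measurable
qed

section \<open>The Efron--Stein inequality\<close>

lemma (in prob_space) integrable_bounded:
  fixes f :: "'a \<Rightarrow> 'b::{banach, second_countable_topology}"
  assumes "f \<in> borel_measurable M" "\<And>x. norm (f x) \<le> B"
  shows "integrable M f"
  using assms by (intro integrable_const_bound[where B = B]) auto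

lemma (in prob_space) norm_integral_le_bound:
  fixes f :: "'a \<Rightarrow> 'b::{banach, second_countable_topology}"
  assumes "f \<in> borel_measurable M" "\<And>x. norm (f x) \<le> B"
  shows "norm (\<integral>x. f x \<partial>M) \<le> B"
proof -
  have "0 \<le> B" using assms(2)[of undefined] norm_ge_zero order_trans by blast
  have "norm (\<integral>x. f x \<partial>M) \<le> (\<integral>x. norm (f x) \<partial>M)" by (rule integral_norm_bound)
  also have "\<dots> \<le> (\<integral>x. B \<partial>M)"
    using assms \<open>0 \<le> B\<close> by (intro integral_mono integrable_norm integrable_bounded[where B = B]) auto
  finally show ?thesis by (simp add: prob_space)
qed

text \<open>The bias-variance decomposition. With \<open>c = 0\<close> it gives the Jensen
  inequality for squares; in the Efron-Stein induction it gives the optimality of the mean among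
  constants.\<close>

lemma (in prob_space) integral_square_shift:
  fixes Z :: "'a \<Rightarrow> real"
  assumes [measurable]: "Z \<in> borel_measurable M" and b: "\<And>x. \<bar>Z x\<bar> \<le> B"
  shows "(\<integral>x. (Z x - c)\<^sup>2 \<partial>M) = (\<integral>x. (Z x - (\<integral>x. Z x \<partial>M))\<^sup>2 \<partial>M) + ((\<integral>x. Z x \<partial>M) - c)\<^sup>2"
proof -
  let ?m = "\<integral>x. Z x \<partial>M"
  have iZ: "integrable M Z" using b by (intro integrable_bounded[where B = B]) auto
  have "(Z x)\<^sup>2 \<le> B\<^sup>2" for x
    using power_mono[OF b[of x], of 2] by simp
  then have iZ2: "integrable M (\<lambda>x. (Z x)\<^sup>2)" by (intro integrable_bounded[where B = "B\<^sup>2"]) auto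
  have "(\<integral>x. (Z x - k)\<^sup>2 \<partial>M) = (\<integral>x. (Z x)\<^sup>2 \<partial>M) - 2 * k * ?m + k\<^sup>2" for k
  proof -
    have "(\<integral>x. (Z x - k)\<^sup>2 \<partial>M) = (\<integral>x. (Z x)\<^sup>2 - 2 * k * Z x + k\<^sup>2 \<partial>M)"
      by (simp add: power2_diff algebra_simps)
    then show ?thesis using iZ iZ2 by (simp add: prob_space)
  qed
  note * = this
  show ?thesis unfolding *[of c] *[of ?m] by (simp add: power2_eq_square algebra_simps)
qed

lemma (in prob_space) integral_square_le:
  fixes Z :: "'a \<Rightarrow> real"
  assumes "Z \<in> borel_measurable M" "\<And>x. \<bar>Z x\<bar> \<le> B"
  shows "(\<integral>x. Z x \<partial>M)\<^sup>2 \<le> (\<integral>x. (Z x)\<^sup>2 \<partial>M)"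
  using integral_square_shift[OF assms, of 0] by simp

lemma (in prob_space) integral_abs_le_sqrt:
  fixes Z :: "'a \<Rightarrow> real"
  assumes [measurable]: "Z \<in> borel_measurable M" and "\<And>x. \<bar>Z x\<bar> \<le> B"
  shows "(\<integral>x. \<bar>Z x\<bar> \<partial>M) \<le> sqrt (\<integral>x. (Z x)\<^sup>2 \<partial>M)"
  using integral_square_le[of "\<lambda>x. \<bar>Z x\<bar>" B] assms by (intro real_le_rsqrt) auto

lemma abs_diff_square_le:
  fixes a b :: real
  assumes "\<bar>a\<bar> \<le> A" "\<bar>b\<bar> \<le> B"
  shows "\<bar>(a - b)\<^sup>2\<bar> \<le> (A + B)\<^sup>2"
proof -
  have "\<bar>a - b\<bar> \<le> A + B" using assms by linarith
  from power_mono[OF this, of 2] show ?thesis by simp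
qed

text \<open>Induction over the coordinates. The squared deviation of \<open>g\<close> from its mean
  splits into the fluctuation in the new coordinate \<open>j\<close> and that of the average
  \<open>G\<close> over \<open>j\<close>. In the first part \<open>g' j\<close>, which is constant
  in coordinate \<open>j\<close>, does no better than the mean; the second falls under the induction
  hypothesis with the averages \<open>G' i\<close> as comparison functions. Any functions
  \<open>g' i\<close> free of coordinate \<open>i\<close> are allowed, in particular the statistic
  of the sample without observation \<open>i\<close>.\<close>

theorem Efron_Stein:
  fixes g :: "('i \<Rightarrow> 'b) \<Rightarrow> real" and g' :: "'i \<Rightarrow> ('i \<Rightarrow> 'b) \<Rightarrow> real"
  assumes D: "prob_space D" and I: "finite I"
    and "g \<in> borel_measurable (Pi\<^sub>M I (\<lambda>_. D))" "\<And>x. \<bar>g x\<bar> \<le> C"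
    and "\<And>i. i \<in> I \<Longrightarrow> g' i \<in> borel_measurable (Pi\<^sub>M I (\<lambda>_. D))"
    and "\<And>i x. i \<in> I \<Longrightarrow> \<bar>g' i x\<bar> \<le> C"
    and "\<And>i x y. i \<in> I \<Longrightarrow> g' i (x(i := y)) = g' i x"
  shows "(\<integral>x. (g x - (\<integral>x. g x \<partial>Pi\<^sub>M I (\<lambda>_. D)))\<^sup>2 \<partial>Pi\<^sub>M I (\<lambda>_. D))
    \<le> (\<Sum>i\<in>I. \<integral>x. (g x - g' i x)\<^sup>2 \<partial>Pi\<^sub>M I (\<lambda>_. D))"
  using I assms(3-)
proof (induction I arbitrary: g g' rule: finite_induct)
  case empty
  interpret E: prob_space "Pi\<^sub>M ({} :: 'i set) (\<lambda>_. D)" by (intro prob_space_PiM D)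
  have "g x - (\<integral>x. g x \<partial>Pi\<^sub>M ({} :: 'i set) (\<lambda>_. D)) = 0" if "x \<in> space (Pi\<^sub>M ({} :: 'i set) (\<lambda>_. D))" for x
  proof -
    have "(\<integral>x. g x \<partial>Pi\<^sub>M ({} :: 'i set) (\<lambda>_. D)) = (\<integral>y. g x \<partial>Pi\<^sub>M ({} :: 'i set) (\<lambda>_. D))"
    proof (intro Bochner_Integration.integral_cong refl)
      fix y assume "y \<in> space (Pi\<^sub>M ({} :: 'i set) (\<lambda>_. D))"
      then show "g y = g x" using that by (simp add: space_PiM)
    qed
    also have "\<dots> = g x" using E.prob_space by simp
    finally show ?thesis by simp
  qed
  then have "(\<integral>x. (g x - (\<integral>x. g x \<partial>Pi\<^sub>M ({} :: 'i set) (\<lambda>_. D)))\<^sup>2 \<partial>Pi\<^sub>M ({} :: 'i set) (\<lambda>_. D)) = (\<integral>x. 0 \<partial>Pi\<^sub>M ({} :: 'i set) (\<lambda>_. D))"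
    by (intro Bochner_Integration.integral_cong) auto
  then show ?case by simp
next
  case (insert j I)
  let ?\<mu> = "Pi\<^sub>M I (\<lambda>_. D)" and ?\<nu> = "Pi\<^sub>M (insert j I) (\<lambda>_. D)"
  interpret D: prob_space D by (rule D)
  interpret P: product_sigma_finite "\<lambda>_. D" by unfold_locales
  interpret mu: prob_space ?\<mu> by (intro prob_space_PiM D)
  interpret nu: prob_space ?\<nu> by (intro prob_space_PiM D)
  have C: "0 \<le> C" using insert.prems(2)[of undefined] by linarith
  have [measurable]: "(\<lambda>(x, y). x(j := y)) \<in> ?\<mu> \<Otimes>\<^sub>M D \<rightarrow>\<^sub>M ?\<nu>" by (rule measurable_add_dim)
  have meas: "(\<lambda>p. u ((fst p)(j := snd p))) \<in> borel_measurable (?\<mu> \<Otimes>\<^sub>M D)"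
    if [measurable]: "u \<in> borel_measurable ?\<nu>" for u :: "('i \<Rightarrow> 'b) \<Rightarrow> real"
    using measurable_compose[OF measurable_add_dim that] by (simp add: case_prod_unfold)
  have meas1: "(\<lambda>y. u (x(j := y))) \<in> borel_measurable D"
    if "u \<in> borel_measurable ?\<nu>" "x \<in> space ?\<mu>" for u :: "('i \<Rightarrow> 'b) \<Rightarrow> real" and x
    using measurable_compose[OF measurable_Pair1'[OF that(2)] meas[OF that(1)]] by simp
  have meas2: "(\<lambda>x. \<integral>y. u (x(j := y)) \<partial>D) \<in> borel_measurable ?\<mu>"
    if "u \<in> borel_measurable ?\<nu>" for u :: "('i \<Rightarrow> 'b) \<Rightarrow> real"
    using D.borel_measurable_lebesgue_integral[of "\<lambda>x y. u (x(j := y))" ?\<mu>] meas[OF that]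
    by (simp add: case_prod_unfold)
  have split: "(\<integral>z. u z \<partial>?\<nu>) = (\<integral>x. (\<integral>y. u (x(j := y)) \<partial>D) \<partial>?\<mu>)"
    if "u \<in> borel_measurable ?\<nu>" "\<And>z. \<bar>u z\<bar> \<le> B" for u :: "('i \<Rightarrow> 'b) \<Rightarrow> real" and B
    using that insert.hyps by (intro P.product_integral_insert nu.integrable_bounded[where B = B]) auto
  define G where "G x = (\<integral>y. g (x(j := y)) \<partial>D)" for x
  define G' where "G' i x = (\<integral>y. g' i (x(j := y)) \<partial>D)" for i x
  let ?E = "\<integral>x. G x \<partial>?\<mu>"
  note g = insert.prems(1,2) and g'm = insert.prems(3) and g'b = insert.prems(4) and g'i = insert.prems(5)
  have E: "(\<integral>x. g x \<partial>?\<nu>) = ?E" unfolding G_def by (rule split[OF g])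
  \<comment> \<open>The induction hypothesis asks for bounds at all points, also where the section
    is not measurable; its integral is 0 there by convention.\<close>
  have intb: "\<bar>\<integral>y. u (x(j := y)) \<partial>D\<bar> \<le> B" if "\<And>z. \<bar>u z\<bar> \<le> B"
    for u :: "('i \<Rightarrow> 'b) \<Rightarrow> real" and B x
  proof (cases "(\<lambda>y. u (x(j := y))) \<in> borel_measurable D")
    case True
    then show ?thesis using D.norm_integral_le_bound[OF True, of B] that by simp
  next
    case False
    then have "(\<integral>y. u (x(j := y)) \<partial>D) = 0"
      by (intro not_integrable_integral_eq) (auto dest: borel_measurable_integrable)
    then show ?thesis using that[of undefined] by linarith
  qed
  have Gb: "\<bar>G x\<bar> \<le> C" for x unfolding G_def by (rule intb[OF g(2)])
  have [measurable]: "G \<in> borel_measurable ?\<mu>" unfolding G_def by (rule meas2[OF g(1)])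
  have G'b: "\<bar>G' i x\<bar> \<le> C" if "i \<in> I" for i x
    unfolding G'_def using g'b that by (intro intb) auto
  have G'm: "G' i \<in> borel_measurable ?\<mu>" if "i \<in> I" for i
    unfolding G'_def using g'm that by (intro meas2) auto
  have Eb: "\<bar>?E\<bar> \<le> C" using mu.norm_integral_le_bound[of G C] Gb by simp
  have b4: "\<bar>(g z - k)\<^sup>2\<bar> \<le> (C + C)\<^sup>2" if "\<bar>k\<bar> \<le> C" for z k
    by (rule abs_diff_square_le[OF g(2) that])
  have m1: "(\<lambda>z. (g z - ?E)\<^sup>2) \<in> borel_measurable ?\<nu>" using g(1) by measurable
  have m2: "(\<lambda>z. (g z - g' i z)\<^sup>2) \<in> borel_measurable ?\<nu>" if "i \<in> insert j I" for i
    using g(1) g'm[OF that] by measurable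
  have b2: "\<bar>(g z - g' i z)\<^sup>2\<bar> \<le> (C + C)\<^sup>2" if "i \<in> insert j I" for i z
    using b4 g'b[OF that] by auto
  have "(\<integral>z. (g z - (\<integral>x. g x \<partial>?\<nu>))\<^sup>2 \<partial>?\<nu>) = (\<integral>x. (\<integral>y. (g (x(j := y)) - ?E)\<^sup>2 \<partial>D) \<partial>?\<mu>)"
    unfolding E by (rule split[OF m1 b4[OF Eb]])
  also have "\<dots> \<le> (\<integral>x. (\<integral>y. (g (x(j := y)) - g' j (x(j := y)))\<^sup>2 \<partial>D) + (G x - ?E)\<^sup>2 \<partial>?\<mu>)"
  proof (rule integral_mono)
    show "integrable ?\<mu> (\<lambda>x. \<integral>y. (g (x(j := y)) - ?E)\<^sup>2 \<partial>D)"
      using meas2[OF m1] intb[OF b4[OF Eb]] by (intro mu.integrable_bounded[where B = "(C + C)\<^sup>2"]) auto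
    show "integrable ?\<mu> (\<lambda>x. (\<integral>y. (g (x(j := y)) - g' j (x(j := y)))\<^sup>2 \<partial>D) + (G x - ?E)\<^sup>2)"
      using meas2[OF m2[of j]] intb[OF b2[of j]] abs_diff_square_le[OF Gb Eb]
      by (intro Bochner_Integration.integrable_add mu.integrable_bounded[where B = "(C + C)\<^sup>2"]) auto
    fix x assume x: "x \<in> space ?\<mu>"
    note mx = meas1[OF g(1) x]
    have "(\<integral>y. (g (x(j := y)) - ?E)\<^sup>2 \<partial>D) = (\<integral>y. (g (x(j := y)) - G x)\<^sup>2 \<partial>D) + (G x - ?E)\<^sup>2"
      unfolding G_def by (rule D.integral_square_shift[OF mx g(2)])
    moreover have "(\<integral>y. (g (x(j := y)) - g' j x)\<^sup>2 \<partial>D) = (\<integral>y. (g (x(j := y)) - G x)\<^sup>2 \<partial>D) + (G x - g' j x)\<^sup>2"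
      unfolding G_def by (rule D.integral_square_shift[OF mx g(2)])
    ultimately show "(\<integral>y. (g (x(j := y)) - ?E)\<^sup>2 \<partial>D)
        \<le> (\<integral>y. (g (x(j := y)) - g' j (x(j := y)))\<^sup>2 \<partial>D) + (G x - ?E)\<^sup>2"
      by (simp add: g'i)
  qed
  also have "\<dots> = (\<integral>x. (\<integral>y. (g (x(j := y)) - g' j (x(j := y)))\<^sup>2 \<partial>D) \<partial>?\<mu>) + (\<integral>x. (G x - ?E)\<^sup>2 \<partial>?\<mu>)"
    using meas2[OF m2[of j]] intb[OF b2[of j]] abs_diff_square_le[OF Gb Eb]
    by (intro Bochner_Integration.integral_add mu.integrable_bounded[where B = "(C + C)\<^sup>2"]) auto
  also have "(\<integral>x. (\<integral>y. (g (x(j := y)) - g' j (x(j := y)))\<^sup>2 \<partial>D) \<partial>?\<mu>) = (\<integral>z. (g z - g' j z)\<^sup>2 \<partial>?\<nu>)"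
    by (rule split[OF m2 b2, symmetric]) auto
  also have "(\<integral>x. (G x - ?E)\<^sup>2 \<partial>?\<mu>) \<le> (\<Sum>i\<in>I. \<integral>x. (G x - G' i x)\<^sup>2 \<partial>?\<mu>)"
  proof (rule insert.IH)
    fix i x y assume i: "i \<in> I"
    then have ij: "i \<noteq> j" using insert.hyps by auto
    show "G' i (x(i := y)) = G' i x" unfolding G'_def
      by (simp only: fun_upd_twist[OF ij] g'i[OF insertI2[OF i]])
  qed (use Gb G'b G'm in auto)
  also have "\<dots> \<le> (\<Sum>i\<in>I. \<integral>z. (g z - g' i z)\<^sup>2 \<partial>?\<nu>)"
  proof (rule sum_mono)
    fix i assume "i \<in> I"
    then have i: "i \<in> insert j I" by auto
    \<comment> \<open>Averaging over coordinate \<open>j\<close> contracts squared differences, by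
      Jensen.\<close>
    have "(\<integral>x. (G x - G' i x)\<^sup>2 \<partial>?\<mu>) \<le> (\<integral>x. (\<integral>y. (g (x(j := y)) - g' i (x(j := y)))\<^sup>2 \<partial>D) \<partial>?\<mu>)"
    proof (rule integral_mono)
      show "integrable ?\<mu> (\<lambda>x. (G x - G' i x)\<^sup>2)"
        using G'm[OF \<open>i \<in> I\<close>] abs_diff_square_le[OF Gb G'b[OF \<open>i \<in> I\<close>]]
        by (intro mu.integrable_bounded[where B = "(C + C)\<^sup>2"]) auto
      show "integrable ?\<mu> (\<lambda>x. \<integral>y. (g (x(j := y)) - g' i (x(j := y)))\<^sup>2 \<partial>D)"
        using meas2[OF m2[OF i]] intb[OF b2[OF i]] by (intro mu.integrable_bounded[where B = "(C + C)\<^sup>2"]) auto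
      fix x assume x: "x \<in> space ?\<mu>"
      note [measurable] = meas1[OF g(1) x] meas1[OF g'm[OF i] x]
      have "G x - G' i x = (\<integral>y. g (x(j := y)) - g' i (x(j := y)) \<partial>D)"
        unfolding G_def G'_def using g(2) g'b[OF i]
        by (intro Bochner_Integration.integral_diff[symmetric] D.integrable_bounded[where B = C]) auto
      moreover have "\<bar>g (x(j := y)) - g' i (x(j := y))\<bar> \<le> C + C" for y
        using g(2)[of "x(j := y)"] g'b[OF i, of "x(j := y)"] by linarith
      ultimately show "(G x - G' i x)\<^sup>2 \<le> (\<integral>y. (g (x(j := y)) - g' i (x(j := y)))\<^sup>2 \<partial>D)"
        using D.integral_square_le[of "\<lambda>y. g (x(j := y)) - g' i (x(j := y))" "C + C"] by simp
    qed
    also have "\<dots> = (\<integral>z. (g z - g' i z)\<^sup>2 \<partial>?\<nu>)" by (rule split[OF m2[OF i] b2[OF i], symmetric])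
    finally show "(\<integral>x. (G x - G' i x)\<^sup>2 \<partial>?\<mu>) \<le> (\<integral>z. (g z - g' i z)\<^sup>2 \<partial>?\<nu>)" .
  qed
  finally show ?case using insert.hyps by simp
qed

text \<open>Independence of two blocks of coordinates, expressed by functions that read only their
  block rather than by sigma-algebras. The range is a general field because real covariances and
  complex exponentials are both factored this way.\<close>

lemma integral_PiM_disjoint:
  fixes u w :: "('i \<Rightarrow> 'b) \<Rightarrow> 'c::{real_normed_field, banach, second_countable_topology}"
  assumes D: "prob_space D" and I: "finite I"
    and u: "u \<in> borel_measurable (Pi\<^sub>M I (\<lambda>_. D))" "\<And>x. norm (u x) \<le> B"
      "\<And>x y. (\<And>i. i \<in> J \<Longrightarrow> x i = y i) \<Longrightarrow> u x = u y"
    and w: "w \<in> borel_measurable (Pi\<^sub>M I (\<lambda>_. D))" "\<And>x. norm (w x) \<le> B"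
      "\<And>x y. (\<And>i. i \<in> I - J \<Longrightarrow> x i = y i) \<Longrightarrow> w x = w y"
    and J: "J \<subseteq> I"
  shows "(\<integral>x. u x * w x \<partial>Pi\<^sub>M I (\<lambda>_. D)) = (\<integral>x. u x \<partial>Pi\<^sub>M I (\<lambda>_. D)) * (\<integral>x. w x \<partial>Pi\<^sub>M I (\<lambda>_. D))"
proof -
  interpret D: prob_space D by (rule D)
  interpret P: product_sigma_finite "\<lambda>_. D" by unfold_locales
  note integrable_PI = prob_space.integrable_bounded[OF prob_space_PiM[OF D], of _ I]
  interpret J: prob_space "Pi\<^sub>M J (\<lambda>_. D)" by (intro prob_space_PiM D)
  interpret K: prob_space "Pi\<^sub>M (I - J) (\<lambda>_. D)" by (intro prob_space_PiM D)
  note [measurable] = u(1) w(1)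
  have IJ: "I = J \<union> (I - J)" using J by auto
  have fin: "finite J" "finite (I - J)" using I J by (auto intro: finite_subset)
  have fold: "(\<integral>x. v x \<partial>Pi\<^sub>M I (\<lambda>_. D))
      = (\<integral>x. (\<integral>y. v (merge J (I - J) (x, y)) \<partial>Pi\<^sub>M (I - J) (\<lambda>_. D)) \<partial>Pi\<^sub>M J (\<lambda>_. D))"
    if "v \<in> borel_measurable (Pi\<^sub>M I (\<lambda>_. D))" "\<And>x. norm (v x) \<le> B'" for v :: "('i \<Rightarrow> 'b) \<Rightarrow> 'c" and B'
    using P.product_integral_fold[of J "I - J" v] fin IJ integrable_PI[OF that] by (metis Diff_disjoint)
  have um: "u (merge J (I - J) (x, y)) = u x" and wm: "w (merge J (I - J) (x, y)) = w y" for x y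
    by (auto intro!: u(3) w(3) simp: merge_def)
  have B: "0 \<le> B" using u(2)[of undefined] norm_ge_zero order_trans by blast
  have bb: "norm (u x * w x) \<le> B * B" for x
    using mult_mono[OF u(2)[of x] w(2)[of x] B] by (simp add: norm_mult)
  have "(\<integral>x. u x * w x \<partial>Pi\<^sub>M I (\<lambda>_. D))
      = (\<integral>x. (\<integral>y. u x * w y \<partial>Pi\<^sub>M (I - J) (\<lambda>_. D)) \<partial>Pi\<^sub>M J (\<lambda>_. D))"
    by (subst fold[OF _ bb]) (auto simp: um wm)
  also have "\<dots> = (\<integral>x. u x \<partial>Pi\<^sub>M J (\<lambda>_. D)) * (\<integral>y. w y \<partial>Pi\<^sub>M (I - J) (\<lambda>_. D))"
    by simp
  also have "(\<integral>x. u x \<partial>Pi\<^sub>M J (\<lambda>_. D)) = (\<integral>x. u x \<partial>Pi\<^sub>M I (\<lambda>_. D))"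
    using K.prob_space by (subst fold[OF u(1,2)]) (simp add: um)
  also have "(\<integral>y. w y \<partial>Pi\<^sub>M (I - J) (\<lambda>_. D)) = (\<integral>x. w x \<partial>Pi\<^sub>M I (\<lambda>_. D))"
    using J.prob_space by (subst fold[OF w(1,2)]) (simp add: wm)
  finally show ?thesis .
qed

section \<open>Sums of locally dependent random variables\<close>

lemma norm_iexp_diff1: "norm (iexp y - 1 - \<i> * complex_of_real y) \<le> y\<^sup>2 / 2"
  using iexp_approx1[of y 1] by (simp add: power2_eq_square algebra_simps)

text \<open>The method of Tikhomirov. The derivative of the characteristic function of the sum
  \<open>W\<close> is built from the means of \<open>U i\<close> times \<open>exp(isW)\<close>. If
  the part \<open>V i\<close> of \<open>W\<close> that shares coordinates with \<open>U i\<close> is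
  removed from the exponent, the mean becomes 0; to first order the difference is \<open>is\<close>
  times the mean of \<open>U i * V i * exp(isW)\<close>. The sum \<open>H\<close> of the
  \<open>U i * V i\<close> has the variance of \<open>W\<close> as its mean and is concentrated by
  Efron-Stein. In the bound, \<open>c ^ 3\<close> marks the Taylor remainder and
  \<open>sqrt (real (card I))\<close> the mean deviation of \<open>H\<close>.\<close>

theorem char_local_dependence:
  fixes U :: "'k \<Rightarrow> ('i \<Rightarrow> 'b) \<Rightarrow> real" and S :: "'k \<Rightarrow> 'i set" and t c :: real and d :: nat
  assumes D: "prob_space D" and I: "finite I" and K: "finite K"
    and U_meas: "\<And>k. k \<in> K \<Longrightarrow> U k \<in> borel_measurable (Pi\<^sub>M I (\<lambda>_. D))"
    and U_bound: "\<And>k x. k \<in> K \<Longrightarrow> \<bar>U k x\<bar> \<le> c"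
    and U_local: "\<And>k x y. k \<in> K \<Longrightarrow> (\<And>i. i \<in> S k \<Longrightarrow> x i = y i) \<Longrightarrow> U k x = U k y"
    and S_sub: "\<And>k. k \<in> K \<Longrightarrow> S k \<subseteq> I"
    and S_card: "\<And>k. k \<in> K \<Longrightarrow> card (S k) \<le> d"
    and S_deg: "\<And>i. i \<in> I \<Longrightarrow> card {k\<in>K. i \<in> S k} \<le> d"
    and U_centred: "\<And>k. k \<in> K \<Longrightarrow> (\<integral>x. U k x \<partial>Pi\<^sub>M I (\<lambda>_. D)) = 0"
    and c: "0 \<le> c"
  shows "norm ((\<integral>x. iexp (t * (\<Sum>k\<in>K. U k x)) \<partial>Pi\<^sub>M I (\<lambda>_. D))
      - exp (- (t\<^sup>2 * (\<integral>x. (\<Sum>k\<in>K. U k x)\<^sup>2 \<partial>Pi\<^sub>M I (\<lambda>_. D)) / 2)))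
    \<le> \<bar>t\<bar> * (real (card K) * c ^ 3 * real d ^ 4 * t\<^sup>2 + \<bar>t\<bar> * (sqrt (real (card I)) * (2 * real d ^ 3 * c\<^sup>2)))"
proof -
  let ?\<mu> = "Pi\<^sub>M I (\<lambda>_. D)"
  interpret mu: prob_space ?\<mu> by (intro prob_space_PiM D)
  note [measurable] = U_meas
  define W where "W x = (\<Sum>k\<in>K. U k x)" for x
  \<comment> \<open>\<open>A i\<close> lists the summands that share a coordinate with
    \<open>U i\<close>: at most \<open>d\<close> coordinates, each read by at most \<open>d\<close>
    summands. The rest of \<open>W\<close> reads only coordinates outside
    \<open>S i\<close>.\<close>
  define A where "A i = {k\<in>K. S i \<inter> S k \<noteq> {}}" for i
  define V where "V i x = (\<Sum>k\<in>A i. U k x)" for i x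
  define H where "H x = (\<Sum>i\<in>K. U i x * V i x)" for x
  define \<phi> where "\<phi> s = (\<integral>x. iexp (s * W x) \<partial>?\<mu>)" for s :: real
  define \<phi>' where "\<phi>' s = (\<integral>x. \<i> * W x * iexp (s * W x) \<partial>?\<mu>)" for s :: real
  define \<sigma>2 where "\<sigma>2 = (\<integral>x. (W x)\<^sup>2 \<partial>?\<mu>)"
  define K1 where "K1 = real (card K) * c ^ 3 * real d ^ 4"
  define K2 where "K2 = sqrt (real (card I)) * (2 * real d ^ 3 * c\<^sup>2)"
  have A_sub: "A i \<subseteq> K" for i by (auto simp: A_def)
  then have A_fin: "finite (A i)" for i using K by (rule finite_subset)
  have A_card: "card (A i) \<le> d\<^sup>2" if i: "i \<in> K" for i
  proof -
    have "A i \<subseteq> (\<Union>j\<in>S i. {k\<in>K. j \<in> S k})" by (auto simp: A_def)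
    moreover have "finite (S i)" using S_sub[OF i] I by (rule finite_subset)
    ultimately have "card (A i) \<le> (\<Sum>j\<in>S i. card {k\<in>K. j \<in> S k})"
      using K by (intro order_trans[OF card_mono card_UN_le]) auto
    also have "\<dots> \<le> (\<Sum>j\<in>S i. d)" using S_deg S_sub[OF i] by (intro sum_mono) auto
    also have "\<dots> \<le> d\<^sup>2" using S_card[OF i] by (simp add: power2_eq_square)
    finally show ?thesis .
  qed
  have Vm [measurable]: "V i \<in> borel_measurable ?\<mu>" for i
    unfolding V_def using A_sub[of i] by (intro borel_measurable_sum) auto
  have Wm [measurable]: "W \<in> borel_measurable ?\<mu>" unfolding W_def by simp
  have Hm [measurable]: "H \<in> borel_measurable ?\<mu>" unfolding H_def by measurable
  have Vb: "\<bar>V i x\<bar> \<le> real d ^ 2 * c" if i: "i \<in> K" for i x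
  proof -
    have "\<bar>V i x\<bar> \<le> (\<Sum>k\<in>A i. c)" unfolding V_def
      using U_bound A_sub[of i] by (intro order_trans[OF sum_abs] sum_mono) auto
    also have "\<dots> \<le> real (d\<^sup>2) * c" using A_card[OF i] c by (simp add: mult_right_mono del: of_nat_power)
    finally show ?thesis by simp
  qed
  have Wb: "\<bar>W x\<bar> \<le> real (card K) * c" for x
    unfolding W_def using sum_norm_bound[of K "\<lambda>k. U k x" c] U_bound by auto
  have UVb: "\<bar>U i x * V i x\<bar> \<le> c * (real d ^ 2 * c)" if "i \<in> K" for i x
    unfolding abs_mult using U_bound[OF that] Vb[OF that] c by (intro mult_mono) auto
  have Hb: "\<bar>H x\<bar> \<le> real (card K) * (c * (real d ^ 2 * c))" for x
    unfolding H_def using sum_norm_bound[of K "\<lambda>i. U i x * V i x"] UVb by auto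
  have W_split: "W x = V i x + (\<Sum>k\<in>K - A i. U k x)" for i x
    unfolding W_def V_def using sum.subset_diff[OF A_sub K] by (simp add: add.commute)
  have local: "(\<Sum>k\<in>K - A i. U k x) = (\<Sum>k\<in>K - A i. U k y)"
    if "\<And>j. j \<in> I - S i \<Longrightarrow> x j = y j" for i x y
  proof (intro sum.cong refl)
    fix k assume k: "k \<in> K - A i"
    then show "U k x = U k y" using S_sub[of k] that
      by (intro U_local) (auto simp: A_def)
  qed
  have rest_m: "(\<lambda>x. \<Sum>k\<in>K - A i. U k x) \<in> borel_measurable ?\<mu>" for i
    by (intro borel_measurable_sum) auto
  have rest_b: "\<bar>\<Sum>k\<in>K - A i. U k x\<bar> \<le> real (card K) * c" for i x
  proof -
    have "\<bar>\<Sum>k\<in>K - A i. U k x\<bar> \<le> real (card (K - A i)) * c"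
      using sum_norm_bound[of "K - A i" "\<lambda>k. U k x" c] U_bound by auto
    also have "\<dots> \<le> real (card K) * c" using K c by (intro mult_right_mono) (auto intro: card_mono)
    finally show ?thesis .
  qed
  have indep0: "(\<integral>x. U i x * (\<Sum>k\<in>K - A i. U k x) \<partial>?\<mu>) = 0" if i: "i \<in> K" for i
  proof (subst integral_PiM_disjoint[OF D I, where J = "S i" and B = "max c (real (card K) * c)"])
    fix x y :: "'i \<Rightarrow> 'b" assume "\<And>j. j \<in> I - S i \<Longrightarrow> x j = y j"
    then show "(\<Sum>k\<in>K - A i. U k x) = (\<Sum>k\<in>K - A i. U k y)" by (rule local)
  next
    fix x y :: "'i \<Rightarrow> 'b" assume "\<And>j. j \<in> S i \<Longrightarrow> x j = y j"
    then show "U i x = U i y" by (rule U_local[OF i])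
  qed (use U_bound[OF i] rest_m rest_b S_sub[OF i] U_centred[OF i] i in
         \<open>simp_all add: le_max_iff_disj\<close>)
  have EH: "(\<integral>x. H x \<partial>?\<mu>) = \<sigma>2"
  proof -
    have "(W x)\<^sup>2 = (\<Sum>i\<in>K. U i x * V i x + U i x * (\<Sum>k\<in>K - A i. U k x))" for x
    proof -
      have "(W x)\<^sup>2 = (\<Sum>i\<in>K. U i x * W x)"
        by (simp add: power2_eq_square W_def sum_distrib_right)
      also have "\<dots> = (\<Sum>i\<in>K. U i x * V i x + U i x * (\<Sum>k\<in>K - A i. U k x))"
        by (intro sum.cong refl) (metis W_split distrib_left)
      finally show ?thesis .
    qed
    then have "\<sigma>2 = (\<integral>x. (\<Sum>i\<in>K. U i x * V i x + U i x * (\<Sum>k\<in>K - A i. U k x)) \<partial>?\<mu>)"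
      unfolding \<sigma>2_def by simp
    also have "\<dots> = (\<Sum>i\<in>K. (\<integral>x. U i x * V i x \<partial>?\<mu>) + (\<integral>x. U i x * (\<Sum>k\<in>K - A i. U k x) \<partial>?\<mu>))"
    proof -
      have 1: "integrable ?\<mu> (\<lambda>x. U i x * V i x)" if "i \<in> K" for i
        using UVb that by (intro mu.integrable_bounded[where B = "c * (real d ^ 2 * c)"]) auto
      have 2: "integrable ?\<mu> (\<lambda>x. U i x * (\<Sum>k\<in>K - A i. U k x))" if "i \<in> K" for i
        using U_bound[OF that] rest_b[of _ i] rest_m[of i] that c
        by (intro mu.integrable_bounded[where B = "c * (real (card K) * c)"])
           (auto simp: abs_mult intro!: mult_mono)
      show ?thesis using 1 2 by (subst Bochner_Integration.integral_sum) auto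
    qed
    also have "\<dots> = (\<integral>x. H x \<partial>?\<mu>)"
      unfolding H_def using UVb
      by (subst Bochner_Integration.integral_sum)
         (auto simp: indep0 intro!: mu.integrable_bounded[where B = "c * (real d ^ 2 * c)"])
    finally show ?thesis by simp
  qed
  have varH: "(\<integral>x. \<bar>H x - \<sigma>2\<bar> \<partial>?\<mu>) \<le> K2"
  proof -
    define Pr where "Pr = (SIGMA i:K. A i)"
    define Bad where "Bad j = {p\<in>Pr. j \<in> S (fst p) \<union> S (snd p)}" for j
    \<comment> \<open>\<open>H' j\<close> keeps the products that do not read coordinate
      \<open>j\<close>. A dropped pair has a factor reading \<open>j\<close>, with \<open>d\<close>
      choices, and a partner, with \<open>d ^ 2\<close> choices, in either order: at most
      \<open>2 * d ^ 3\<close> pairs.\<close>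
    define H' where "H' j x = (\<Sum>p\<in>Pr - Bad j. U (fst p) x * U (snd p) x)" for j x
    have Pr_fin: "finite Pr" using K A_fin by (auto simp: Pr_def)
    have H_Pr: "H x = (\<Sum>p\<in>Pr. U (fst p) x * U (snd p) x)" for x
      unfolding H_def V_def Pr_def sum_distrib_left using K A_fin
      by (subst sum.Sigma) (auto simp: case_prod_unfold)
    have Pr_K: "fst p \<in> K" "snd p \<in> K" if "p \<in> Pr" for p
      using that by (auto simp: Pr_def A_def)
    have UU: "\<bar>U (fst p) x * U (snd p) x\<bar> \<le> c\<^sup>2" if "p \<in> Pr" for p x
      unfolding abs_mult power2_eq_square using U_bound Pr_K[OF that] c by (intro mult_mono) auto
    have Bad_card: "card (Bad j) \<le> 2 * d ^ 3" if j: "j \<in> I" for j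
    proof -
      let ?Z = "SIGMA i:{k\<in>K. j \<in> S k}. A i"
      have fZ: "finite ?Z" using K A_fin by auto
      have "card ?Z = (\<Sum>i\<in>{k\<in>K. j \<in> S k}. card (A i))"
        using K A_fin by (subst card_SigmaI) auto
      also have "\<dots> \<le> (\<Sum>i\<in>{k\<in>K. j \<in> S k}. d\<^sup>2)" using A_card by (intro sum_mono) auto
      also have "\<dots> \<le> d * d\<^sup>2" using S_deg[OF j] by simp
      finally have Z: "card ?Z \<le> d ^ 3" by (simp add: power2_eq_square power3_eq_cube)
      have "Bad j \<subseteq> ?Z \<union> prod.swap ` ?Z" by (force simp: Bad_def Pr_def A_def)
      then have "card (Bad j) \<le> card (?Z \<union> prod.swap ` ?Z)" using fZ by (intro card_mono) auto
      also have "\<dots> \<le> card ?Z + card (prod.swap ` ?Z)" by (rule card_Un_le)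
      also have "\<dots> \<le> card ?Z + card ?Z" using fZ by (intro add_left_mono card_image_le)
      finally show ?thesis using Z by linarith
    qed
    have HH': "\<bar>H x - H' j x\<bar> \<le> real (2 * d ^ 3) * c\<^sup>2" if j: "j \<in> I" for x j
    proof -
      have "H x - H' j x = (\<Sum>p\<in>Bad j. U (fst p) x * U (snd p) x)"
        unfolding H_Pr H'_def using Pr_fin by (subst sum_diff) (auto simp: Bad_def)
      also have "\<bar>\<dots>\<bar> \<le> real (card (Bad j)) * c\<^sup>2"
        using sum_norm_bound[of "Bad j" "\<lambda>p. U (fst p) x * U (snd p) x" "c\<^sup>2"] UU by (auto simp: Bad_def)
      also have "\<dots> \<le> real (2 * d ^ 3) * c\<^sup>2"
        using Bad_card[OF j] by (intro mult_right_mono) (simp_all del: of_nat_mult of_nat_power)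
      finally show ?thesis .
    qed
    define C where "C = real (card Pr) * c\<^sup>2"
    have Hb2: "\<bar>H x\<bar> \<le> C" for x
      unfolding H_Pr C_def using sum_norm_bound[of Pr "\<lambda>p. U (fst p) x * U (snd p) x" "c\<^sup>2"] UU by auto
    have Hb': "\<bar>H' j x\<bar> \<le> C" for j x
    proof -
      have "\<bar>H' j x\<bar> \<le> real (card (Pr - Bad j)) * c\<^sup>2"
        unfolding H'_def using sum_norm_bound[of "Pr - Bad j" "\<lambda>p. U (fst p) x * U (snd p) x" "c\<^sup>2"] UU by auto
      also have "\<dots> \<le> C" unfolding C_def using Pr_fin by (intro mult_right_mono) (auto intro: card_mono)
      finally show ?thesis .
    qed
    have H'm [measurable]: "H' j \<in> borel_measurable ?\<mu>" for j
      unfolding H'_def using Pr_K by (intro borel_measurable_sum borel_measurable_times U_meas) auto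
    have "(\<integral>x. (H x - \<sigma>2)\<^sup>2 \<partial>?\<mu>) \<le> (\<Sum>j\<in>I. \<integral>x. (H x - H' j x)\<^sup>2 \<partial>?\<mu>)"
      unfolding EH[symmetric]
    proof (rule Efron_Stein[OF D I])
      fix j x y assume "j \<in> I"
      show "H' j (x(j := y)) = H' j x" unfolding H'_def
      proof (intro sum.cong refl arg_cong2[where f = "(*)"])
        fix p assume p: "p \<in> Pr - Bad j"
        show "U (fst p) (x(j := y)) = U (fst p) x"
          using p Pr_K by (intro U_local) (auto simp: Bad_def)
        show "U (snd p) (x(j := y)) = U (snd p) x"
          using p Pr_K by (intro U_local) (auto simp: Bad_def)
      qed
    qed (use Hb2 Hb' in auto)
    also have "\<dots> \<le> (\<Sum>j\<in>I. (real (2 * d ^ 3) * c\<^sup>2)\<^sup>2)"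
    proof (rule sum_mono)
      fix j assume j: "j \<in> I"
      have b: "\<bar>(H x - H' j x)\<^sup>2\<bar> \<le> (real (2 * d ^ 3) * c\<^sup>2)\<^sup>2" for x
        using power_mono[OF HH'[OF j, of x], of 2] by simp
      show "(\<integral>x. (H x - H' j x)\<^sup>2 \<partial>?\<mu>) \<le> (real (2 * d ^ 3) * c\<^sup>2)\<^sup>2"
        using mu.norm_integral_le_bound[of "\<lambda>x. (H x - H' j x)\<^sup>2", OF _ b[unfolded real_norm_def[symmetric]]]
        by simp
    qed
    finally have v: "(\<integral>x. (H x - \<sigma>2)\<^sup>2 \<partial>?\<mu>) \<le> real (card I) * (real (2 * d ^ 3) * c\<^sup>2)\<^sup>2" by simp
    have "(\<integral>x. \<bar>H x - \<sigma>2\<bar> \<partial>?\<mu>) \<le> sqrt (\<integral>x. (H x - \<sigma>2)\<^sup>2 \<partial>?\<mu>)"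
    proof (rule mu.integral_abs_le_sqrt)
      show "\<bar>H x - \<sigma>2\<bar> \<le> C + \<bar>\<sigma>2\<bar>" for x using Hb2[of x] by linarith
    qed auto
    also have "\<dots> \<le> sqrt (real (card I) * (real (2 * d ^ 3) * c\<^sup>2)\<^sup>2)" using v by simp
    also have "\<dots> = K2" unfolding K2_def by (simp add: real_sqrt_mult)
    finally show ?thesis .
  qed
  have iW: "integrable ?\<mu> (\<lambda>x. iexp (s * W x))" for s
    by (intro mu.integrable_bounded[where B = 1]) auto
  have iWW: "integrable ?\<mu> (\<lambda>x. \<i> * W x * iexp (s * W x))" for s
    using Wb by (intro mu.integrable_bounded[where B = "real (card K) * c"]) (auto simp: norm_mult)
  \<comment> \<open>Differentiation under the integral: since \<open>W\<close> is bounded, the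
    quadratic Taylor remainder of the exponential is uniform.\<close>
  have deriv: "(\<phi> has_vector_derivative \<phi>' s) (at s)" for s
    unfolding has_vector_derivative_def
  proof (rule has_derivativeI_sandwich[where e = 1])
    let ?B = "real (card K) * c"
    show "bounded_linear (\<lambda>h. h *\<^sub>R \<phi>' s)" by (rule bounded_linear_scaleR_left)
    show "((\<lambda>y. \<bar>y - s\<bar> * (?B\<^sup>2 / 2)) \<longlongrightarrow> 0) (at s)"
      by (auto intro!: tendsto_eq_intros)
    fix y :: real assume y: "y \<noteq> s"
    have "\<phi> y - \<phi> s - (y - s) *\<^sub>R \<phi>' s
        = (\<integral>x. iexp (y * W x) - iexp (s * W x) - (y - s) *\<^sub>R (\<i> * W x * iexp (s * W x)) \<partial>?\<mu>)"
      unfolding \<phi>_def \<phi>'_def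
      by (subst Bochner_Integration.integral_diff Bochner_Integration.integral_scaleR_right;
          use iW iWW in \<open>auto intro!: Bochner_Integration.integrable_diff integrable_scaleR_right\<close>)+
    also have "norm \<dots> \<le> \<bar>y - s\<bar>\<^sup>2 * (?B\<^sup>2 / 2)"
    proof (rule mu.norm_integral_le_bound)
      fix x
      have "iexp (y * W x) - iexp (s * W x) - (y - s) *\<^sub>R (\<i> * W x * iexp (s * W x))
        = iexp (s * W x) * (iexp ((y - s) * W x) - 1 - \<i> * complex_of_real ((y - s) * W x))"
      proof -
        have "iexp (y * W x) = iexp (s * W x) * iexp ((y - s) * W x)"
          by (simp add: exp_add[symmetric] algebra_simps)
        then show ?thesis by (simp add: scaleR_conv_of_real algebra_simps)
      qed
      also have "norm \<dots> \<le> ((y - s) * W x)\<^sup>2 / 2"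
        using norm_iexp_diff1[of "(y - s) * W x"] by (simp add: norm_mult)
      also have "\<dots> \<le> \<bar>y - s\<bar>\<^sup>2 * (?B\<^sup>2 / 2)"
        using power_mono[OF Wb[of x], of 2] by (simp add: power_mult_distrib mult_left_mono)
      finally show "norm (iexp (y * W x) - iexp (s * W x) - (y - s) *\<^sub>R (\<i> * W x * iexp (s * W x)))
        \<le> \<bar>y - s\<bar>\<^sup>2 * (?B\<^sup>2 / 2)" .
    qed measurable
    finally show "norm ((\<phi> y - \<phi> s) - (y - s) *\<^sub>R \<phi>' s) / norm (y - s) \<le> \<bar>y - s\<bar> * (?B\<^sup>2 / 2)"
      using y by (simp add: divide_le_eq power2_eq_square algebra_simps)
  qed auto
  have step: "norm (\<phi>' s + s * \<sigma>2 * \<phi> s) \<le> K1 * s\<^sup>2 + K2 * \<bar>s\<bar>" for s :: real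
  proof -
    have b3: "c * ((\<bar>s\<bar> * (real d ^ 2 * c))\<^sup>2 / 2) \<le> c ^ 3 * real d ^ 4 * s\<^sup>2"
    proof -
      have "c * ((\<bar>s\<bar> * (real d ^ 2 * c))\<^sup>2 / 2) = (c ^ 3 * real d ^ 4 * s\<^sup>2) / 2"
        by (simp add: power_mult_distrib power2_eq_square power3_eq_cube power4_eq_xxxx)
      then show ?thesis using c by simp
    qed
    have one: "norm ((\<integral>x. U i x * iexp (s * W x) \<partial>?\<mu>) - \<i> * s * (\<integral>x. U i x * V i x * iexp (s * W x) \<partial>?\<mu>))
        \<le> c ^ 3 * real d ^ 4 * s\<^sup>2" if i: "i \<in> K" for i
    proof -
      let ?R = "\<lambda>x. \<Sum>k\<in>K - A i. U k x"
      note [measurable] = rest_m[of i] U_meas[OF i]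
      have 0: "(\<integral>x. complex_of_real (U i x) * iexp (s * ?R x) \<partial>?\<mu>) = 0"
      proof (subst integral_PiM_disjoint[OF D I, where J = "S i" and B = "max c 1"])
        fix x y :: "'i \<Rightarrow> 'b" assume "\<And>j. j \<in> I - S i \<Longrightarrow> x j = y j"
        then show "iexp (s * ?R x) = iexp (s * ?R y)" using local[of i x y] by simp
      next
        fix x y :: "'i \<Rightarrow> 'b" assume "\<And>j. j \<in> S i \<Longrightarrow> x j = y j"
        then show "complex_of_real (U i x) = complex_of_real (U i y)" using U_local[OF i, of x y] by simp
      qed (use U_bound[OF i] S_sub[OF i] U_centred[OF i] in \<open>simp_all add: le_max_iff_disj\<close>)
      have i1: "integrable ?\<mu> (\<lambda>x. complex_of_real (U i x) * iexp (s * W x))"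
        using U_bound[OF i] by (intro mu.integrable_bounded[where B = c]) (auto simp: norm_mult)
      have i2: "integrable ?\<mu> (\<lambda>x. complex_of_real (U i x) * iexp (s * ?R x))"
        using U_bound[OF i] by (intro mu.integrable_bounded[where B = c]) (auto simp: norm_mult)
      have i3: "integrable ?\<mu> (\<lambda>x. complex_of_real (U i x * V i x) * iexp (s * W x))"
        using UVb[OF i] by (intro mu.integrable_bounded[where B = "c * (real d ^ 2 * c)"])
          (auto simp: norm_mult abs_mult)
      \<comment> \<open>A zero is inserted: \<open>U i\<close> is centred and independent of the
        remaining sum \<open>?R\<close>, so its mean against the exponential of \<open>?R\<close>
        vanishes.\<close>
      have "(\<integral>x. U i x * iexp (s * W x) \<partial>?\<mu>) - \<i> * s * (\<integral>x. U i x * V i x * iexp (s * W x) \<partial>?\<mu>)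
         = (\<integral>x. U i x * iexp (s * W x) \<partial>?\<mu>) - (\<integral>x. complex_of_real (U i x) * iexp (s * ?R x) \<partial>?\<mu>)
            - (\<integral>x. \<i> * s * (complex_of_real (U i x * V i x) * iexp (s * W x)) \<partial>?\<mu>)"
        using 0 by simp
      also have "\<dots> = (\<integral>x. complex_of_real (U i x) * iexp (s * W x) - complex_of_real (U i x) * iexp (s * ?R x)
           - \<i> * s * (complex_of_real (U i x * V i x) * iexp (s * W x)) \<partial>?\<mu>)"
        using Bochner_Integration.integral_diff[OF Bochner_Integration.integrable_diff[OF i1 i2] integrable_mult_right[OF i3, of "\<i> * s"]]
          Bochner_Integration.integral_diff[OF i1 i2] by simp
      also have "norm \<dots> \<le> c * ((\<bar>s\<bar> * (real d ^ 2 * c))\<^sup>2 / 2)"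
      proof (rule mu.norm_integral_le_bound)
        fix x
        \<comment> \<open>\<open>?y\<close> is the change of the exponent from
          \<open>s * W x\<close> to \<open>s * ?R x\<close>; with it the integrand is a first-order
          Taylor remainder.\<close>
        let ?y = "- s * V i x"
        have "iexp (s * ?R x) = iexp (s * W x) * iexp ?y"
          by (subst W_split[of x i]) (simp add: exp_add[symmetric] algebra_simps)
        then have "complex_of_real (U i x) * iexp (s * W x) - complex_of_real (U i x) * iexp (s * ?R x)
           - \<i> * s * (complex_of_real (U i x * V i x) * iexp (s * W x))
          = - (complex_of_real (U i x) * iexp (s * W x) * (iexp ?y - 1 - \<i> * complex_of_real ?y))"
          by (simp add: algebra_simps)
        also have "norm \<dots> \<le> c * (?y\<^sup>2 / 2)"
          using norm_iexp_diff1[of ?y] U_bound[OF i, of x] c unfolding norm_minus_cancel norm_mult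
          by (intro mult_mono) auto
        also have "\<dots> \<le> c * ((\<bar>s\<bar> * (real d ^ 2 * c))\<^sup>2 / 2)"
        proof -
          have "\<bar>?y\<bar> \<le> \<bar>s\<bar> * (real d ^ 2 * c)"
            using Vb[OF i, of x] by (simp add: abs_mult mult_left_mono)
          from power_mono[OF this, of 2] show ?thesis using c by (intro mult_left_mono) auto
        qed
        finally show "norm (complex_of_real (U i x) * iexp (s * W x) - complex_of_real (U i x) * iexp (s * ?R x)
           - \<i> * s * (complex_of_real (U i x * V i x) * iexp (s * W x))) \<le> c * ((\<bar>s\<bar> * (real d ^ 2 * c))\<^sup>2 / 2)" .
      qed measurable
      finally show ?thesis using b3 by linarith
    qed
    have sumW: "\<phi>' s = \<i> * (\<Sum>i\<in>K. \<integral>x. U i x * iexp (s * W x) \<partial>?\<mu>)"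
    proof -
      have "\<phi>' s = (\<integral>x. \<i> * (\<Sum>i\<in>K. U i x * iexp (s * W x)) \<partial>?\<mu>)"
        unfolding \<phi>'_def
        by (intro Bochner_Integration.integral_cong refl) (simp add: W_def sum_distrib_right mult.assoc)
      then show ?thesis using U_bound
        by (subst Bochner_Integration.integral_sum[symmetric])
           (auto simp: norm_mult intro!: mu.integrable_bounded[where B = c])
    qed
    have iH: "integrable ?\<mu> (\<lambda>x. H x * iexp (s * W x))"
      using Hb by (intro mu.integrable_bounded[where B = "real (card K) * (c * (real d ^ 2 * c))"])
          (auto simp: norm_mult)
    have sumH: "(\<integral>x. H x * iexp (s * W x) \<partial>?\<mu>) = (\<Sum>i\<in>K. \<integral>x. U i x * V i x * iexp (s * W x) \<partial>?\<mu>)"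
    proof -
      have "(\<integral>x. H x * iexp (s * W x) \<partial>?\<mu>) = (\<integral>x. (\<Sum>i\<in>K. complex_of_real (U i x * V i x) * iexp (s * W x)) \<partial>?\<mu>)"
        by (intro Bochner_Integration.integral_cong refl) (simp add: H_def sum_distrib_right)
      then show ?thesis using UVb
        by (subst (asm) Bochner_Integration.integral_sum)
           (auto simp: norm_mult abs_mult intro!: mu.integrable_bounded[where B = "c * (real d ^ 2 * c)"])
    qed
    define a where "a = (\<Sum>i\<in>K. (\<integral>x. U i x * iexp (s * W x) \<partial>?\<mu>)
      - \<i> * s * (\<integral>x. U i x * V i x * iexp (s * W x) \<partial>?\<mu>))"
    define b where "b = (\<integral>x. (H x - \<sigma>2) * iexp (s * W x) \<partial>?\<mu>)"
    have b_eq: "b = (\<integral>x. H x * iexp (s * W x) \<partial>?\<mu>) - \<sigma>2 * \<phi> s"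
      unfolding \<phi>_def b_def using Bochner_Integration.integral_diff[OF iH integrable_mult_right[OF iW, of \<sigma>2 s]]
      by (simp add: algebra_simps)
    \<comment> \<open>\<open>a\<close> collects the Taylor remainders, and \<open>b\<close> is the
      error of replacing \<open>H\<close> by its mean \<open>\<sigma>2\<close>.\<close>
    have "\<phi>' s + s * \<sigma>2 * \<phi> s = \<i> * a - s * b"
      unfolding b_eq a_def sumH sumW by (simp add: sum_subtractf sum_distrib_left sum_negf algebra_simps)
    then have "norm (\<phi>' s + s * \<sigma>2 * \<phi> s) \<le> norm a + \<bar>s\<bar> * norm b"
      using norm_triangle_ineq4[of "\<i> * a" "s * b"] by (simp add: norm_mult)
    moreover have "norm a \<le> K1 * s\<^sup>2"
    proof -
      have "norm a \<le> (\<Sum>i\<in>K. c ^ 3 * real d ^ 4 * s\<^sup>2)"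
        unfolding a_def by (rule sum_norm_le) (rule one)
      then show ?thesis by (simp add: K1_def mult.assoc)
    qed
    moreover have "norm b \<le> K2"
    proof -
      have "norm b \<le> (\<integral>x. norm ((H x - \<sigma>2) * iexp (s * W x)) \<partial>?\<mu>)"
        unfolding b_def by (rule integral_norm_bound)
      also have "\<dots> = (\<integral>x. \<bar>H x - \<sigma>2\<bar> \<partial>?\<mu>)"
        by (intro Bochner_Integration.integral_cong refl) (simp add: norm_mult flip: of_real_diff)
      finally show ?thesis using varH by simp
    qed
    then have "\<bar>s\<bar> * norm b \<le> K2 * \<bar>s\<bar>"
      using mult_left_mono[of "norm b" K2 "\<bar>s\<bar>"] by (simp add: mult.commute)
    ultimately show ?thesis by linarith
  qed
  \<comment> \<open>An integrating factor: the derivative of \<open>G\<close> contains only the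
    defect of the differential equation, so \<open>G t\<close> is close to \<open>G 0 = 1\<close>.
    The exponential in \<open>?B\<close> cancels on the way back to \<open>\<phi> t\<close>, which
    keeps the final bound polynomial in \<open>t\<close>.\<close>
  define G where "G s = exp (\<sigma>2 * s\<^sup>2 / 2) *\<^sub>R \<phi> s" for s
  let ?B = "exp (\<sigma>2 * t\<^sup>2 / 2) * (K1 * t\<^sup>2 + K2 * \<bar>t\<bar>)"
  have pos: "0 \<le> \<sigma>2" "0 \<le> K1" "0 \<le> K2" using c by (simp_all add: \<sigma>2_def K1_def K2_def)
  have "norm (G t - G 0) \<le> ?B * norm (t - 0)"
  proof (rule differentiable_bound)
    show "convex {-\<bar>t\<bar>..\<bar>t\<bar>}" by simp
    fix s assume s: "s \<in> {-\<bar>t\<bar>..\<bar>t\<bar>}"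
    let ?v = "exp (\<sigma>2 * s\<^sup>2 / 2) *\<^sub>R (\<phi>' s + s * \<sigma>2 * \<phi> s)"
    have "((\<lambda>s. exp (\<sigma>2 * s\<^sup>2 / 2)) has_field_derivative exp (\<sigma>2 * s\<^sup>2 / 2) * (\<sigma>2 * s)) (at s)"
      by (auto intro!: derivative_eq_intros simp: power2_eq_square)
    from has_vector_derivative_scaleR[OF this deriv[of s]]
    have "(G has_vector_derivative ?v) (at s)"
      unfolding G_def by (simp add: scaleR_conv_of_real algebra_simps)
    then show "(G has_derivative (\<lambda>h. h *\<^sub>R ?v)) (at s within {-\<bar>t\<bar>..\<bar>t\<bar>})"
      unfolding has_vector_derivative_def by (rule has_derivative_at_withinI)
    have st: "s\<^sup>2 \<le> t\<^sup>2" "\<bar>s\<bar> \<le> \<bar>t\<bar>" using s by (auto simp: abs_le_square_iff[symmetric])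
    have "norm ?v \<le> ?B"
      unfolding norm_scaleR
      using step[of s] st pos
      by (intro mult_mono order_trans[OF step] add_mono) (auto intro!: divide_right_mono mult_left_mono add_nonneg_nonneg)
    then have "norm (h *\<^sub>R ?v) \<le> ?B * norm h" for h :: real
      unfolding norm_scaleR[of h] mult.commute[of ?B] real_norm_def by (intro mult_left_mono) auto
    then show "onorm (\<lambda>h. h *\<^sub>R ?v) \<le> ?B" by (rule onorm_le)
  qed auto
  moreover have "G 0 = 1" using mu.prob_space by (simp add: G_def \<phi>_def)
  moreover have "norm (\<phi> t - exp (- (t\<^sup>2 * \<sigma>2 / 2))) = exp (- (\<sigma>2 * t\<^sup>2 / 2)) * norm (G t - 1)"
  proof -
    have "\<phi> t - exp (- (t\<^sup>2 * \<sigma>2 / 2)) = exp (- (\<sigma>2 * t\<^sup>2 / 2)) *\<^sub>R (G t - 1)"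
      by (simp add: G_def scaleR_right_diff_distrib exp_add[symmetric] mult.commute)
        (simp add: scaleR_conv_of_real exp_of_real[symmetric])
    then show ?thesis by (simp only: norm_scaleR abs_exp_cancel)
  qed
  ultimately have "norm (\<phi> t - exp (- (t\<^sup>2 * \<sigma>2 / 2))) \<le> exp (- (\<sigma>2 * t\<^sup>2 / 2)) * (?B * \<bar>t\<bar>)"
    by (simp add: mult_left_mono)
  also have "\<dots> = \<bar>t\<bar> * (K1 * t\<^sup>2 + \<bar>t\<bar> * K2)"
    by (simp add: exp_minus algebra_simps)
  finally show ?thesis
    unfolding \<phi>_def W_def \<sigma>2_def K1_def K2_def by simp
qed

text \<open>Dividing the summands by \<open>sqrt n\<close> gives \<open>c = B / sqrt n\<close>; then
  \<open>n * c ^ 3\<close> and \<open>sqrt n\<close> times the square of \<open>c\<close> are both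
  of order \<open>1 / sqrt n\<close>.\<close>

corollary char_local_dependence_scaled:
  fixes U :: "nat \<Rightarrow> (nat \<Rightarrow> 'b) \<Rightarrow> real" and S :: "nat \<Rightarrow> nat set" and t B :: real and d n :: nat
    and D :: "'b measure"
  defines "\<mu> \<equiv> Pi\<^sub>M {1..n} (\<lambda>_. D)"
  assumes D: "prob_space D" and n: "n \<ge> 1"
    and meas: "\<And>k. k \<in> {1..n} \<Longrightarrow> U k \<in> borel_measurable \<mu>"
    and bound: "\<And>k x. k \<in> {1..n} \<Longrightarrow> \<bar>U k x\<bar> \<le> B" and B: "0 \<le> B"
    and local: "\<And>k x y. k \<in> {1..n} \<Longrightarrow> (\<And>i. i \<in> S k \<Longrightarrow> x i = y i) \<Longrightarrow> U k x = U k y"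
    and S: "\<And>k. k \<in> {1..n} \<Longrightarrow> S k \<subseteq> {1..n}" "\<And>k. k \<in> {1..n} \<Longrightarrow> card (S k) \<le> d"
      "\<And>i. i \<in> {1..n} \<Longrightarrow> card {k\<in>{1..n}. i \<in> S k} \<le> d"
    and centred: "\<And>k. k \<in> {1..n} \<Longrightarrow> (\<integral>x. U k x \<partial>\<mu>) = 0"
  shows "norm ((\<integral>x. iexp (t * ((\<Sum>k = 1..n. U k x) / sqrt (real n))) \<partial>\<mu>)
      - exp (- (t\<^sup>2 * ((\<integral>x. (\<Sum>k = 1..n. U k x)\<^sup>2 \<partial>\<mu>) / real n) / 2)))
    \<le> (\<bar>t\<bar> * (real d ^ 4 * B ^ 3 * t\<^sup>2 + \<bar>t\<bar> * (2 * real d ^ 3 * B\<^sup>2))) / sqrt (real n)"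
proof -
  let ?r = "sqrt (real n)" and ?c = "B / sqrt (real n)"
  have r: "?r > 0" "?r * ?r = real n" using n by auto
  have sum: "(\<Sum>k = 1..n. U k x / ?r) = (\<Sum>k = 1..n. U k x) / ?r" for x
    by (simp add: sum_divide_distrib)
  have var: "(\<integral>x. ((\<Sum>k = 1..n. U k x) / ?r)\<^sup>2 \<partial>\<mu>) = (\<integral>x. (\<Sum>k = 1..n. U k x)\<^sup>2 \<partial>\<mu>) / real n"
    by (simp add: power_divide)
  have eqs: "real n * ?c ^ 3 = B ^ 3 / ?r" "?r * ?c\<^sup>2 = B\<^sup>2 / ?r"
    using r by (simp_all add: power_divide power3_eq_cube power2_eq_square field_simps)
  have "norm ((\<integral>x. iexp (t * (\<Sum>k = 1..n. U k x / ?r)) \<partial>\<mu>)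
      - exp (- (t\<^sup>2 * (\<integral>x. (\<Sum>k = 1..n. U k x / ?r)\<^sup>2 \<partial>\<mu>) / 2)))
    \<le> \<bar>t\<bar> * (real (card {1..n}) * ?c ^ 3 * real d ^ 4 * t\<^sup>2
       + \<bar>t\<bar> * (sqrt (real (card {1..n})) * (2 * real d ^ 3 * ?c\<^sup>2)))"
    unfolding \<mu>_def
  proof (rule char_local_dependence[OF D])
    fix k assume k: "k \<in> {1..n}"
    show "\<bar>U k x / ?r\<bar> \<le> ?c" for x using bound[OF k, of x] by (simp add: divide_right_mono)
    show "U k x / ?r = U k y / ?r" if "\<And>i. i \<in> S k \<Longrightarrow> x i = y i" for x y using local[OF k that] by simp
    show "(\<lambda>x. U k x / ?r) \<in> borel_measurable (Pi\<^sub>M {1..n} (\<lambda>_. D))" using meas[OF k] unfolding \<mu>_def by simp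
    show "(\<integral>x. U k x / ?r \<partial>Pi\<^sub>M {1..n} (\<lambda>_. D)) = 0" using centred[OF k] unfolding \<mu>_def by simp
  qed (use S B in auto)
  also have "\<dots> = \<bar>t\<bar> * (real d ^ 4 * (real n * ?c ^ 3) * t\<^sup>2 + \<bar>t\<bar> * (2 * real d ^ 3 * (?r * ?c\<^sup>2)))"
    by simp
  also have "\<dots> = (\<bar>t\<bar> * (real d ^ 4 * B ^ 3 * t\<^sup>2 + \<bar>t\<bar> * (2 * real d ^ 3 * B\<^sup>2))) / ?r"
    unfolding eqs by (simp add: add_divide_distrib algebra_simps)
  finally show ?thesis unfolding sum var .
qed

section \<open>Neighbouring observations are close\<close>

lemma tendsto_of_square_subsequence:
  fixes a :: "nat \<Rightarrow> real"
  assumes incr: "\<And>n. n \<ge> 1 \<Longrightarrow> \<bar>a (Suc n) - a n\<bar> \<le> K"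
    and lim: "(\<lambda>k. a (k\<^sup>2) / real (k\<^sup>2)) \<longlonglongrightarrow> m"
  shows "(\<lambda>n. a n / real n) \<longlonglongrightarrow> m"
proof -
  have K: "0 \<le> K" using incr[of 1] by linarith
  have gap: "\<bar>a (l + j) - a l\<bar> \<le> real j * K" if "l \<ge> 1" for l j
  proof (induction j)
    case (Suc j)
    have "\<bar>a (l + Suc j) - a l\<bar> \<le> \<bar>a (Suc (l + j)) - a (l + j)\<bar> + \<bar>a (l + j) - a l\<bar>" by simp
    also have "\<dots> \<le> K + real j * K" using incr[of "l + j"] that Suc by (intro add_mono) auto
    finally show ?case by (simp add: algebra_simps)
  qed simp
  \<comment> \<open>With \<open>k n\<close> the integer part of \<open>sqrt n\<close>, the gap from
    the square of \<open>k n\<close> to \<open>n\<close> is at most \<open>2 * k n\<close>. Bounded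
    increments thus change \<open>a\<close> by \<open>O(sqrt n)\<close>, which is negligible against
    \<open>n\<close>.\<close>
  define k where "k n = nat \<lfloor>sqrt (real n)\<rfloor>" for n
  define b where "b n = a ((k n)\<^sup>2) / real ((k n)\<^sup>2)" for n
  have k_lim: "filterlim k at_top sequentially"
    unfolding k_def
    by (intro filterlim_compose[OF filterlim_nat_sequentially] filterlim_compose[OF filterlim_floor_sequentially]
          filterlim_compose[OF sqrt_at_top] filterlim_real_sequentially)
  have b_lim: "b \<longlonglongrightarrow> m" unfolding b_def using filterlim_compose[OF lim k_lim] by simp
  have bound: "\<bar>a n / real n - b n\<bar> \<le> (2 / sqrt (real n)) * (K + \<bar>b n\<bar>)" if n: "n \<ge> 1" for n
  proof -
    have s1: "1 \<le> sqrt (real n)" using n by simp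
    then have kn: "k n \<ge> 1" unfolding k_def by (simp add: le_nat_iff le_floor_iff)
    have kreal: "real (k n) = of_int \<lfloor>sqrt (real n)\<rfloor>" unfolding k_def using s1 by simp
    then have k1: "real (k n) \<le> sqrt (real n)" and k2: "sqrt (real n) < real (k n) + 1" by linarith+
    have "(real (k n))\<^sup>2 \<le> (sqrt (real n))\<^sup>2" using k1 by (intro power_mono) auto
    then have sq1: "(real (k n))\<^sup>2 \<le> real n" by simp
    then have kn2: "(k n)\<^sup>2 \<le> n" by (simp flip: of_nat_power)
    have "(sqrt (real n))\<^sup>2 < (real (k n) + 1)\<^sup>2" using k2 by (intro power_strict_mono) auto
    then have "real n < (real (k n))\<^sup>2 + 2 * real (k n) + 1" by (simp add: power2_eq_square algebra_simps)
    then have "real n < real ((k n)\<^sup>2 + 2 * k n + 1)" by simp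
    then have "n < (k n)\<^sup>2 + 2 * k n + 1" by (simp only: of_nat_less_iff)
    then have "n - (k n)\<^sup>2 \<le> 2 * k n" by simp
    then have d: "real (n - (k n)\<^sup>2) \<le> 2 * sqrt (real n)" using k1 by linarith
    have A: "\<bar>a n - a ((k n)\<^sup>2)\<bar> \<le> 2 * sqrt (real n) * K"
    proof -
      have "\<bar>a n - a ((k n)\<^sup>2)\<bar> \<le> real (n - (k n)\<^sup>2) * K"
        using gap[of "(k n)\<^sup>2" "n - (k n)\<^sup>2"] kn kn2 by simp
      also have "\<dots> \<le> 2 * sqrt (real n) * K" using d K by (intro mult_right_mono)
      finally show ?thesis .
    qed
    have np: "0 < real n" using n by simp
    have "a ((k n)\<^sup>2) = b n * (real n - real (n - (k n)\<^sup>2))"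
      using kn kn2 by (simp add: b_def of_nat_diff)
    then have "a n / real n - b n = ((a n - a ((k n)\<^sup>2)) - b n * real (n - (k n)\<^sup>2)) / real n"
      using np by (simp add: field_simps)
    also have "\<bar>\<dots>\<bar> \<le> (2 * sqrt (real n) * K + \<bar>b n\<bar> * (2 * sqrt (real n))) / real n"
    proof -
      have "\<bar>b n * real (n - (k n)\<^sup>2)\<bar> \<le> \<bar>b n\<bar> * (2 * sqrt (real n))"
        unfolding abs_mult using d by (intro mult_left_mono) auto
      then have "\<bar>(a n - a ((k n)\<^sup>2)) - b n * real (n - (k n)\<^sup>2)\<bar>
          \<le> 2 * sqrt (real n) * K + \<bar>b n\<bar> * (2 * sqrt (real n))" using A by linarith
      then show ?thesis using np by (simp add: divide_right_mono)
    qed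
    also have "\<dots> = (2 / sqrt (real n)) * (K + \<bar>b n\<bar>)"
    proof -
      have "real n = sqrt (real n) * sqrt (real n)" by simp
      then have "sqrt (real n) / real n = 1 / sqrt (real n)"
        using np by (metis nonzero_divide_mult_cancel_left order_less_irrefl real_sqrt_gt_0_iff)
      moreover have "(2 * sqrt (real n) * K + \<bar>b n\<bar> * (2 * sqrt (real n))) / real n
          = 2 * (K + \<bar>b n\<bar>) * (sqrt (real n) / real n)"
        by (simp add: algebra_simps add_divide_distrib)
      ultimately show ?thesis by simp
    qed
    finally show ?thesis .
  qed
  have "(\<lambda>n. (2 / sqrt (real n)) * (K + \<bar>b n\<bar>)) \<longlonglongrightarrow> 0 * (K + \<bar>m\<bar>)"
    by (intro tendsto_mult tendsto_add tendsto_const tendsto_rabs b_lim tendsto_divide_0[OF tendsto_const]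
          filterlim_at_top_imp_at_infinity filterlim_compose[OF sqrt_at_top] filterlim_real_sequentially)
  then have lim0: "(\<lambda>n. (2 / sqrt (real n)) * (K + \<bar>b n\<bar>)) \<longlonglongrightarrow> 0" by simp
  have "(\<lambda>n. a n / real n - b n) \<longlonglongrightarrow> 0"
  proof (rule Lim_null_comparison[OF _ lim0])
    show "\<forall>\<^sub>F n in sequentially. norm (a n / real n - b n) \<le> (2 / sqrt (real n)) * (K + \<bar>b n\<bar>)"
      unfolding real_norm_def by (rule eventually_sequentiallyI[of 1]) (rule bound)
  qed
  from tendsto_add[OF this b_lim] show ?thesis by simp
qed

text \<open>The second moment of \<open>T n / n - \<mu> n\<close> is \<open>O(1/n)\<close>, hence
  \<open>O(1/k^2)\<close> at \<open>n = k^2\<close>. A series of nonnegative terms with finite mean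
  converges almost surely, so its terms tend to 0. The centre \<open>\<mu> n\<close> depends on
  \<open>n\<close> because it includes the bias.\<close>

lemma (in prob_space) AE_tendsto_of_second_moments:
  fixes T :: "nat \<Rightarrow> 'a \<Rightarrow> real" and \<mu> :: "nat \<Rightarrow> real"
  assumes [measurable]: "\<And>n. T n \<in> borel_measurable M"
    and incr: "AE \<omega> in M. \<forall>n\<ge>1. \<bar>T (Suc n) \<omega> - T n \<omega>\<bar> \<le> K"
    and int: "\<And>n. n \<ge> N \<Longrightarrow> integrable M (\<lambda>\<omega>. (T n \<omega> - real n * \<mu> n)\<^sup>2)"
    and mom: "\<And>n. n \<ge> N \<Longrightarrow> expectation (\<lambda>\<omega>. (T n \<omega> - real n * \<mu> n)\<^sup>2) \<le> K' * real n"
    and \<mu>: "\<mu> \<longlonglongrightarrow> m"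
  shows "AE \<omega> in M. (\<lambda>n. T n \<omega> / real n) \<longlonglongrightarrow> m"
proof -
  define Z where "Z k \<omega> = (T (k\<^sup>2) \<omega> / real (k\<^sup>2) - \<mu> (k\<^sup>2))\<^sup>2" for k \<omega>
  \<comment> \<open>The shift by \<open>Suc N\<close> makes every square that occurs at least
    \<open>N\<close>, where the moment bound applies, and nonzero, so that one may divide by
    it.\<close>
  define N' where "N' = Suc N"
  have sq: "N \<le> (k + N')\<^sup>2" "1 \<le> k + N'" for k
    by (simp_all add: N'_def power2_eq_square trans_le_add1 trans_le_add2)
  have Z_eq: "Z (k + N') \<omega> = (T ((k + N')\<^sup>2) \<omega> - real ((k + N')\<^sup>2) * \<mu> ((k + N')\<^sup>2))\<^sup>2 / (real ((k + N')\<^sup>2))\<^sup>2" for k \<omega>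
  proof -
    have "real ((k + N')\<^sup>2) \<noteq> 0" using sq(2)[of k] by simp
    then have "T ((k + N')\<^sup>2) \<omega> / real ((k + N')\<^sup>2) - \<mu> ((k + N')\<^sup>2)
      = (T ((k + N')\<^sup>2) \<omega> - real ((k + N')\<^sup>2) * \<mu> ((k + N')\<^sup>2)) / real ((k + N')\<^sup>2)"
      by (simp add: field_simps)
    then show ?thesis unfolding Z_def by (simp only: power_divide)
  qed
  have Z_meas [measurable]: "Z k \<in> borel_measurable M" for k unfolding Z_def by measurable
  have Z_int: "integrable M (Z (k + N'))" for k
    unfolding Z_eq using int[OF sq(1)] by (intro integrable_divide)
  have Z_le: "expectation (Z (k + N')) \<le> \<bar>K'\<bar> * (1 / (real (k + N'))\<^sup>2)" for k
  proof -
    let ?n = "(k + N')\<^sup>2"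
    have p: "0 < real ?n" using sq(2)[of k] by simp
    have "expectation (Z (k + N')) = expectation (\<lambda>\<omega>. (T ?n \<omega> - real ?n * \<mu> ?n)\<^sup>2) / (real ?n)\<^sup>2"
      unfolding Z_eq by simp
    also have "\<dots> \<le> (K' * real ?n) / (real ?n)\<^sup>2" using mom[OF sq(1)] by (intro divide_right_mono) auto
    also have "\<dots> = K' * (1 / real ?n)" using p by (simp add: power2_eq_square)
    also have "\<dots> \<le> \<bar>K'\<bar> * (1 / real ?n)" using p by (intro mult_right_mono) auto
    finally show ?thesis by simp
  qed
  have Z0: "0 \<le> Z k \<omega>" for k \<omega> by (simp add: Z_def)
  have E0: "0 \<le> expectation (Z k)" for k using Z0 by (intro integral_nonneg_AE) auto
  have "summable (\<lambda>k. 1 / (real (k + N'))\<^sup>2)"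
    using inverse_power_summable[of 2, where 'a = real] summable_ignore_initial_segment[of "\<lambda>k. inverse ((real k)\<^sup>2)" N']
    by (simp add: inverse_eq_divide)
  from summable_mult[OF this, of "\<bar>K'\<bar>"]
  have sm: "summable (\<lambda>k. expectation (Z (k + N')))"
  proof (rule summable_comparison_test')
    show "norm (expectation (Z (k + N'))) \<le> \<bar>K'\<bar> * (1 / (real (k + N'))\<^sup>2)" if "k \<ge> 0" for k
      using Z_le[of k] E0[of "k + N'"] by simp
  qed
  have "(\<integral>\<^sup>+\<omega>. (\<Sum>k. ennreal (Z (k + N') \<omega>)) \<partial>M) = (\<Sum>k. \<integral>\<^sup>+\<omega>. ennreal (Z (k + N') \<omega>) \<partial>M)"
    by (rule nn_integral_suminf) measurable
  also have "\<dots> = (\<Sum>k. ennreal (expectation (Z (k + N'))))"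
    using Z0 Z_int by (intro suminf_cong nn_integral_eq_integral) auto
  also have "\<dots> = ennreal (\<Sum>k. expectation (Z (k + N')))"
    by (rule suminf_ennreal2[OF E0 sm])
  finally have "(\<integral>\<^sup>+\<omega>. (\<Sum>k. ennreal (Z (k + N') \<omega>)) \<partial>M) \<noteq> \<infinity>" by simp
  then have "AE \<omega> in M. (\<Sum>k. ennreal (Z (k + N') \<omega>)) \<noteq> \<infinity>"
    by (intro nn_integral_PInf_AE) auto
  then show ?thesis using incr
  proof eventually_elim
    case (elim \<omega>)
    have "summable (\<lambda>k. Z (k + N') \<omega>)"
      using elim(1) Z0 by (intro summable_suminf_not_top) auto
    then have "(\<lambda>k. Z (k + N') \<omega>) \<longlonglongrightarrow> 0" by (rule summable_LIMSEQ_zero)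
    then have "(\<lambda>k. Z k \<omega>) \<longlonglongrightarrow> 0" by (rule LIMSEQ_offset)
    then have "(\<lambda>k. sqrt (Z k \<omega>)) \<longlonglongrightarrow> 0" using tendsto_real_sqrt by fastforce
    then have "(\<lambda>k. T (k\<^sup>2) \<omega> / real (k\<^sup>2) - \<mu> (k\<^sup>2)) \<longlonglongrightarrow> 0"
      by (simp add: Z_def tendsto_rabs_zero_iff)
    moreover have "(\<lambda>k. \<mu> (k\<^sup>2)) \<longlonglongrightarrow> m"
      by (rule filterlim_compose[OF \<mu> filterlim_subseq]) (auto simp: strict_mono_def intro: power_strict_mono)
    ultimately have "(\<lambda>k. (T (k\<^sup>2) \<omega> / real (k\<^sup>2) - \<mu> (k\<^sup>2)) + \<mu> (k\<^sup>2)) \<longlonglongrightarrow> 0 + m" by (rule tendsto_add)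
    then have "(\<lambda>k. T (k\<^sup>2) \<omega> / real (k\<^sup>2)) \<longlonglongrightarrow> m" by simp
    then show ?case using elim(2) tendsto_of_square_subsequence[of "\<lambda>n. T n \<omega>" K m] by auto
  qed
qed

section \<open>Samples from a law on the real line\<close>

lemma measurable_PiM_coordinate:
  fixes P :: "real measure"
  assumes P: "sets P = sets borel"
  shows "(\<lambda>x. x k) \<in> borel_measurable (Pi\<^sub>M I (\<lambda>_. P))"
proof (cases "k \<in> I")
  case True
  then have "(\<lambda>x. x k) \<in> measurable (Pi\<^sub>M I (\<lambda>_. P)) P" by (rule measurable_component_singleton)
  then show ?thesis using measurable_cong_sets[OF refl P] by blast
next
  case False
  \<comment> \<open>wait\<close>
  then have "(\<lambda>x. x k) \<in> borel_measurable (Pi\<^sub>M I (\<lambda>_. P)) \<longleftrightarrow> (\<lambda>x. undefined :: real) \<in> borel_measurable (Pi\<^sub>M I (\<lambda>_. P))"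
    by (intro measurable_cong) (auto simp: space_PiM PiE_def extensional_def)
  then show ?thesis by simp
qed

lemma measurable_at_cyc_next:
  fixes X :: "'a \<Rightarrow> nat \<Rightarrow> real"
  assumes A: "finite A" and X: "\<And>k. (\<lambda>\<omega>. X \<omega> k) \<in> borel_measurable M"
    and Z: "\<And>k. (\<lambda>\<omega>. Z \<omega> k) \<in> borel_measurable M"
  shows "(\<lambda>\<omega>. Z \<omega> (cyc_next A (X \<omega>) i)) \<in> borel_measurable M"
  using measurable_compose_countable[OF Z measurable_cyc_next[OF A X X]] .

context real_distribution
begin

abbreviation sample :: "nat set \<Rightarrow> (nat \<Rightarrow> real) measure" where
  "sample A \<equiv> Pi\<^sub>M A (\<lambda>_. M)"

lemma prob_space_sample: "prob_space (sample A)"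
  by (intro prob_space_PiM) unfold_locales

lemma measurable_coordinate [measurable]: "(\<lambda>x. x k) \<in> borel_measurable (sample A)"
  by (rule measurable_PiM_coordinate) simp

lemma measurable_next_coordinate [measurable]:
  "finite B \<Longrightarrow> (\<lambda>x. x (cyc_next B x i)) \<in> borel_measurable (sample A)"
  by (rule measurable_at_cyc_next) auto

lemma integral_coordinate:
  fixes h :: "real \<Rightarrow> 'b::{banach, second_countable_topology}"
  assumes "i \<in> A" and [measurable]: "h \<in> borel_measurable borel"
  shows "(\<integral>x. h (x i) \<partial>sample A) = (\<integral>u. h u \<partial>M)"
    and "integrable (sample A) (\<lambda>x. h (x i)) \<longleftrightarrow> integrable M h"
proof -
  have d: "distr (sample A) M (\<lambda>x. x i) = M"
    using assms(1) by (intro distr_PiM_component) unfold_locales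
  have m: "(\<lambda>x. x i) \<in> measurable (sample A) M" using assms(1) by (rule measurable_component_singleton)
  show "(\<integral>x. h (x i) \<partial>sample A) = (\<integral>u. h u \<partial>M)"
    using integral_distr[OF m, of h] d by simp
  show "integrable (sample A) (\<lambda>x. h (x i)) \<longleftrightarrow> integrable M h"
    using integrable_distr_eq[OF m, of h] d by simp
qed

end

locale atomless_distribution = real_distribution M for M :: "real measure" +
  assumes atomless: "measure M {x} = 0"
begin

lemma AE_coordinates_neq:
  assumes "finite A" "i \<in> A" "j \<in> A" "i \<noteq> j"
  shows "AE x in sample A. x i \<noteq> x j"
proof -
  interpret P: product_sigma_finite "\<lambda>_. M" by unfold_locales
  have A: "A = insert i (A - {i})" using assms by auto
  let ?N = "{x \<in> space (sample A). x i = x j}"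
  have N: "?N \<in> sets (sample A)" by measurable
  have "emeasure (sample A) ?N = (\<integral>\<^sup>+x. indicator ?N x \<partial>sample A)" using N by simp
  also have "\<dots> = (\<integral>\<^sup>+x. indicator {x. x i = x j} x \<partial>sample A)"
    by (intro nn_integral_cong) (auto simp: indicator_def)
  also have "\<dots> = (\<integral>\<^sup>+x. (\<integral>\<^sup>+y. indicator {x. x i = x j} (x(i := y)) \<partial>M) \<partial>sample (A - {i}))"
  proof -
    have m: "(\<lambda>x. indicator {x. x i = x j} x :: ennreal) \<in> borel_measurable (sample A)"
      using N by (subst measurable_cong[where g = "indicator ?N"]) (auto simp: indicator_def)
    show ?thesis using P.product_nn_integral_insert[of "A - {i}" i "\<lambda>x. indicator {x. x i = x j} x"]
      m assms A[symmetric] by auto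
  qed
  also have "\<dots> = (\<integral>\<^sup>+x. (\<integral>\<^sup>+y. indicator {x j} y \<partial>M) \<partial>sample (A - {i}))"
    using assms by (intro nn_integral_cong) (auto simp: indicator_def)
  also have "\<dots> = 0" by (simp add: emeasure_eq_measure atomless)
  finally show ?thesis using N by (auto intro!: AE_I[where N = ?N])
qed

lemma AE_inj_on_sample:
  assumes "finite A"
  shows "AE x in sample A. inj_on x A"
proof -
  have "AE x in sample A. \<forall>i\<in>A. \<forall>j\<in>A. i \<noteq> j \<longrightarrow> x i \<noteq> x j"
    using AE_coordinates_neq[OF assms] assms by (intro AE_finite_allI) auto
  then show ?thesis by eventually_elim (auto simp: inj_on_def)
qed

definition neighbour_dev :: "(real \<Rightarrow> real) \<Rightarrow> nat \<Rightarrow> real" where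
  "neighbour_dev h n =
    (\<integral>x. (\<Sum>i = 1..n. \<bar>h (x i) - h (x (cyc_next {1..n} x i))\<bar>) \<partial>sample {1..n}) / real n"

lemma integrable_next_coordinate:
  fixes h :: "real \<Rightarrow> real"
  assumes h: "integrable M h" and i: "i \<in> {1..n}"
  shows "integrable (sample {1..n}) (\<lambda>x. h (x (cyc_next {1..n} x i)))"
proof (rule Bochner_Integration.integrable_bound)
  have [measurable]: "h \<in> borel_measurable borel" using h by simp
  show "integrable (sample {1..n}) (\<lambda>x. \<Sum>k = 1..n. \<bar>h (x k)\<bar>)"
    using h by (intro Bochner_Integration.integrable_sum) (auto simp: integral_coordinate)
  show "AE x in sample {1..n}. norm (h (x (cyc_next {1..n} x i))) \<le> norm (\<Sum>k = 1..n. \<bar>h (x k)\<bar>)"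
  proof (rule AE_I2)
    fix x :: "nat \<Rightarrow> real"
    have "cyc_next {1..n} x i \<in> {1..n}" using i by (intro cyc_next_in) auto
    then have "\<bar>h (x (cyc_next {1..n} x i))\<bar> \<le> (\<Sum>k = 1..n. \<bar>h (x k)\<bar>)"
      by (intro member_le_sum[of _ "{1..n}" "\<lambda>k. \<bar>h (x k)\<bar>"]) auto
    then show "norm (h (x (cyc_next {1..n} x i))) \<le> norm (\<Sum>k = 1..n. \<bar>h (x k)\<bar>)" by simp
  qed
  show "(\<lambda>x. h (x (cyc_next {1..n} x i))) \<in> borel_measurable (sample {1..n})"
    by (rule measurable_compose[OF measurable_next_coordinate]) auto
qed

lemma integrable_neighbour_sum:
  fixes h :: "real \<Rightarrow> real"
  assumes h: "integrable M h"
  shows "integrable (sample {1..n}) (\<lambda>x. \<Sum>i = 1..n. \<bar>h (x i) - h (x (cyc_next {1..n} x i))\<bar>)"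
  using integrable_next_coordinate[OF h] integral_coordinate(2)[of _ "{1..n}" h] h
  by (intro Bochner_Integration.integrable_sum integrable_abs Bochner_Integration.integrable_diff) auto

lemma neighbour_dev_mono:
  fixes h f g :: "real \<Rightarrow> real"
  assumes h: "integrable M h" and f: "integrable M f" and g: "integrable M g"
    and le: "\<And>u v. \<bar>h u - h v\<bar> \<le> c * (\<bar>f u - f v\<bar> + \<bar>g u - g v\<bar>)"
  shows "neighbour_dev h n \<le> c * (neighbour_dev f n + neighbour_dev g n)"
proof -
  let ?S = "\<lambda>h x. \<Sum>i = 1..n. \<bar>h (x i) - h (x (cyc_next {1..n} x i))\<bar> :: real"
  have "(\<integral>x. ?S h x \<partial>sample {1..n}) \<le> (\<integral>x. c * (?S f x + ?S g x) \<partial>sample {1..n})"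
  proof (intro integral_mono integrable_neighbour_sum h integrable_mult_right Bochner_Integration.integrable_add f g)
    fix x :: "nat \<Rightarrow> real"
    show "?S h x \<le> c * (?S f x + ?S g x)"
      unfolding sum.distrib[symmetric] sum_distrib_left by (intro sum_mono le)
  qed
  also have "\<dots> = c * ((\<integral>x. ?S f x \<partial>sample {1..n}) + (\<integral>x. ?S g x \<partial>sample {1..n}))"
    using integrable_neighbour_sum[OF f, of n] integrable_neighbour_sum[OF g, of n] by simp
  finally have "(\<integral>x. ?S h x \<partial>sample {1..n}) / real n
      \<le> (c * ((\<integral>x. ?S f x \<partial>sample {1..n}) + (\<integral>x. ?S g x \<partial>sample {1..n}))) / real n"
    by (rule divide_right_mono) simp
  then show ?thesis unfolding neighbour_dev_def
    by (simp only: add_divide_distrib[symmetric] times_divide_eq_right)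
qed

lemma neighbour_dev_nonneg: "0 \<le> neighbour_dev h n"
  unfolding neighbour_dev_def by (intro divide_nonneg_nonneg integral_nonneg_AE) (auto intro: sum_nonneg)

lemma neighbour_dev_approx:
  fixes h g :: "real \<Rightarrow> real"
  assumes h: "integrable M h" and g: "integrable M g"
  shows "neighbour_dev h n \<le> neighbour_dev g n + 2 * (\<integral>u. \<bar>h u - g u\<bar> \<partial>M)"
proof (cases "n = 0")
  case True
  then show ?thesis by (simp add: neighbour_dev_def)
next
  case False
  let ?S = "\<lambda>h x. \<Sum>i = 1..n. \<bar>h (x i) - h (x (cyc_next {1..n} x i))\<bar> :: real"
  let ?D = "\<lambda>x. \<Sum>i = 1..n. \<bar>h (x i) - g (x i)\<bar> :: real"
  have [measurable]: "h \<in> borel_measurable borel" "g \<in> borel_measurable borel" using h g by simp_all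
  have iD1: "integrable (sample {1..n}) (\<lambda>x. \<bar>h (x i) - g (x i)\<bar>)" if "i \<in> {1..n}" for i
    using integral_coordinate(2)[of i "{1..n}" "\<lambda>u. \<bar>h u - g u\<bar>"] that h g by simp
  then have iD: "integrable (sample {1..n}) ?D" by (intro Bochner_Integration.integrable_sum) auto
  have "(\<integral>x. ?S h x \<partial>sample {1..n}) \<le> (\<integral>x. ?S g x + 2 * ?D x \<partial>sample {1..n})"
  proof (intro integral_mono_AE integrable_neighbour_sum h Bochner_Integration.integrable_add g integrable_mult_right iD)
    show "AE x in sample {1..n}. ?S h x \<le> ?S g x + 2 * ?D x"
      using AE_inj_on_sample[of "{1..n}", simplified]
    proof eventually_elim
      case (elim x)
      have "?S h x \<le> (\<Sum>i = 1..n. \<bar>g (x i) - g (x (cyc_next {1..n} x i))\<bar> + (\<bar>h (x i) - g (x i)\<bar>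
          + \<bar>h (x (cyc_next {1..n} x i)) - g (x (cyc_next {1..n} x i))\<bar>))"
        by (intro sum_mono) linarith
      also have "\<dots> = ?S g x + (?D x + (\<Sum>i = 1..n. \<bar>h (x (cyc_next {1..n} x i)) - g (x (cyc_next {1..n} x i))\<bar>))"
        by (simp add: sum.distrib)
      also have "(\<Sum>i = 1..n. \<bar>h (x (cyc_next {1..n} x i)) - g (x (cyc_next {1..n} x i))\<bar>) = ?D x"
        using elim by (intro sum_cyc_next) auto
      finally show ?case by simp
    qed
  qed
  also have "\<dots> = (\<integral>x. ?S g x \<partial>sample {1..n}) + 2 * (\<integral>x. ?D x \<partial>sample {1..n})"
    using integrable_neighbour_sum[OF g, of n] iD by simp
  also have "(\<integral>x. ?D x \<partial>sample {1..n}) = (\<Sum>i = 1..n. \<integral>x. \<bar>h (x i) - g (x i)\<bar> \<partial>sample {1..n})"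
    using iD1 by (intro Bochner_Integration.integral_sum) auto
  also have "\<dots> = real n * (\<integral>u. \<bar>h u - g u\<bar> \<partial>M)"
    using integral_coordinate(1)[of _ "{1..n}" "\<lambda>u. \<bar>h u - g u\<bar>"] by simp
  finally have "(\<integral>x. ?S h x \<partial>sample {1..n})
      \<le> (\<integral>x. ?S g x \<partial>sample {1..n}) + 2 * (real n * (\<integral>u. \<bar>h u - g u\<bar> \<partial>M))" .
  then have "(\<integral>x. ?S h x \<partial>sample {1..n}) / real n
      \<le> ((\<integral>x. ?S g x \<partial>sample {1..n}) + 2 * (real n * (\<integral>u. \<bar>h u - g u\<bar> \<partial>M))) / real n"
    by (rule divide_right_mono) simp
  also have "\<dots> = (\<integral>x. ?S g x \<partial>sample {1..n}) / real n + 2 * (\<integral>u. \<bar>h u - g u\<bar> \<partial>M)"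
    using False by (simp add: add_divide_distrib)
  finally show ?thesis by (simp only: neighbour_dev_def)
qed

lemma neighbour_dev_tendsto_approx:
  fixes h :: "real \<Rightarrow> real"
  assumes h: "integrable M h"
    and approx: "\<And>\<epsilon>. \<epsilon> > 0 \<Longrightarrow> \<exists>g. integrable M g \<and> neighbour_dev g \<longlonglongrightarrow> 0 \<and> (\<integral>u. \<bar>h u - g u\<bar> \<partial>M) < \<epsilon>"
  shows "neighbour_dev h \<longlonglongrightarrow> 0"
proof (rule LIMSEQ_I)
  fix r :: real assume r: "0 < r"
  obtain g where g: "integrable M g" "neighbour_dev g \<longlonglongrightarrow> 0" "(\<integral>u. \<bar>h u - g u\<bar> \<partial>M) < r / 4"
    using approx[of "r / 4"] r by auto
  obtain N where N: "\<And>n. n \<ge> N \<Longrightarrow> \<bar>neighbour_dev g n\<bar> < r / 2"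
    using LIMSEQ_D[OF g(2), of "r / 2"] r by auto
  have "\<bar>neighbour_dev h n\<bar> < r" if "n \<ge> N" for n
    using neighbour_dev_approx[OF h g(1), of n] N[OF that] g(3) neighbour_dev_nonneg[of h n] by linarith
  then show "\<exists>no. \<forall>n\<ge>no. norm (neighbour_dev h n - 0) < r" by auto
qed

lemma neighbour_dev_tendsto_mono:
  fixes h f g :: "real \<Rightarrow> real"
  assumes "integrable M h" "integrable M f" "integrable M g"
    and "\<And>u v. \<bar>h u - h v\<bar> \<le> c * (\<bar>f u - f v\<bar> + \<bar>g u - g v\<bar>)"
    and lim: "neighbour_dev f \<longlonglongrightarrow> 0" "neighbour_dev g \<longlonglongrightarrow> 0"
  shows "neighbour_dev h \<longlonglongrightarrow> 0"
proof (rule tendsto_sandwich[OF _ _ tendsto_const])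
  show "\<forall>\<^sub>F n in sequentially. 0 \<le> neighbour_dev h n" by (simp add: neighbour_dev_nonneg)
  show "\<forall>\<^sub>F n in sequentially. neighbour_dev h n \<le> c * (neighbour_dev f n + neighbour_dev g n)"
    by (intro always_eventually allI neighbour_dev_mono assms)
  show "(\<lambda>n. c * (neighbour_dev f n + neighbour_dev g n)) \<longlonglongrightarrow> 0"
    using tendsto_mult_right_zero[OF tendsto_add_zero[OF lim], of c] .
qed

lemma integrable_indicat: "A \<in> sets borel \<Longrightarrow> integrable M (indicat_real A)"
  by (simp add: emeasure_eq_measure)

lemma neighbour_dev_indicator:
  assumes "A \<in> sets borel"
  shows "neighbour_dev (indicat_real A) \<longlonglongrightarrow> 0"
proof -
  have sets: "sets (borel :: real measure) = sigma_sets UNIV (range (\<lambda>a::real. {..a}))"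
    unfolding borel_eq_atMost[where 'a = real] by (simp add: sets_measure_of)
  have "A \<in> sigma_sets UNIV (range (\<lambda>a::real. {..a}))" using assms sets by simp
  then show ?thesis
  proof (induction rule: sigma_sets.induct)
    case (Basic A)
    then obtain t where A: "A = {..t}" by auto
    have le: "neighbour_dev (indicat_real A) n \<le> 2 * inverse (real n)" for n
    proof -
      have "(\<integral>x. (\<Sum>i = 1..n. \<bar>indicat_real A (x i) - indicat_real A (x (cyc_next {1..n} x i))\<bar>) \<partial>sample {1..n})
        \<le> (\<integral>x. 2 \<partial>sample {1..n})"
      proof (intro integral_mono_AE)
        show "integrable (sample {1..n}) (\<lambda>x. \<Sum>i = 1..n. \<bar>indicat_real A (x i) - indicat_real A (x (cyc_next {1..n} x i))\<bar>)"
          by (intro integrable_neighbour_sum integrable_indicat) (simp add: A)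
        show "integrable (sample {1..n}) (\<lambda>x. 2 :: real)"
          using prob_space.finite_measure[OF prob_space_sample] by (rule finite_measure.integrable_const)
        show "AE x in sample {1..n}. (\<Sum>i = 1..n. \<bar>indicat_real A (x i) - indicat_real A (x (cyc_next {1..n} x i))\<bar>) \<le> 2"
          using AE_inj_on_sample[OF finite_atLeastAtMost] unfolding A
          by eventually_elim (rule cyc_next_atMost_crossings, auto)
      qed
      also have "\<dots> = 2" using prob_space.prob_space[OF prob_space_sample] by simp
      finally show ?thesis unfolding neighbour_dev_def by (simp add: divide_inverse mult_right_mono)
    qed
    show ?case
    proof (rule tendsto_sandwich[OF _ _ tendsto_const])
      show "\<forall>\<^sub>F n in sequentially. 0 \<le> neighbour_dev (indicat_real A) n" by (simp add: neighbour_dev_nonneg)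
      show "\<forall>\<^sub>F n in sequentially. neighbour_dev (indicat_real A) n \<le> 2 * inverse (real n)"
        by (intro always_eventually allI le)
      show "(\<lambda>n. 2 * inverse (real n)) \<longlonglongrightarrow> 0"
        by (intro tendsto_mult_right_zero lim_inverse_n)
    qed
  next
    case Empty
    then show ?case by (simp add: neighbour_dev_def[abs_def])
  next
    case (Compl A)
    have A: "A \<in> sets borel" using Compl.hyps sets by simp
    show ?case
    proof (rule neighbour_dev_tendsto_mono[where f = "indicator A" and g = "indicator A" and c = 1])
      show "integrable M (indicat_real (UNIV - A))" by (intro integrable_indicat sets.Diff A) simp
      show "\<bar>indicat_real (UNIV - A) u - indicat_real (UNIV - A) v\<bar>
        \<le> 1 * (\<bar>indicat_real A u - indicat_real A v\<bar> + \<bar>indicat_real A u - indicat_real A v\<bar>)" for u v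
        by (simp add: indicator_def)
    qed (intro integrable_indicat A Compl.IH)+
  next
    case (Union A)
    have A: "A i \<in> sets borel" for i using Union.hyps sets by simp
    define B where "B k = (\<Union>i<k. A i)" for k :: nat
    have B: "B k \<in> sets borel" for k unfolding B_def using A by auto
    have limB: "neighbour_dev (indicat_real (B k)) \<longlonglongrightarrow> 0" for k
    proof (induction k)
      case 0
      then show ?case by (simp add: neighbour_dev_def[abs_def] B_def)
    next
      case (Suc k)
      have BS: "B (Suc k) = B k \<union> A k" by (auto simp: B_def less_Suc_eq)
      show ?case
      proof (rule neighbour_dev_tendsto_mono[where f = "indicator (B k)" and g = "indicator (A k)" and c = 1])
        show "\<bar>indicat_real (B (Suc k)) u - indicat_real (B (Suc k)) v\<bar>
          \<le> 1 * (\<bar>indicat_real (B k) u - indicat_real (B k) v\<bar> + \<bar>indicat_real (A k) u - indicat_real (A k) v\<bar>)" for u v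
          unfolding BS by (simp add: indicator_def)
      qed (intro integrable_indicat A B Suc.IH Union.IH)+
    qed
    have UB: "(\<Union>i. A i) = (\<Union>k. B k)" by (auto simp: B_def)
    have "incseq B" unfolding incseq_def B_def by (intro allI impI UN_mono) auto
    then have "(\<lambda>k. measure M (B k)) \<longlonglongrightarrow> measure M (\<Union>k. B k)"
      using B by (intro finite_Lim_measure_incseq) auto
    then have lim: "(\<lambda>k. measure M (B k)) \<longlonglongrightarrow> measure M (\<Union>i. A i)" by (simp add: UB)
    show ?case
    proof (rule neighbour_dev_tendsto_approx)
      show "integrable M (indicat_real (\<Union>i. A i))" using A by (intro integrable_indicat) auto
      fix \<epsilon> :: real assume "\<epsilon> > 0"
      then obtain k where k: "\<bar>measure M (B k) - measure M (\<Union>i. A i)\<bar> < \<epsilon>"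
        using LIMSEQ_D[OF lim] by fastforce
      have sub: "B k \<subseteq> (\<Union>i. A i)" by (auto simp: B_def)
      have "(\<integral>u. \<bar>indicat_real (\<Union>i. A i) u - indicat_real (B k) u\<bar> \<partial>M) = (\<integral>u. indicat_real ((\<Union>i. A i) - B k) u \<partial>M)"
        using sub by (intro Bochner_Integration.integral_cong) (auto simp: indicator_def)
      also have "\<dots> = measure M ((\<Union>i. A i) - B k)" by simp
      also have "\<dots> = measure M (\<Union>i. A i) - measure M (B k)"
        using sub A B by (intro finite_measure_Diff) auto
      finally show "\<exists>g. integrable M g \<and> neighbour_dev g \<longlonglongrightarrow> 0 \<and> (\<integral>u. \<bar>indicat_real (\<Union>i. A i) u - g u\<bar> \<partial>M) < \<epsilon>"
        using k limB B integrable_indicat by (intro exI[of _ "indicat_real (B k)"]) auto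
    qed
  qed
qed

theorem neighbour_dev_tendsto_0:
  fixes h :: "real \<Rightarrow> real"
  assumes "integrable M h"
  shows "neighbour_dev h \<longlonglongrightarrow> 0"
  using assms
proof (induction rule: integrable_induct)
  case (base A c)
  then have A: "A \<in> sets borel" by simp
  show ?case
  proof (rule neighbour_dev_tendsto_mono[where f = "indicator A" and g = "indicator A" and c = "\<bar>c\<bar>"])
    show "integrable M (\<lambda>x. indicat_real A x *\<^sub>R c)"
      by (intro integrable_scaleR_left integrable_indicat A)
    show "\<bar>indicat_real A u *\<^sub>R c - indicat_real A v *\<^sub>R c\<bar>
      \<le> \<bar>c\<bar> * (\<bar>indicat_real A u - indicat_real A v\<bar> + \<bar>indicat_real A u - indicat_real A v\<bar>)" for u v
      by (simp add: indicator_def)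
  qed (intro integrable_indicat neighbour_dev_indicator A)+
next
  case (add f g)
  then show ?case
    by (intro neighbour_dev_tendsto_mono[of "\<lambda>x. f x + g x" f g 1]) auto
next
  case (lim f s)
  have [measurable]: "f \<in> borel_measurable M" "\<And>i. s i \<in> borel_measurable M"
    using lim by auto
  show ?case
  proof (rule neighbour_dev_tendsto_approx)
    fix \<epsilon> :: real assume e: "\<epsilon> > 0"
    have "(\<lambda>i. \<integral>u. \<bar>f u - s i u\<bar> \<partial>M) \<longlonglongrightarrow> (\<integral>u. 0 \<partial>M)"
    proof (rule integral_dominated_convergence[where w = "\<lambda>u. 3 * \<bar>f u\<bar>"])
      show "AE u in M. (\<lambda>i. \<bar>f u - s i u\<bar>) \<longlonglongrightarrow> 0"
      proof (rule AE_I2)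
        fix u assume "u \<in> space M"
        from tendsto_rabs_zero[OF tendsto_diff[OF tendsto_const lim.hyps(2)[OF this], of "f u", simplified]]
        show "(\<lambda>i. \<bar>f u - s i u\<bar>) \<longlonglongrightarrow> 0" .
      qed
      show "AE u in M. norm \<bar>f u - s i u\<bar> \<le> 3 * \<bar>f u\<bar>" for i
      proof (rule AE_I2)
        fix u assume "u \<in> space M"
        from lim.hyps(3)[OF this, of i] show "norm \<bar>f u - s i u\<bar> \<le> 3 * \<bar>f u\<bar>" by simp
      qed
    qed (use lim in auto)
    then obtain i where "\<bar>\<integral>u. \<bar>f u - s i u\<bar> \<partial>M\<bar> < \<epsilon>"
      using LIMSEQ_D[OF _ e] by fastforce
    then show "\<exists>g. integrable M g \<and> neighbour_dev g \<longlonglongrightarrow> 0 \<and> (\<integral>u. \<bar>f u - g u\<bar> \<partial>M) < \<epsilon>"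
      using lim by (intro exI[of _ "s i"]) auto
  qed (use lim in auto)
qed

end

section \<open>The noise, given the covariates\<close>

lemma (in real_distribution) integral_two_coordinates:
  fixes g h :: "real \<Rightarrow> real"
  assumes A: "finite A" and ij: "i \<in> A" "j \<in> A" "i \<noteq> j"
    and [measurable]: "g \<in> borel_measurable borel" "h \<in> borel_measurable borel"
    and b: "\<And>u. \<bar>g u\<bar> \<le> B" "\<And>u. \<bar>h u\<bar> \<le> B"
  shows "(\<integral>x. g (x i) * h (x j) \<partial>sample A) = (\<integral>u. g u \<partial>M) * (\<integral>u. h u \<partial>M)"
proof -
  have "(\<integral>x. g (x i) * h (x j) \<partial>sample A) = (\<integral>x. g (x i) \<partial>sample A) * (\<integral>x. h (x j) \<partial>sample A)"
  proof (rule integral_PiM_disjoint[OF prob_space_axioms A, where J = "{i}" and B = B])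
    show "h (x j) = h (y j)" if "\<And>k. k \<in> A - {i} \<Longrightarrow> x k = y k" for x y :: "nat \<Rightarrow> real"
      using that[of j] ij by simp
  qed (use ij b in \<open>simp_all\<close>)
  then show ?thesis using ij by (simp add: integral_coordinate)
qed

locale rank_model = X: atomless_distribution P + E: real_distribution R for P R :: "real measure" +
  fixes f :: "real \<times> real \<Rightarrow> real" and C a b c :: real
  assumes f_meas [measurable]: "f \<in> borel_measurable (borel \<Otimes>\<^sub>M borel)"
    and f_bound: "\<And>z. \<bar>f z\<bar> \<le> C" and C: "1 \<le> C"
begin

text \<open>
  \<open>m\<close> is the regression function and \<open>s\<close> its analogue for the squared response; \<open>v\<close>, \<open>q\<close> and \<open>w\<close> are
  the entries of \<open>Sigma_b\<close>. The weights \<open>a\<close>, \<open>b\<close>, \<open>c\<close> select a linear combination \<open>T\<close> of the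
  three sums in the estimator: unit weights give the sums themselves, the vector \<open>v(f)\<close> of the
  theorem gives the linearised estimator.
\<close>

definition m :: "real \<Rightarrow> real" where "m x = (\<integral>e. f (x, e) \<partial>R)"
definition s :: "real \<Rightarrow> real" where "s x = (\<integral>e. (f (x, e))\<^sup>2 \<partial>R)"
definition \<eta> :: "real \<Rightarrow> real \<Rightarrow> real" where "\<eta> x e = f (x, e) - m x"
definition \<zeta> :: "real \<Rightarrow> real \<Rightarrow> real" where "\<zeta> x e = (f (x, e))\<^sup>2 - s x"
definition v :: "real \<Rightarrow> real" where "v x = (\<integral>e. (\<eta> x e)\<^sup>2 \<partial>R)"
definition q :: "real \<Rightarrow> real" where "q x = (\<integral>e. \<eta> x e * \<zeta> x e \<partial>R)"
definition w :: "real \<Rightarrow> real" where "w x = (\<integral>e. (\<zeta> x e)\<^sup>2 \<partial>R)"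
definition L :: real where "L = 4 * C ^ 4"

abbreviation SX :: "nat \<Rightarrow> (nat \<Rightarrow> real) measure" where "SX n \<equiv> X.sample {1..n}"
abbreviation SE :: "nat \<Rightarrow> (nat \<Rightarrow> real) measure" where "SE n \<equiv> E.sample {1..n}"
abbreviation nx :: "nat \<Rightarrow> (nat \<Rightarrow> real) \<Rightarrow> nat \<Rightarrow> nat" where
  "nx n x \<equiv> cyc_next {1..n} x"

definition T :: "nat \<Rightarrow> (nat \<Rightarrow> real) \<Rightarrow> (nat \<Rightarrow> real) \<Rightarrow> real" where
  "T n x e = (\<Sum>i = 1..n. a * (f (x i, e i) * f (x (nx n x i), e (nx n x i))) + b * f (x i, e i) + c * (f (x i, e i))\<^sup>2)"

definition h :: "real \<Rightarrow> real" where "h u = a * (m u)\<^sup>2 + b * m u + c * s u"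

definition Q :: "nat \<Rightarrow> (nat \<Rightarrow> real) \<Rightarrow> real" where
  "Q n x = (\<Sum>i = 1..n. (m (x i) - m (x (nx n x i)))\<^sup>2)"

definition Bn :: "nat \<Rightarrow> (nat \<Rightarrow> real) \<Rightarrow> (nat \<Rightarrow> real) \<Rightarrow> real" where
  "Bn n x e = T n x e - (\<Sum>i = 1..n. h (x i)) + a / 2 * Q n x"

lemma m_meas [measurable]: "m \<in> borel_measurable borel"
  and s_meas [measurable]: "s \<in> borel_measurable borel"
  unfolding m_def[abs_def] s_def[abs_def] by measurable

lemma eta_meas [measurable]: "(\<lambda>(x, e). \<eta> x e) \<in> borel_measurable (borel \<Otimes>\<^sub>M borel)"
  and zeta_meas [measurable]: "(\<lambda>(x, e). \<zeta> x e) \<in> borel_measurable (borel \<Otimes>\<^sub>M borel)"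
  unfolding \<eta>_def \<zeta>_def by measurable

lemma v_meas [measurable]: "v \<in> borel_measurable borel"
  and q_meas [measurable]: "q \<in> borel_measurable borel"
  and w_meas [measurable]: "w \<in> borel_measurable borel"
  unfolding v_def[abs_def] q_def[abs_def] w_def[abs_def] by measurable

lemma C_powers: "0 \<le> C" "C \<le> C ^ 4" "C\<^sup>2 \<le> C ^ 4" "C ^ 3 \<le> C ^ 4" "1 \<le> C ^ 4"
proof -
  show "C \<le> C ^ 4" using power_increasing[of 1 4 C] C by simp
  show "C\<^sup>2 \<le> C ^ 4" "C ^ 3 \<le> C ^ 4" using C by (auto intro: power_increasing)
qed (use C in auto)

lemma L_ge: "1 \<le> L" "C \<le> L"
  using C_powers by (auto simp: L_def)

lemma f2_bound: "\<bar>(f z)\<^sup>2\<bar> \<le> C\<^sup>2"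
  using power_mono[OF f_bound[of z], of 2] by simp

lemma m_bound_C: "\<bar>m x\<bar> \<le> C" and s_bound_C: "\<bar>s x\<bar> \<le> C\<^sup>2"
  unfolding m_def s_def
  using E.norm_integral_le_bound[of "\<lambda>e. f (x, e)" C] E.norm_integral_le_bound[of "\<lambda>e. (f (x, e))\<^sup>2" "C\<^sup>2"]
    f_bound f2_bound by auto

lemma eta_bound_C: "\<bar>\<eta> x e\<bar> \<le> 2 * C" and zeta_bound_C: "\<bar>\<zeta> x e\<bar> \<le> 2 * C\<^sup>2"
  unfolding \<eta>_def \<zeta>_def
  using f_bound[of "(x, e)"] f2_bound[of "(x, e)"] m_bound_C[of x] s_bound_C[of x] by linarith+

lemma eta_slice [measurable]: "\<eta> x \<in> borel_measurable borel" "\<zeta> x \<in> borel_measurable borel"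
  unfolding \<eta>_def[abs_def] \<zeta>_def[abs_def] by measurable

lemma product_bounds:
  "\<bar>(\<eta> x e)\<^sup>2\<bar> \<le> L" "\<bar>\<eta> x e * \<zeta> x e\<bar> \<le> L" "\<bar>(\<zeta> x e)\<^sup>2\<bar> \<le> L"
proof -
  have "\<bar>\<eta> x e * \<eta> x e\<bar> \<le> (2 * C) * (2 * C)"
    unfolding abs_mult using eta_bound_C C_powers by (intro mult_mono) auto
  then show "\<bar>(\<eta> x e)\<^sup>2\<bar> \<le> L" using C_powers by (simp add: L_def power2_eq_square)
  have "\<bar>\<eta> x e * \<zeta> x e\<bar> \<le> (2 * C) * (2 * C\<^sup>2)"
    unfolding abs_mult using eta_bound_C zeta_bound_C C_powers by (intro mult_mono) auto
  then show "\<bar>\<eta> x e * \<zeta> x e\<bar> \<le> L" using C_powers by (simp add: L_def power2_eq_square power3_eq_cube)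
  have "\<bar>\<zeta> x e * \<zeta> x e\<bar> \<le> (2 * C\<^sup>2) * (2 * C\<^sup>2)"
    unfolding abs_mult using zeta_bound_C C_powers by (intro mult_mono) auto
  then show "\<bar>(\<zeta> x e)\<^sup>2\<bar> \<le> L" by (simp add: L_def power2_eq_square power4_eq_xxxx)
qed

lemma bounds:
  "\<bar>f z\<bar> \<le> L" "\<bar>(f z)\<^sup>2\<bar> \<le> L" "\<bar>m x\<bar> \<le> L" "\<bar>s x\<bar> \<le> L" "\<bar>\<eta> x e\<bar> \<le> L" "\<bar>\<zeta> x e\<bar> \<le> L"
  "\<bar>v x\<bar> \<le> L" "\<bar>q x\<bar> \<le> L" "\<bar>w x\<bar> \<le> L"
proof -
  show "\<bar>v x\<bar> \<le> L" "\<bar>q x\<bar> \<le> L" "\<bar>w x\<bar> \<le> L"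
    unfolding v_def q_def w_def
    using E.norm_integral_le_bound[of "\<lambda>e. (\<eta> x e)\<^sup>2" L] E.norm_integral_le_bound[of "\<lambda>e. \<eta> x e * \<zeta> x e" L]
      E.norm_integral_le_bound[of "\<lambda>e. (\<zeta> x e)\<^sup>2" L] product_bounds by auto
qed (use f_bound[of z] f2_bound[of z] m_bound_C[of x] s_bound_C[of x] eta_bound_C[of x e] zeta_bound_C[of x e]
       C_powers in \<open>auto simp: L_def\<close>)

lemma eta_centred: "(\<integral>e. \<eta> x e \<partial>R) = 0" and zeta_centred: "(\<integral>e. \<zeta> x e \<partial>R) = 0"
proof -
  have "integrable R (\<lambda>e. f (x, e))" "integrable R (\<lambda>e. (f (x, e))\<^sup>2)"
    using f_bound f2_bound by (auto intro!: E.integrable_bounded)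
  then show "(\<integral>e. \<eta> x e \<partial>R) = 0" "(\<integral>e. \<zeta> x e \<partial>R) = 0"
    unfolding \<eta>_def \<zeta>_def using E.prob_space by (simp_all add: m_def s_def)
qed

text \<open>Collecting the linear terms in \<open>e i\<close> makes the summands \<open>U i\<close> of the noise pairwise uncorrelated.\<close>

definition prv :: "nat \<Rightarrow> (nat \<Rightarrow> real) \<Rightarrow> nat \<Rightarrow> nat" where
  "prv n x = inv_into {1..n} (nx n x)"

definition lin :: "nat \<Rightarrow> (nat \<Rightarrow> real) \<Rightarrow> nat \<Rightarrow> real" where
  "lin n x i = a * (m (x (prv n x i)) + m (x (nx n x i))) + b"

definition U :: "nat \<Rightarrow> (nat \<Rightarrow> real) \<Rightarrow> nat \<Rightarrow> (nat \<Rightarrow> real) \<Rightarrow> real" where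
  "U n x i e = a * (\<eta> (x i) (e i) * \<eta> (x (nx n x i)) (e (nx n x i)))
     + (lin n x i * \<eta> (x i) (e i) + c * \<zeta> (x i) (e i))"

definition KU :: real where "KU = \<bar>a\<bar> * (L * L) + ((\<bar>a\<bar> * (L + L) + \<bar>b\<bar>) * L + \<bar>c\<bar> * L)"

lemma lin_bound: "\<bar>lin n x i\<bar> \<le> \<bar>a\<bar> * (L + L) + \<bar>b\<bar>"
proof -
  have "\<bar>a * (m (x (prv n x i)) + m (x (nx n x i)))\<bar> \<le> \<bar>a\<bar> * (L + L)"
    unfolding abs_mult by (intro mult_left_mono order_trans[OF abs_triangle_ineq] add_mono bounds) auto
  then show ?thesis unfolding lin_def by linarith
qed

lemma linear_part_bound: "\<bar>lin n x i * \<eta> u e + c * \<zeta> u e\<bar> \<le> (\<bar>a\<bar> * (L + L) + \<bar>b\<bar>) * L + \<bar>c\<bar> * L"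
proof -
  have "0 \<le> \<bar>a\<bar> * (L + L) + \<bar>b\<bar>" using lin_bound[of n x i] by linarith
  then show ?thesis unfolding abs_mult[symmetric]
    by (intro order_trans[OF abs_triangle_ineq] add_mono; unfold abs_mult; intro mult_mono lin_bound bounds; simp)
qed

lemma U_bound: "\<bar>U n x i e\<bar> \<le> KU"
proof -
  have "\<bar>\<eta> (x i) (e i) * \<eta> (x (nx n x i)) (e (nx n x i))\<bar> \<le> L * L"
    unfolding abs_mult using L_ge by (intro mult_mono bounds) auto
  then have "\<bar>a * (\<eta> (x i) (e i) * \<eta> (x (nx n x i)) (e (nx n x i)))\<bar> \<le> \<bar>a\<bar> * (L * L)"
    unfolding abs_mult[of a] by (intro mult_left_mono) auto
  then show ?thesis unfolding U_def KU_def by (intro order_trans[OF abs_triangle_ineq] add_mono linear_part_bound)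
qed

lemma KU_nonneg: "0 \<le> KU"
  using U_bound[of 0 undefined 0 undefined] by linarith

lemma eta_coordinate [measurable]:
  "(\<lambda>e. \<eta> u (e i)) \<in> borel_measurable (E.sample A)" "(\<lambda>e. \<zeta> u (e i)) \<in> borel_measurable (E.sample A)"
  using measurable_compose[OF E.measurable_coordinate eta_slice(1)]
    measurable_compose[OF E.measurable_coordinate eta_slice(2)] by auto

lemma U_meas [measurable]: "U n x i \<in> borel_measurable (E.sample A)"
  unfolding U_def[abs_def] by measurable

lemma U_local: "(\<And>j. j \<in> {i, nx n x i} \<Longrightarrow> e j = e' j) \<Longrightarrow> U n x i e = U n x i e'"
  unfolding U_def by simp

definition var_U :: "nat \<Rightarrow> (nat \<Rightarrow> real) \<Rightarrow> nat \<Rightarrow> real" where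
  "var_U n x i = a\<^sup>2 * (v (x i) * v (x (nx n x i)))
     + ((lin n x i)\<^sup>2 * v (x i) + 2 * lin n x i * c * q (x i) + c\<^sup>2 * w (x i))"

definition lim_var :: "real \<Rightarrow> real" where
  "lim_var u = a\<^sup>2 * (v u)\<^sup>2 + ((2 * a * m u + b)\<^sup>2 * v u + 2 * (2 * a * m u + b) * c * q u + c\<^sup>2 * w u)"

context
  fixes n :: nat and x :: "nat \<Rightarrow> real"
  assumes n: "n \<ge> 3" and inj: "inj_on x {1..n}"
begin

lemma nx_bij: "bij_betw (nx n x) {1..n} {1..n}"
  using bij_betw_cyc_next[OF _ inj] by simp

lemma nx_in: "i \<in> {1..n} \<Longrightarrow> nx n x i \<in> {1..n}"
  using bij_betwE[OF nx_bij] by auto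

lemma prv_nx: "i \<in> {1..n} \<Longrightarrow> prv n x (nx n x i) = i"
  unfolding prv_def using bij_betw_inv_into_left[OF nx_bij] .

lemma nx_neq: "i \<in> {1..n} \<Longrightarrow> nx n x i \<noteq> i"
  using cyc_next_neq[OF _ inj] n by simp

lemma nx_nx_neq: "i \<in> {1..n} \<Longrightarrow> nx n x (nx n x i) \<noteq> i"
  using cyc_next_cyc_next_neq[OF _ inj] n by simp

lemma sum_nx: "(\<Sum>i = 1..n. G (nx n x i)) = (\<Sum>i = 1..n. G i :: real)"
  by (rule sum.reindex_bij_betw[OF nx_bij])

lemma sum_prv: "(\<Sum>i = 1..n. G (prv n x i) i) = (\<Sum>i = 1..n. G i (nx n x i) :: real)"
proof -
  have "(\<Sum>i = 1..n. G (prv n x i) i) = (\<Sum>i = 1..n. G (prv n x (nx n x i)) (nx n x i))"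
    by (rule sum_nx[symmetric])
  also have "\<dots> = (\<Sum>i = 1..n. G i (nx n x i))"
    by (intro sum.cong refl) (simp only: prv_nx)
  finally show ?thesis .
qed

lemma sum_U: "(\<Sum>i = 1..n. U n x i e) = Bn n x e"
proof -
  let ?M = "\<lambda>i. m (x i)" and ?S = "\<lambda>i. s (x i)" and ?N = "nx n x"
  let ?H = "\<lambda>i. \<eta> (x i) (e i)" and ?Z = "\<lambda>i. \<zeta> (x i) (e i)"
  have F: "f (x i, e i) = ?M i + ?H i" "(f (x i, e i))\<^sup>2 = ?S i + ?Z i" for i
    by (simp_all add: \<eta>_def \<zeta>_def)
  have "Q n x = (\<Sum>i = 1..n. (?M i)\<^sup>2 + (?M (?N i))\<^sup>2 - 2 * (?M i * ?M (?N i)))"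
    unfolding Q_def by (intro sum.cong refl) (simp add: power2_diff)
  also have "\<dots> = 2 * (\<Sum>i = 1..n. (?M i)\<^sup>2) - 2 * (\<Sum>i = 1..n. ?M i * ?M (?N i))"
    using sum_nx[of "\<lambda>i. (?M i)\<^sup>2"] by (simp add: sum.distrib sum_subtractf sum_distrib_left)
  finally have Q: "Q n x = 2 * (\<Sum>i = 1..n. (?M i)\<^sup>2) - 2 * (\<Sum>i = 1..n. ?M i * ?M (?N i))" .
  have "T n x e = (\<Sum>i = 1..n. a * (?M i * ?M (?N i)) + a * (?M i * ?H (?N i)) + a * (?M (?N i) * ?H i)
      + a * (?H i * ?H (?N i)) + b * ?M i + b * ?H i + c * ?S i + c * ?Z i)"
    unfolding T_def F(2) unfolding F(1) by (intro sum.cong refl) (simp add: algebra_simps)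
  also have "\<dots> = a * (\<Sum>i = 1..n. ?M i * ?M (?N i)) + a * (\<Sum>i = 1..n. ?M i * ?H (?N i)) + a * (\<Sum>i = 1..n. ?M (?N i) * ?H i)
      + a * (\<Sum>i = 1..n. ?H i * ?H (?N i)) + b * (\<Sum>i = 1..n. ?M i) + b * (\<Sum>i = 1..n. ?H i) + c * (\<Sum>i = 1..n. ?S i) + c * (\<Sum>i = 1..n. ?Z i)"
    by (simp only: sum.distrib sum_distrib_left)
  also have "(\<Sum>i = 1..n. ?M i * ?H (?N i)) = (\<Sum>i = 1..n. ?M (prv n x i) * ?H i)"
    by (rule sum_prv[symmetric])
  finally have T: "T n x e = a * (\<Sum>i = 1..n. ?M i * ?M (?N i)) + a * (\<Sum>i = 1..n. ?M (prv n x i) * ?H i) + a * (\<Sum>i = 1..n. ?M (?N i) * ?H i)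
      + a * (\<Sum>i = 1..n. ?H i * ?H (?N i)) + b * (\<Sum>i = 1..n. ?M i) + b * (\<Sum>i = 1..n. ?H i) + c * (\<Sum>i = 1..n. ?S i) + c * (\<Sum>i = 1..n. ?Z i)" .
  have "(\<Sum>i = 1..n. U n x i e) = (\<Sum>i = 1..n. a * (?H i * ?H (?N i)) + a * (?M (prv n x i) * ?H i) + a * (?M (?N i) * ?H i) + b * ?H i + c * ?Z i)"
    unfolding U_def lin_def by (intro sum.cong refl) (simp add: algebra_simps)
  also have "\<dots> = a * (\<Sum>i = 1..n. ?H i * ?H (?N i)) + a * (\<Sum>i = 1..n. ?M (prv n x i) * ?H i) + a * (\<Sum>i = 1..n. ?M (?N i) * ?H i)
      + b * (\<Sum>i = 1..n. ?H i) + c * (\<Sum>i = 1..n. ?Z i)"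
    by (simp only: sum.distrib sum_distrib_left)
  finally have SU: "(\<Sum>i = 1..n. U n x i e) = \<dots>" .
  have "(\<Sum>i = 1..n. h (x i)) = a * (\<Sum>i = 1..n. (?M i)\<^sup>2) + b * (\<Sum>i = 1..n. ?M i) + c * (\<Sum>i = 1..n. ?S i)"
    unfolding h_def by (simp only: sum.distrib sum_distrib_left)
  then show ?thesis unfolding Bn_def T SU Q by (simp add: algebra_simps)
qed

lemma U_coordinate_orth:
  assumes i: "i \<in> {1..n}" and W [measurable]: "W \<in> borel_measurable (SE n)"
    and Wb: "\<And>e. \<bar>W e\<bar> \<le> KU" and loc: "\<And>e e'. (\<And>j. j \<in> {1..n} - {i} \<Longrightarrow> e j = e' j) \<Longrightarrow> W e = W e'"
  shows "(\<integral>e. U n x i e * W e \<partial>SE n) = 0"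
proof -
  interpret S: prob_space "SE n" by (rule E.prob_space_sample)
  let ?N = "nx n x i"
  define B where "B = max (max L ((\<bar>a\<bar> * (L + L) + \<bar>b\<bar>) * L + \<bar>c\<bar> * L)) (max KU (\<bar>a\<bar> * L * KU))"
  have aWb: "\<bar>a * \<eta> (x ?N) (e ?N) * W e\<bar> \<le> \<bar>a\<bar> * L * KU" for e
    unfolding abs_mult using L_ge by (intro mult_mono bounds Wb) auto
  have "(\<integral>e. \<eta> (x i) (e i) * (a * \<eta> (x ?N) (e ?N) * W e) \<partial>SE n) = (\<integral>e. \<eta> (x i) (e i) \<partial>SE n) * (\<integral>e. a * \<eta> (x ?N) (e ?N) * W e \<partial>SE n)"
  proof (rule integral_PiM_disjoint[OF E.prob_space_axioms, where J = "{i}" and B = B])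
    show "norm (\<eta> (x i) (e i)) \<le> B" for e using bounds(5)[of "x i" "e i"] by (simp add: B_def le_max_iff_disj)
    show "norm (a * \<eta> (x ?N) (e ?N) * W e) \<le> B" for e using aWb[of e] by (simp add: B_def le_max_iff_disj)
    show "a * \<eta> (x ?N) (e ?N) * W e = a * \<eta> (x ?N) (e' ?N) * W e'"
      if "\<And>j. j \<in> {1..n} - {i} \<Longrightarrow> e j = e' j" for e e'
      using that[of ?N] loc[OF that] nx_in[OF i] nx_neq[OF i] by simp
  qed (use i in \<open>auto simp del: One_nat_def\<close>)
  also have "(\<integral>e. \<eta> (x i) (e i) \<partial>SE n) = 0"
    using i by (simp add: E.integral_coordinate eta_centred)
  finally have 1: "(\<integral>e. \<eta> (x i) (e i) * (a * \<eta> (x ?N) (e ?N) * W e) \<partial>SE n) = 0" by simp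
  let ?l = "\<lambda>u. lin n x i * \<eta> (x i) u + c * \<zeta> (x i) u"
  have l0: "(\<integral>e. ?l (e i) \<partial>SE n) = 0"
  proof -
    have "(\<integral>e. ?l (e i) \<partial>SE n) = (\<integral>u. ?l u \<partial>R)" using i by (intro E.integral_coordinate) auto
    also have "\<dots> = lin n x i * (\<integral>u. \<eta> (x i) u \<partial>R) + c * (\<integral>u. \<zeta> (x i) u \<partial>R)"
      using bounds by (subst Bochner_Integration.integral_add) (auto intro!: E.integrable_bounded[where B = L])
    finally show ?thesis by (simp add: eta_centred zeta_centred)
  qed
  have "(\<integral>e. ?l (e i) * W e \<partial>SE n) = (\<integral>e. ?l (e i) \<partial>SE n) * (\<integral>e. W e \<partial>SE n)"
  proof (rule integral_PiM_disjoint[OF E.prob_space_axioms, where J = "{i}" and B = B])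
    show "norm (?l (e i)) \<le> B" for e using linear_part_bound[of n x i "x i" "e i"] by (simp add: B_def le_max_iff_disj)
    show "norm (W e) \<le> B" for e using Wb[of e] by (simp add: B_def le_max_iff_disj)
    show "W e = W e'" if "\<And>j. j \<in> {1..n} - {i} \<Longrightarrow> e j = e' j" for e e' by (rule loc[OF that])
  qed (use i in \<open>auto simp del: One_nat_def\<close>)
  then have 2: "(\<integral>e. ?l (e i) * W e \<partial>SE n) = 0" using l0 by simp
  have i1: "integrable (SE n) (\<lambda>e. \<eta> (x i) (e i) * (a * \<eta> (x ?N) (e ?N) * W e))"
    using mult_mono[OF bounds(5) aWb] L_ge
    by (intro S.integrable_bounded[where B = "L * (\<bar>a\<bar> * L * KU)"]) (auto simp: abs_mult simp del: One_nat_def)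
  have lWb: "\<bar>?l (e i) * W e\<bar> \<le> ((\<bar>a\<bar> * (L + L) + \<bar>b\<bar>) * L + \<bar>c\<bar> * L) * KU" for e
    unfolding abs_mult[of "?l (e i)"] using linear_part_bound[of n x i "x i" "e i"]
    by (intro mult_mono linear_part_bound Wb) auto
  have i2: "integrable (SE n) (\<lambda>e. ?l (e i) * W e)"
    using lWb i
    by (intro S.integrable_bounded[where B = "((\<bar>a\<bar> * (L + L) + \<bar>b\<bar>) * L + \<bar>c\<bar> * L) * KU"])
       (auto simp del: One_nat_def)
  have "U n x i e * W e = \<eta> (x i) (e i) * (a * \<eta> (x ?N) (e ?N) * W e) + ?l (e i) * W e" for e
    unfolding U_def by (simp add: algebra_simps)
  then show ?thesis using i1 i2 1 2 by simp
qed

lemma U_centred: "i \<in> {1..n} \<Longrightarrow> (\<integral>e. U n x i e \<partial>SE n) = 0"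
proof (cases "KU = 0")
  case True
  then have "U n x i = (\<lambda>e. 0)" using U_bound[of n x i] by (intro ext) simp
  then show ?thesis by simp
next
  case False
  assume i: "i \<in> {1..n}"
  have "(\<integral>e. U n x i e * KU \<partial>SE n) = 0"
    using KU_nonneg by (intro U_coordinate_orth i) auto
  then show ?thesis using False by simp
qed

lemma U_orth:
  assumes i: "i \<in> {1..n}" and k: "k \<in> {1..n}" and ne: "i \<noteq> k"
  shows "(\<integral>e. U n x i e * U n x k e \<partial>SE n) = 0"
proof -
  have *: "(\<integral>e. U n x i e * U n x k e \<partial>SE n) = 0"
    if "i \<in> {1..n}" "k \<in> {1..n}" "i \<noteq> k" "nx n x k \<noteq> i" for i k
    using that nx_in[of k] by (intro U_coordinate_orth U_bound U_local) auto
  show ?thesis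
  proof (cases "nx n x k = i")
    case False
    then show ?thesis using * i k ne by auto
  next
    case True
    then have "nx n x i \<noteq> k" using nx_nx_neq[OF k] by auto
    then show ?thesis using *[of k i] i k ne by (simp add: mult.commute)
  qed
qed

lemma integral_U_square:
  assumes i: "i \<in> {1..n}"
  shows "(\<integral>e. (U n x i e)\<^sup>2 \<partial>SE n) = var_U n x i"
proof -
  interpret S: prob_space "SE n" by (rule E.prob_space_sample)
  let ?N = "nx n x i"
  let ?l = "\<lambda>u. lin n x i * \<eta> (x i) u + c * \<zeta> (x i) u"
  let ?B = "(\<bar>a\<bar> * (L + L) + \<bar>b\<bar>) * L + \<bar>c\<bar> * L"
  have lb: "\<bar>?l u\<bar> \<le> ?B" for u by (rule linear_part_bound)
  have B0: "0 \<le> ?B" using lb[of 0] by linarith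
  have lb2: "\<bar>(?l u)\<^sup>2\<bar> \<le> ?B\<^sup>2" for u using power_mono[OF lb[of u], of 2] by simp
  have elb: "\<bar>\<eta> (x i) u * ?l u\<bar> \<le> L * ?B" for u
    unfolding abs_mult using L_ge B0 by (intro mult_mono bounds lb) auto
  have N: "?N \<in> {1..n}" "i \<noteq> ?N" using nx_in[OF i] nx_neq[OF i] by auto
  have l2: "(\<integral>u. (?l u)\<^sup>2 \<partial>R) = (lin n x i)\<^sup>2 * v (x i) + 2 * lin n x i * c * q (x i) + c\<^sup>2 * w (x i)"
  proof -
    have "(\<integral>u. (?l u)\<^sup>2 \<partial>R) = (\<integral>u. (lin n x i)\<^sup>2 * (\<eta> (x i) u)\<^sup>2 + 2 * lin n x i * c * (\<eta> (x i) u * \<zeta> (x i) u) + c\<^sup>2 * (\<zeta> (x i) u)\<^sup>2 \<partial>R)"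
      by (intro Bochner_Integration.integral_cong refl) (simp add: power2_eq_square algebra_simps)
    also have "\<dots> = (lin n x i)\<^sup>2 * v (x i) + 2 * lin n x i * c * q (x i) + c\<^sup>2 * w (x i)"
    proof -
      have "integrable R (\<lambda>u. (\<eta> (x i) u)\<^sup>2)" "integrable R (\<lambda>u. \<eta> (x i) u * \<zeta> (x i) u)" "integrable R (\<lambda>u. (\<zeta> (x i) u)\<^sup>2)"
        using product_bounds by (auto intro!: E.integrable_bounded[where B = L])
      then show ?thesis by (simp add: v_def q_def w_def)
    qed
    finally show ?thesis .
  qed
  have p1: "(\<integral>e. (\<eta> (x i) (e i))\<^sup>2 * (\<eta> (x ?N) (e ?N))\<^sup>2 \<partial>SE n) = v (x i) * v (x ?N)"
    unfolding v_def using product_bounds i N by (intro E.integral_two_coordinates[where B = L]) auto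
  have p2: "(\<integral>e. (\<eta> (x i) (e i) * ?l (e i)) * \<eta> (x ?N) (e ?N) \<partial>SE n) = 0"
  proof -
    have "(\<integral>e. (\<eta> (x i) (e i) * ?l (e i)) * \<eta> (x ?N) (e ?N) \<partial>SE n)
      = (\<integral>u. \<eta> (x i) u * ?l u \<partial>R) * (\<integral>u. \<eta> (x ?N) u \<partial>R)"
      using elb i N bounds(5)
      by (intro E.integral_two_coordinates[where B = "max (L * ?B) L"]) (auto simp: le_max_iff_disj)
    then show ?thesis by (simp add: eta_centred)
  qed
  have p3: "(\<integral>e. (?l (e i))\<^sup>2 \<partial>SE n) = (\<integral>u. (?l u)\<^sup>2 \<partial>R)"
    using i by (intro E.integral_coordinate(1)[of i "{1..n}" "\<lambda>u. (?l u)\<^sup>2"]) auto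
  have i1: "integrable (SE n) (\<lambda>e. (\<eta> (x i) (e i))\<^sup>2 * (\<eta> (x ?N) (e ?N))\<^sup>2)"
    using mult_mono[OF product_bounds(1) product_bounds(1)] L_ge
    by (intro S.integrable_bounded[where B = "L * L"]) (auto simp: abs_mult)
  have i2: "integrable (SE n) (\<lambda>e. (\<eta> (x i) (e i) * ?l (e i)) * \<eta> (x ?N) (e ?N))"
    using mult_mono[OF elb bounds(5)] L_ge B0
    by (intro S.integrable_bounded[where B = "(L * ?B) * L"]) (auto simp: abs_mult)
  have i3: "integrable (SE n) (\<lambda>e. (?l (e i))\<^sup>2)"
    using lb2 by (intro S.integrable_bounded[where B = "?B\<^sup>2"]) auto
  have "(\<integral>e. (U n x i e)\<^sup>2 \<partial>SE n) = (\<integral>e. a\<^sup>2 * ((\<eta> (x i) (e i))\<^sup>2 * (\<eta> (x ?N) (e ?N))\<^sup>2)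
    + 2 * a * ((\<eta> (x i) (e i) * ?l (e i)) * \<eta> (x ?N) (e ?N)) + (?l (e i))\<^sup>2 \<partial>SE n)"
    unfolding U_def by (intro Bochner_Integration.integral_cong refl) (simp add: power2_eq_square algebra_simps)
  also have "\<dots> = a\<^sup>2 * (v (x i) * v (x ?N)) + (\<integral>u. (?l u)\<^sup>2 \<partial>R)"
    using i1 i2 i3 by (simp add: p1 p2 p3 del: One_nat_def)
  finally show ?thesis unfolding l2 var_U_def .
qed

lemma integral_Bn_square: "(\<integral>e. (Bn n x e)\<^sup>2 \<partial>SE n) = (\<Sum>i = 1..n. var_U n x i)"
proof -
  interpret S: prob_space "SE n" by (rule E.prob_space_sample)
  have UU: "integrable (SE n) (\<lambda>e. U n x i e * U n x k e)" for i k
    using mult_mono[OF U_bound U_bound KU_nonneg]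
    by (intro S.integrable_bounded[where B = "KU * KU"]) (auto simp: abs_mult)
  have "(\<integral>e. (Bn n x e)\<^sup>2 \<partial>SE n) = (\<integral>e. (\<Sum>i = 1..n. \<Sum>k = 1..n. U n x i e * U n x k e) \<partial>SE n)"
    unfolding sum_U[symmetric] by (simp add: power2_eq_square sum_product)
  also have "\<dots> = (\<Sum>i = 1..n. \<Sum>k = 1..n. \<integral>e. U n x i e * U n x k e \<partial>SE n)"
    using UU by simp
  also have "\<dots> = (\<Sum>i = 1..n. \<Sum>k = 1..n. if k = i then var_U n x i else 0)"
    using U_orth integral_U_square by (intro sum.cong refl) (auto simp: power2_eq_square)
  also have "\<dots> = (\<Sum>i = 1..n. var_U n x i)" by simp
  finally show ?thesis .
qed

lemma char_Bn:
  "norm ((\<integral>e. iexp (t * (Bn n x e / sqrt (real n))) \<partial>SE n)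
      - exp (- (t\<^sup>2 * ((\<Sum>i = 1..n. var_U n x i) / real n) / 2)))
    \<le> (\<bar>t\<bar> * (16 * KU ^ 3 * t\<^sup>2 + \<bar>t\<bar> * (16 * KU\<^sup>2))) / sqrt (real n)"
proof -
  have "norm ((\<integral>e. iexp (t * ((\<Sum>i = 1..n. U n x i e) / sqrt (real n))) \<partial>SE n)
      - exp (- (t\<^sup>2 * ((\<integral>e. (\<Sum>i = 1..n. U n x i e)\<^sup>2 \<partial>SE n) / real n) / 2)))
    \<le> (\<bar>t\<bar> * (real 2 ^ 4 * KU ^ 3 * t\<^sup>2 + \<bar>t\<bar> * (2 * real 2 ^ 3 * KU\<^sup>2))) / sqrt (real n)"
  proof (rule char_local_dependence_scaled[OF E.prob_space_axioms, where S = "\<lambda>i. {i, nx n x i}"])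
    fix i assume i: "i \<in> {1..n}"
    show "{i, nx n x i} \<subseteq> {1..n}" using i nx_in[OF i] by auto
    show "card {i, nx n x i} \<le> 2" by (simp add: card_insert_le_m1)
    have "{k \<in> {1..n}. i \<in> {k, nx n x k}} \<subseteq> {i, prv n x i}" using prv_nx by auto
    then have "card {k \<in> {1..n}. i \<in> {k, nx n x k}} \<le> card {i, prv n x i}" by (intro card_mono) auto
    also have "\<dots> \<le> 2" by (simp add: card_insert_le_m1)
    finally show "card {k \<in> {1..n}. i \<in> {k, nx n x k}} \<le> 2" .
  next
    fix i :: nat and e e' :: "nat \<Rightarrow> real" assume "\<And>j. j \<in> {i, nx n x i} \<Longrightarrow> e j = e' j"
    then show "U n x i e = U n x i e'" by (rule U_local)
  next
    show "1 \<le> n" using n by simp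
  qed (rule U_meas U_bound U_centred KU_nonneg, assumption?)+
  then show ?thesis by (simp only: sum_U integral_Bn_square) simp
qed

lemma var_U_bound: "\<bar>var_U n x i\<bar> \<le> KU\<^sup>2" if "i \<in> {1..n}"
proof -
  interpret S: prob_space "SE n" by (rule E.prob_space_sample)
  have "\<bar>(U n x i e)\<^sup>2\<bar> \<le> KU\<^sup>2" for e using power_mono[OF U_bound[of n x i e], of 2] by simp
  then show ?thesis
    unfolding integral_U_square[OF that, symmetric] real_norm_def[symmetric]
    by (intro S.norm_integral_le_bound) auto
qed

end

end

section \<open>The covariates\<close>

declare One_nat_def [simp del]

context real_distribution
begin

lemma integral_sum_square:
  fixes g :: "real \<Rightarrow> real"
  assumes A: "finite A" and [measurable]: "g \<in> borel_measurable borel" and b: "\<And>u. \<bar>g u\<bar> \<le> B"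
    and 0: "(\<integral>u. g u \<partial>M) = 0"
  shows "(\<integral>x. (\<Sum>i\<in>A. g (x i))\<^sup>2 \<partial>sample A) = real (card A) * (\<integral>u. (g u)\<^sup>2 \<partial>M)"
proof -
  interpret S: prob_space "sample A" by (rule prob_space_sample)
  have B: "0 \<le> B" using b[of 0] by linarith
  have gg: "integrable (sample A) (\<lambda>x. g (x i) * g (x k))" for i k
    using mult_mono[OF b b B] by (intro S.integrable_bounded[where B = "B * B"]) (auto simp: abs_mult)
  have "(\<integral>x. (\<Sum>i\<in>A. g (x i))\<^sup>2 \<partial>sample A) = (\<integral>x. (\<Sum>i\<in>A. \<Sum>k\<in>A. g (x i) * g (x k)) \<partial>sample A)"
    by (simp add: power2_eq_square sum_product)
  also have "\<dots> = (\<Sum>i\<in>A. \<Sum>k\<in>A. \<integral>x. g (x i) * g (x k) \<partial>sample A)" using gg by simp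
  also have "\<dots> = (\<Sum>i\<in>A. \<Sum>k\<in>A. if k = i then (\<integral>u. (g u)\<^sup>2 \<partial>M) else 0)"
  proof (intro sum.cong refl)
    fix i k assume ik: "i \<in> A" "k \<in> A"
    have "(\<integral>x. g (x i) * g (x i) \<partial>sample A) = (\<integral>u. g u * g u \<partial>M)"
      using ik by (intro integral_coordinate(1)[of i A "\<lambda>u. g u * g u"]) auto
    moreover have "(\<integral>x. g (x i) * g (x k) \<partial>sample A) = 0" if "k \<noteq> i"
      using integral_two_coordinates[OF A ik, of g g B] that b 0 by auto
    ultimately show "(\<integral>x. g (x i) * g (x k) \<partial>sample A) = (if k = i then (\<integral>u. (g u)\<^sup>2 \<partial>M) else 0)"
      by (simp add: power2_eq_square)
  qed
  also have "\<dots> = real (card A) * (\<integral>u. (g u)\<^sup>2 \<partial>M)" using A by simp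
  finally show ?thesis .
qed

lemma char_sum:
  fixes g :: "real \<Rightarrow> real"
  assumes n: "n \<ge> 1" and [measurable]: "g \<in> borel_measurable borel" and b: "\<And>u. \<bar>g u\<bar> \<le> B"
    and 0: "(\<integral>u. g u \<partial>M) = 0"
  shows "norm ((\<integral>x. iexp (t * ((\<Sum>i = 1..n. g (x i)) / sqrt (real n))) \<partial>sample {1..n})
      - exp (- (t\<^sup>2 * (\<integral>u. (g u)\<^sup>2 \<partial>M) / 2)))
    \<le> (\<bar>t\<bar> * (B ^ 3 * t\<^sup>2 + \<bar>t\<bar> * (2 * B\<^sup>2))) / sqrt (real n)"
proof -
  have B: "0 \<le> B" using b[of 0] by linarith
  have var: "(\<integral>x. (\<Sum>i = 1..n. g (x i))\<^sup>2 \<partial>sample {1..n}) / real n = (\<integral>u. (g u)\<^sup>2 \<partial>M)"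
    using integral_sum_square[of "{1..n}" g B] b 0 n by simp
  have "norm ((\<integral>x. iexp (t * ((\<Sum>i = 1..n. g (x i)) / sqrt (real n))) \<partial>sample {1..n})
      - exp (- (t\<^sup>2 * ((\<integral>x. (\<Sum>i = 1..n. g (x i))\<^sup>2 \<partial>sample {1..n}) / real n) / 2)))
    \<le> (\<bar>t\<bar> * (real 1 ^ 4 * B ^ 3 * t\<^sup>2 + \<bar>t\<bar> * (2 * real 1 ^ 3 * B\<^sup>2))) / sqrt (real n)"
  proof (rule char_local_dependence_scaled[OF prob_space_axioms n, where S = "\<lambda>i. {i}"])
    fix i assume i: "i \<in> {1..n}"
    show "(\<integral>x. g (x i) \<partial>sample {1..n}) = 0" using i 0 by (simp add: integral_coordinate)
    have "card {k \<in> {1..n}. i \<in> {k}} \<le> card {i}" by (intro card_mono) auto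
    then show "card {k \<in> {1..n}. i \<in> {k}} \<le> 1" by simp
  qed (use B b in auto)
  then show ?thesis unfolding var by simp
qed

end

context rank_model
begin

lemma fst_coordinate [measurable]: "(\<lambda>p. fst p k) \<in> borel_measurable (SX n \<Otimes>\<^sub>M SE n)"
  and snd_coordinate [measurable]: "(\<lambda>p. snd p k) \<in> borel_measurable (SX n \<Otimes>\<^sub>M SE n)"
  using measurable_compose[OF measurable_fst X.measurable_coordinate]
    measurable_compose[OF measurable_snd E.measurable_coordinate] by auto

lemma next_coordinate [measurable]:
  "(\<lambda>p. fst p (nx n (fst p) i)) \<in> borel_measurable (SX n \<Otimes>\<^sub>M SE n)"
  "(\<lambda>p. snd p (nx n (fst p) i)) \<in> borel_measurable (SX n \<Otimes>\<^sub>M SE n)"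
  by (rule measurable_at_cyc_next; simp)+

lemma h_meas [measurable]: "h \<in> borel_measurable borel"
  unfolding h_def[abs_def] by measurable

lemma lim_var_meas [measurable]: "lim_var \<in> borel_measurable borel"
  unfolding lim_var_def[abs_def] by measurable

lemma Q_meas [measurable]: "Q n \<in> borel_measurable (SX n)"
proof -
  have "(\<lambda>x. m (x (nx n x i))) \<in> borel_measurable (SX n)" for i
    by (rule measurable_compose[OF X.measurable_next_coordinate m_meas]) simp
  moreover have "(\<lambda>x. m (x i)) \<in> borel_measurable (SX n)" for i
    by (rule measurable_compose[OF X.measurable_coordinate m_meas])
  ultimately show ?thesis unfolding Q_def[abs_def]
    by (intro borel_measurable_sum borel_measurable_power borel_measurable_diff)
qed

lemma T_meas [measurable]: "(\<lambda>p. T n (fst p) (snd p)) \<in> borel_measurable (SX n \<Otimes>\<^sub>M SE n)"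
proof -
  have 1: "(\<lambda>p. f (fst p i, snd p i)) \<in> borel_measurable (SX n \<Otimes>\<^sub>M SE n)" for i
    by (rule measurable_compose[OF measurable_Pair f_meas]) measurable
  have 2: "(\<lambda>p. f (fst p (nx n (fst p) i), snd p (nx n (fst p) i))) \<in> borel_measurable (SX n \<Otimes>\<^sub>M SE n)" for i
    by (rule measurable_compose[OF measurable_Pair f_meas]) (rule next_coordinate)+
  show ?thesis unfolding T_def
    by (intro borel_measurable_sum borel_measurable_add borel_measurable_times borel_measurable_const borel_measurable_power 1 2)
qed

lemma sum_h_meas [measurable]: "(\<lambda>x. \<Sum>i = 1..n. h (x i)) \<in> borel_measurable (SX n)"
  by (intro borel_measurable_sum measurable_compose[OF X.measurable_coordinate h_meas])

lemma Bn_meas [measurable]: "(\<lambda>p. Bn n (fst p) (snd p)) \<in> borel_measurable (SX n \<Otimes>\<^sub>M SE n)"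
  unfolding Bn_def
  by (intro borel_measurable_add borel_measurable_diff borel_measurable_times borel_measurable_const T_meas
      measurable_compose[OF measurable_fst sum_h_meas] measurable_compose[OF measurable_fst Q_meas])

definition Kh :: real where "Kh = \<bar>a\<bar> * (L * L) + \<bar>b\<bar> * L + \<bar>c\<bar> * L"

lemma h_bound: "\<bar>h u\<bar> \<le> Kh"
proof -
  have "\<bar>m u * m u\<bar> \<le> L * L" unfolding abs_mult using L_ge by (intro mult_mono bounds) auto
  then have "\<bar>a * (m u)\<^sup>2\<bar> \<le> \<bar>a\<bar> * (L * L)"
    unfolding power2_eq_square abs_mult[of a] by (intro mult_left_mono) auto
  moreover have "\<bar>b * m u\<bar> \<le> \<bar>b\<bar> * L" "\<bar>c * s u\<bar> \<le> \<bar>c\<bar> * L"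
    unfolding abs_mult by (intro mult_left_mono bounds; simp)+
  ultimately show ?thesis unfolding h_def Kh_def by linarith
qed

lemma link_bound: "\<bar>a * (f z * f z')\<bar> \<le> \<bar>a\<bar> * (L * L)"
proof -
  have "\<bar>f z * f z'\<bar> \<le> L * L" unfolding abs_mult using L_ge by (intro mult_mono bounds) auto
  then show ?thesis unfolding abs_mult[of a] by (intro mult_left_mono) auto
qed

lemma node_bound: "\<bar>b * f z + c * (f z)\<^sup>2\<bar> \<le> \<bar>b\<bar> * L + \<bar>c\<bar> * L"
proof -
  have "\<bar>b * f z\<bar> \<le> \<bar>b\<bar> * L" "\<bar>c * (f z)\<^sup>2\<bar> \<le> \<bar>c\<bar> * L"
    unfolding abs_mult[of b] abs_mult[of c] by (intro mult_left_mono bounds; simp)+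
  then show ?thesis by linarith
qed

lemma T_bound: "\<bar>T n x e\<bar> \<le> real n * Kh"
proof -
  have "\<bar>T n x e\<bar> \<le> real (card {1..n}) * Kh"
    unfolding T_def real_norm_def[symmetric]
  proof (rule sum_norm_bound)
    fix i
    show "norm (a * (f (x i, e i) * f (x (nx n x i), e (nx n x i))) + b * f (x i, e i) + c * (f (x i, e i))\<^sup>2) \<le> Kh"
      using link_bound[of "(x i, e i)" "(x (nx n x i), e (nx n x i))"] node_bound[of "(x i, e i)"]
      unfolding Kh_def real_norm_def by linarith
  qed
  then show ?thesis by simp
qed

lemma m_diff_square: "(m u - m u')\<^sup>2 \<le> 4 * (L * L)" "(m u - m u')\<^sup>2 \<le> 2 * L * \<bar>m u - m u'\<bar>"
proof -
  have d: "\<bar>m u - m u'\<bar> \<le> 2 * L" using bounds(3)[of u] bounds(3)[of u'] by linarith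
  have "\<bar>m u - m u'\<bar> * \<bar>m u - m u'\<bar> \<le> 2 * L * \<bar>m u - m u'\<bar>" using d by (intro mult_right_mono) auto
  then show 1: "(m u - m u')\<^sup>2 \<le> 2 * L * \<bar>m u - m u'\<bar>" by (simp add: power2_eq_square)
  have "2 * L * \<bar>m u - m u'\<bar> \<le> 2 * L * (2 * L)" using d L_ge by (intro mult_left_mono) auto
  with 1 show "(m u - m u')\<^sup>2 \<le> 4 * (L * L)" by simp
qed

lemma Q_nonneg: "0 \<le> Q n x" unfolding Q_def by (intro sum_nonneg) auto

lemma Q_bound: "Q n x \<le> real n * (4 * (L * L))"
  unfolding Q_def using sum_bounded_above[of "{1..n}" "\<lambda>i. (m (x i) - m (x (nx n x i)))\<^sup>2" "4 * (L * L)"] m_diff_square by auto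

lemma sum_h_bound: "\<bar>\<Sum>i = 1..n. h (x i)\<bar> \<le> real n * Kh"
  using sum_norm_bound[of "{1..n}" "\<lambda>i. h (x i)" Kh] h_bound by simp

definition KB :: "nat \<Rightarrow> real" where "KB n = real n * (2 * Kh + 2 * \<bar>a\<bar> * (L * L))"

lemma Bn_bound: "\<bar>Bn n x e\<bar> \<le> KB n"
proof -
  have "\<bar>a / 2 * Q n x\<bar> \<le> \<bar>a\<bar> / 2 * (real n * (4 * (L * L)))"
    unfolding abs_mult using Q_bound Q_nonneg by (intro mult_mono) auto
  then show ?thesis using T_bound[of n x e] sum_h_bound[of x n]
    unfolding Bn_def KB_def by (simp add: algebra_simps)
qed

lemma prob_SX: "prob_space (SX n)" and prob_SE: "prob_space (SE n)"
  by (rule X.prob_space_sample E.prob_space_sample)+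

lemma Q_integrable: "integrable (SX n) (Q n)"
  using Q_bound Q_nonneg
  by (intro prob_space.integrable_bounded[OF prob_SX, where B = "real n * (4 * (L * L))"]) auto

definition D :: "nat \<Rightarrow> real" where "D n = (\<integral>x. Q n x \<partial>SX n) / real n"

lemma integrable_P:
  "integrable P m" "integrable P v" "integrable P h"
  using bounds h_bound by (auto intro!: X.integrable_bounded)

lemma D_nonneg: "0 \<le> D n"
  unfolding D_def using Q_nonneg by (intro divide_nonneg_nonneg integral_nonneg_AE) auto

lemma D_bound: "D n \<le> 4 * (L * L)"
proof (cases "n = 0")
  case False
  interpret S: prob_space "SX n" by (rule prob_SX)
  have "(\<integral>x. Q n x \<partial>SX n) \<le> (\<integral>x. real n * (4 * (L * L)) \<partial>SX n)"
    by (intro integral_mono Q_integrable Q_bound) simp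
  then have "(\<integral>x. Q n x \<partial>SX n) \<le> real n * (4 * (L * L))" using S.prob_space by simp
  then show ?thesis using False by (simp add: D_def divide_le_eq mult.commute)
qed (simp add: D_def L_def)

lemma D_le: "D n \<le> 2 * L * X.neighbour_dev m n"
proof -
  let ?S = "\<lambda>x. \<Sum>i = 1..n. \<bar>m (x i) - m (x (nx n x i))\<bar>"
  have "(\<integral>x. Q n x \<partial>SX n) \<le> (\<integral>x. 2 * L * ?S x \<partial>SX n)"
  proof (intro integral_mono Q_integrable integrable_mult_right X.integrable_neighbour_sum integrable_P)
    fix x :: "nat \<Rightarrow> real"
    show "Q n x \<le> 2 * L * ?S x"
      unfolding Q_def sum_distrib_left by (intro sum_mono m_diff_square)
  qed
  then have "(\<integral>x. Q n x \<partial>SX n) \<le> 2 * L * (\<integral>x. ?S x \<partial>SX n)" by simp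
  then have "(\<integral>x. Q n x \<partial>SX n) / real n \<le> 2 * L * (\<integral>x. ?S x \<partial>SX n) / real n"
    by (rule divide_right_mono) simp
  then show ?thesis unfolding D_def X.neighbour_dev_def by (simp only: times_divide_eq_right)
qed

lemma D_tendsto_0: "D \<longlonglongrightarrow> 0"
proof (rule tendsto_sandwich[OF _ _ tendsto_const])
  show "\<forall>\<^sub>F n in sequentially. 0 \<le> D n" by (simp add: D_nonneg)
  show "\<forall>\<^sub>F n in sequentially. D n \<le> 2 * L * X.neighbour_dev m n" by (intro always_eventually allI D_le)
  show "(\<lambda>n. 2 * L * X.neighbour_dev m n) \<longlonglongrightarrow> 0"
    by (intro tendsto_mult_right_zero X.neighbour_dev_tendsto_0 integrable_P)
qed

text \<open>Deleting one observation changes \<open>Q\<close> by at most the two squared increments at it, which sum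
  up to \<open>2 * Q\<close>; hence the variance of \<open>Q\<close> is of the order of its mean, which is \<open>o(n)\<close>.\<close>

lemma variance_Q:
  assumes n: "n \<ge> 2"
  shows "(\<integral>x. (Q n x - (\<integral>x. Q n x \<partial>SX n))\<^sup>2 \<partial>SX n) \<le> 16 * (L * L) * (\<integral>x. Q n x \<partial>SX n)"
proof -
  interpret S: prob_space "SX n" by (rule prob_SX)
  define g' where "g' i x = (\<Sum>j\<in>{1..n} - {i}. (m (x j) - m (x (cyc_next ({1..n} - {i}) x j)))\<^sup>2)" for i x
  let ?B = "real n * (4 * (L * L))"
  have g'_meas: "g' i \<in> borel_measurable (SX n)" for i
  proof -
    have "(\<lambda>x. m (x (cyc_next ({1..n} - {i}) x j))) \<in> borel_measurable (SX n)" for j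
      by (rule measurable_compose[OF X.measurable_next_coordinate m_meas]) simp
    moreover have "(\<lambda>x. m (x j)) \<in> borel_measurable (SX n)" for j
      by (rule measurable_compose[OF X.measurable_coordinate m_meas])
    ultimately show ?thesis unfolding g'_def[abs_def]
      by (intro borel_measurable_sum borel_measurable_power borel_measurable_diff)
  qed
  have g'_bound: "\<bar>g' i x\<bar> \<le> ?B" for i x
  proof -
    have "\<bar>g' i x\<bar> = g' i x" unfolding g'_def by (simp add: sum_nonneg)
    also have "\<dots> \<le> real (card ({1..n} - {i})) * (4 * (L * L))"
      unfolding g'_def by (rule sum_bounded_above) (rule m_diff_square)
    also have "\<dots> \<le> ?B" using card_mono[of "{1..n}" "{1..n} - {i}"]
      by (intro mult_right_mono) (auto simp: L_def)
    finally show ?thesis .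
  qed
  have Q_abs: "\<bar>Q n x\<bar> \<le> ?B" for x using Q_bound[of n x] Q_nonneg[of n x] by simp
  have sqi: "integrable (SX n) (\<lambda>x. (Q n x - g' i x)\<^sup>2)" for i
    using abs_diff_square_le[OF Q_abs g'_bound] g'_meas
    by (intro S.integrable_bounded[where B = "(?B + ?B)\<^sup>2"]) auto
  have "(\<integral>x. (Q n x - (\<integral>x. Q n x \<partial>SX n))\<^sup>2 \<partial>SX n) \<le> (\<Sum>i\<in>{1..n}. \<integral>x. (Q n x - g' i x)\<^sup>2 \<partial>SX n)"
  proof (rule Efron_Stein[OF X.prob_space_axioms])
    fix i x y assume "i \<in> {1..n}"
    show "g' i (x(i := y)) = g' i x"
      unfolding g'_def
    proof (intro sum.cong refl)
      fix j assume j: "j \<in> {1..n} - {i}"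
      have "cyc_next ({1..n} - {i}) (x(i := y)) j = cyc_next ({1..n} - {i}) x j"
        using j by (intro cyc_next_cong) auto
      moreover have "cyc_next ({1..n} - {i}) x j \<in> {1..n} - {i}"
        using j by (intro cyc_next_in) auto
      ultimately show "(m ((x(i := y)) j) - m ((x(i := y)) (cyc_next ({1..n} - {i}) (x(i := y)) j)))\<^sup>2
        = (m (x j) - m (x (cyc_next ({1..n} - {i}) x j)))\<^sup>2" using j by simp
    qed
  qed (use Q_abs g'_bound g'_meas Q_meas in auto)
  also have "\<dots> = (\<integral>x. (\<Sum>i\<in>{1..n}. (Q n x - g' i x)\<^sup>2) \<partial>SX n)"
    using sqi by (intro Bochner_Integration.integral_sum[symmetric])
  also have "\<dots> \<le> (\<integral>x. 16 * (L * L) * Q n x \<partial>SX n)"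
  proof (intro integral_mono_AE Bochner_Integration.integrable_sum sqi integrable_mult_right Q_integrable)
    show "AE x in SX n. (\<Sum>i\<in>{1..n}. (Q n x - g' i x)\<^sup>2) \<le> 16 * (L * L) * Q n x"
      using X.AE_inj_on_sample[OF finite_atLeastAtMost]
    proof eventually_elim
      case (elim x)
      let ?N = "nx n x"
      define p where "p = inv_into {1..n} ?N"
      let ?G = "\<lambda>i j. (m (x i) - m (x j))\<^sup>2"
      have bij: "bij_betw ?N {1..n} {1..n}" using bij_betw_cyc_next[OF _ elim] by simp
      have one: "(Q n x - g' i x)\<^sup>2 \<le> 8 * (L * L) * (?G (p i) i + ?G i (?N i))" if i: "i \<in> {1..n}" for i
      proof -
        have pi: "p i \<in> {1..n}" "?N (p i) = i"
          using i bij_betw_inv_into_right[OF bij i] inv_into_into[of i ?N "{1..n}"] bij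
          by (auto simp: p_def bij_betw_def)
        have "Q n x - g' i x = ?G (p i) i + ?G i (?N i) - ?G (p i) (?N i)"
          unfolding Q_def g'_def
          using sum_cyc_next_delete[OF finite_atLeastAtMost elim _ i pi, of "\<lambda>i j. (m (x i) - m (x j))\<^sup>2"] n by simp
        moreover have "?G (p i) (?N i) \<le> 2 * (?G (p i) i + ?G i (?N i))"
        proof -
          have "0 \<le> ((m (x (p i)) - m (x i)) - (m (x i) - m (x (?N i))))\<^sup>2" by simp
          then show ?thesis by (simp add: power2_eq_square algebra_simps)
        qed
        moreover have "0 \<le> ?G (p i) (?N i)" by simp
        moreover have "\<bar>d\<bar> \<le> r" if "d = r - g" "g \<le> 2 * r" "0 \<le> g" for d r g :: real
          using that by linarith
        ultimately have "\<bar>Q n x - g' i x\<bar> \<le> ?G (p i) i + ?G i (?N i)" by blast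
        then have "\<bar>Q n x - g' i x\<bar> * \<bar>Q n x - g' i x\<bar> \<le> (?G (p i) i + ?G i (?N i)) * (?G (p i) i + ?G i (?N i))"
          by (intro mult_mono) auto
        also have "\<dots> \<le> (8 * (L * L)) * (?G (p i) i + ?G i (?N i))"
          using m_diff_square(1)[of "x (p i)" "x i"] m_diff_square(1)[of "x i" "x (?N i)"]
          by (intro mult_right_mono) auto
        finally show ?thesis by (simp add: power2_eq_square)
      qed
      have "(\<Sum>i\<in>{1..n}. (Q n x - g' i x)\<^sup>2) \<le> (\<Sum>i\<in>{1..n}. 8 * (L * L) * (?G (p i) i + ?G i (?N i)))"
        by (intro sum_mono one)
      also have "\<dots> = 8 * (L * L) * ((\<Sum>i\<in>{1..n}. ?G (p i) i) + Q n x)"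
        by (simp add: sum_distrib_left sum.distrib Q_def distrib_left)
      also have "(\<Sum>i\<in>{1..n}. ?G (p i) i) = Q n x"
      proof -
        have "(\<Sum>i\<in>{1..n}. ?G (p i) i) = (\<Sum>i\<in>{1..n}. ?G (p (?N i)) (?N i))"
          by (rule sum.reindex_bij_betw[OF bij, symmetric])
        also have "\<dots> = Q n x" unfolding Q_def
          by (intro sum.cong refl) (simp only: p_def bij_betw_inv_into_left[OF bij])
        finally show ?thesis .
      qed
      finally show ?case by simp
    qed
  qed
  finally show ?thesis by simp
qed

definition hbar :: real where "hbar = (\<integral>u. h u \<partial>P)"
definition V0 :: real where "V0 = (\<integral>u. (h u - hbar)\<^sup>2 \<partial>P)"

lemma h_centred:
  "\<bar>h u - hbar\<bar> \<le> 2 * Kh" "(\<integral>u. h u - hbar \<partial>P) = 0"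
proof -
  have "\<bar>hbar\<bar> \<le> Kh" unfolding hbar_def using X.norm_integral_le_bound[of h Kh] h_bound by simp
  then show "\<bar>h u - hbar\<bar> \<le> 2 * Kh" using h_bound[of u] by linarith
  show "(\<integral>u. h u - hbar \<partial>P) = 0" using integrable_P X.prob_space by (simp add: hbar_def)
qed

lemma sum_h_centred: "(\<Sum>i = 1..n. h (x i)) - real n * hbar = (\<Sum>i = 1..n. h (x i) - hbar)"
  by (simp add: sum_subtractf)

lemma variance_sum_h: "(\<integral>x. ((\<Sum>i = 1..n. h (x i)) - real n * hbar)\<^sup>2 \<partial>SX n) = real n * V0"
  unfolding sum_h_centred V0_def
  using X.integral_sum_square[of "{1..n}" "\<lambda>u. h u - hbar" "2 * Kh"] h_centred by simp

definition Vn :: "nat \<Rightarrow> (nat \<Rightarrow> real) \<Rightarrow> real" where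
  "Vn n x = (\<integral>e. (Bn n x e)\<^sup>2 \<partial>SE n) / real n"

lemma Bn_square_meas: "(\<lambda>x. \<integral>e. (Bn n x e)\<^sup>2 \<partial>SE n) \<in> borel_measurable (SX n)"
proof -
  interpret S: prob_space "SE n" by (rule prob_SE)
  show ?thesis
    using S.borel_measurable_lebesgue_integral[of "\<lambda>x e. (Bn n x e)\<^sup>2" "SX n"] borel_measurable_power[OF Bn_meas, of n 2]
    by (simp add: case_prod_unfold)
qed

lemma Vn_meas [measurable]: "Vn n \<in> borel_measurable (SX n)"
  unfolding Vn_def[abs_def] using Bn_square_meas by measurable

lemma Vn_eq: "n \<ge> 3 \<Longrightarrow> inj_on x {1..n} \<Longrightarrow> Vn n x = (\<Sum>i = 1..n. var_U n x i) / real n"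
  unfolding Vn_def by (simp only: integral_Bn_square)

lemma Vn_bound:
  assumes "n \<ge> 3" "inj_on x {1..n}"
  shows "\<bar>Vn n x\<bar> \<le> KU\<^sup>2"
proof -
  have "\<bar>\<Sum>i = 1..n. var_U n x i\<bar> \<le> real n * KU\<^sup>2"
    using sum_norm_bound[of "{1..n}" "var_U n x" "KU\<^sup>2"] var_U_bound[OF assms] by simp
  then show ?thesis unfolding Vn_eq[OF assms] using assms by (simp add: divide_le_eq mult.commute)
qed

definition KV :: real where
  "KV = a\<^sup>2 * L + (2 * (\<bar>a\<bar> * (L + L) + \<bar>b\<bar>) * L + 2 * \<bar>c\<bar> * L) * \<bar>a\<bar>"

lemma var_U_approx:
  "\<bar>var_U n x i - lim_var (x i)\<bar>
    \<le> KV * (\<bar>v (x i) - v (x (nx n x i))\<bar> + (\<bar>m (x (prv n x i)) - m (x i)\<bar> + \<bar>m (x i) - m (x (nx n x i))\<bar>))"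
proof -
  let ?N = "nx n x i" and ?l = "lin n x i" and ?k = "2 * a * m (x i) + b"
  let ?Kl = "\<bar>a\<bar> * (L + L) + \<bar>b\<bar>"
  let ?dm = "\<bar>m (x (prv n x i)) - m (x i)\<bar> + \<bar>m (x i) - m (x ?N)\<bar>" and ?dv = "\<bar>v (x i) - v (x ?N)\<bar>"
  have kb: "\<bar>?k\<bar> \<le> ?Kl"
  proof -
    have "\<bar>2 * a * m (x i)\<bar> \<le> \<bar>a\<bar> * (L + L)"
      using mult_left_mono[OF bounds(3)[of "x i"], of "\<bar>a\<bar>"] by (simp add: abs_mult)
    then show ?thesis by linarith
  qed
  have lk: "\<bar>?l - ?k\<bar> \<le> \<bar>a\<bar> * ?dm"
  proof -
    have "?l - ?k = a * ((m (x (prv n x i)) - m (x i)) + (m (x ?N) - m (x i)))"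
      by (simp add: lin_def algebra_simps)
    also have "\<bar>\<dots>\<bar> \<le> \<bar>a\<bar> * ?dm" unfolding abs_mult by (intro mult_left_mono) auto
    finally show ?thesis .
  qed
  have eq: "var_U n x i - lim_var (x i) = a\<^sup>2 * (v (x i) * (v (x ?N) - v (x i)))
      + ((?l + ?k) * v (x i) + 2 * c * q (x i)) * (?l - ?k)"
    unfolding var_U_def lim_var_def by (simp add: power2_eq_square algebra_simps)
  define dv where "dv = ?dv"
  define dm where "dm = ?dm"
  define Kl where "Kl = ?Kl"
  have nonneg: "0 \<le> dv" "0 \<le> dm" "0 \<le> Kl" using kb by (auto simp: dv_def dm_def Kl_def)
  have "\<bar>v (x i) * (v (x ?N) - v (x i))\<bar> \<le> L * dv"
    unfolding abs_mult dv_def using L_ge by (intro mult_mono bounds) auto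
  then have 1: "\<bar>a\<^sup>2 * (v (x i) * (v (x ?N) - v (x i)))\<bar> \<le> a\<^sup>2 * (L * dv)"
    unfolding abs_mult[of "a\<^sup>2"] by (intro mult_mono) auto
  have "\<bar>?l + ?k\<bar> \<le> 2 * Kl"
    using add_mono[OF lin_bound[of n x i] kb] order_trans[OF abs_triangle_ineq[of ?l ?k]]
    unfolding Kl_def[symmetric] mult_2 by blast
  then have "\<bar>(?l + ?k) * v (x i)\<bar> \<le> 2 * Kl * L"
    unfolding abs_mult using nonneg by (intro mult_mono bounds) auto
  moreover have "\<bar>2 * c * q (x i)\<bar> \<le> 2 * \<bar>c\<bar> * L"
    using mult_left_mono[OF bounds(8)[of "x i"], of "2 * \<bar>c\<bar>"] by (simp add: abs_mult)
  ultimately have 2: "\<bar>(?l + ?k) * v (x i) + 2 * c * q (x i)\<bar> \<le> 2 * Kl * L + 2 * \<bar>c\<bar> * L"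
    by (intro order_trans[OF abs_triangle_ineq] add_mono)
  have 3: "\<bar>((?l + ?k) * v (x i) + 2 * c * q (x i)) * (?l - ?k)\<bar> \<le> (2 * Kl * L + 2 * \<bar>c\<bar> * L) * (\<bar>a\<bar> * dm)"
    unfolding abs_mult[of "(?l + ?k) * v (x i) + 2 * c * q (x i)"] dm_def
    by (intro mult_mono lk 2 order_trans[OF abs_ge_zero 2] abs_ge_zero)
  have KV: "KV = a\<^sup>2 * L + (2 * Kl * L + 2 * \<bar>c\<bar> * L) * \<bar>a\<bar>" by (simp add: KV_def Kl_def)
  have "a\<^sup>2 * L \<le> KV" "(2 * Kl * L + 2 * \<bar>c\<bar> * L) * \<bar>a\<bar> \<le> KV"
    using L_ge nonneg unfolding KV by auto
  then have "(a\<^sup>2 * L) * dv \<le> KV * dv" "((2 * Kl * L + 2 * \<bar>c\<bar> * L) * \<bar>a\<bar>) * dm \<le> KV * dm"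
    using nonneg by (intro mult_right_mono; simp)+
  then have "\<bar>var_U n x i - lim_var (x i)\<bar> \<le> KV * dv + KV * dm"
    unfolding eq using 1 3 by (intro order_trans[OF abs_triangle_ineq] add_mono) (simp_all add: mult.assoc)
  then show ?thesis unfolding dv_def dm_def by (simp only: distrib_left)
qed

lemma lim_var_bound: "\<exists>K. \<forall>u. \<bar>lim_var u\<bar> \<le> K"
proof -
  have 1: "\<bar>lim_var u\<bar> \<le> a\<^sup>2 * L\<^sup>2 + ((2 * \<bar>a\<bar> * L + \<bar>b\<bar>)\<^sup>2 * L + 2 * (2 * \<bar>a\<bar> * L + \<bar>b\<bar>) * \<bar>c\<bar> * L + c\<^sup>2 * L)" for u
  proof -
    let ?k = "2 * a * m u + b" and ?K = "2 * \<bar>a\<bar> * L + \<bar>b\<bar>"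
    have "\<bar>2 * a * m u\<bar> \<le> 2 * \<bar>a\<bar> * L"
      using mult_left_mono[OF bounds(3)[of u], of "2 * \<bar>a\<bar>"] by (simp add: abs_mult)
    then have k: "\<bar>?k\<bar> \<le> ?K" by linarith
    have "\<bar>a\<^sup>2 * (v u)\<^sup>2\<bar> \<le> a\<^sup>2 * L\<^sup>2"
      using power_mono[OF bounds(7)[of u], of 2] by (simp add: abs_mult mult_left_mono)
    moreover have "\<bar>?k\<^sup>2 * v u\<bar> \<le> ?K\<^sup>2 * L"
      using power_mono[OF k, of 2] L_ge unfolding abs_mult by (intro mult_mono bounds) auto
    moreover have "\<bar>2 * ?k * c * q u\<bar> \<le> 2 * ?K * \<bar>c\<bar> * L"
      using k L_ge unfolding abs_mult by (intro mult_mono bounds) auto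
    moreover have "\<bar>c\<^sup>2 * w u\<bar> \<le> c\<^sup>2 * L" using bounds(9)[of u] by (simp add: abs_mult mult_left_mono)
    ultimately show ?thesis unfolding lim_var_def
      by (intro order_trans[OF abs_triangle_ineq] add_mono)
  qed
  then show ?thesis by blast
qed

lemma T_increment:
  assumes n: "n \<ge> 1" and inj: "inj_on x {1..Suc n}"
  shows "\<bar>T (Suc n) x e - T n x e\<bar> \<le> 3 * (\<bar>a\<bar> * (L * L)) + (\<bar>b\<bar> * L + \<bar>c\<bar> * L)"
proof -
  let ?i = "Suc n" and ?A = "{1..Suc n}"
  let ?G = "\<lambda>i j. a * (f (x i, e i) * f (x j, e j))"
  let ?r = "\<lambda>i. b * f (x i, e i) + c * (f (x i, e i))\<^sup>2"
  have bij: "bij_betw (cyc_next ?A x) ?A ?A" using bij_betw_cyc_next[OF _ inj] by simp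
  have i: "?i \<in> ?A" by simp
  then have "?i \<in> cyc_next ?A x ` ?A" using bij by (simp add: bij_betw_def)
  then obtain p where p: "p \<in> ?A" "cyc_next ?A x p = ?i" by (metis imageE)
  have A: "?A - {?i} = {1..n}" by auto
  have Teq: "T k x e = (\<Sum>i = 1..k. ?G i (nx k x i)) + (\<Sum>i = 1..k. ?r i)" for k
    unfolding T_def by (simp add: sum.distrib add.assoc)
  have "(\<Sum>i = 1..Suc n. ?G i (nx (Suc n) x i)) - (\<Sum>i = 1..n. ?G i (nx n x i))
      = ?G p ?i + ?G ?i (nx (Suc n) x ?i) - ?G p (nx (Suc n) x ?i)"
    using sum_cyc_next_delete[OF finite_atLeastAtMost inj _ i p, of ?G] n unfolding A by simp
  then have eq: "T (Suc n) x e - T n x e = ?G p ?i + ?G ?i (nx (Suc n) x ?i) - ?G p (nx (Suc n) x ?i) + ?r ?i"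
    unfolding Teq by (simp add: algebra_simps)
  have tri: "\<bar>g1 + g2 - g3 + r\<bar> \<le> 3 * A + B" if "\<bar>g1\<bar> \<le> A" "\<bar>g2\<bar> \<le> A" "\<bar>g3\<bar> \<le> A" "\<bar>r\<bar> \<le> B"
    for g1 g2 g3 r A B :: real using that by linarith
  show ?thesis unfolding eq by (intro tri link_bound node_bound)
qed

end

section \<open>Second moments and characteristic functions\<close>

lemma exp_minus_diff_le:
  fixes x y :: real
  assumes "0 \<le> x" "0 \<le> y"
  shows "\<bar>exp (- x) - exp (- y)\<bar> \<le> \<bar>x - y\<bar>"
proof -
  have *: "exp (- x) - exp (- y) \<le> y - x" if "0 \<le> x" "x \<le> y" for x y :: real
  proof -
    have "exp (- x) - exp (- y) = exp (- x) * (1 - exp (- (y - x)))"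
      by (simp add: algebra_simps exp_add[symmetric])
    also have "\<dots> \<le> 1 * (y - x)"
    proof (rule mult_mono)
      show "1 - exp (- (y - x)) \<le> y - x" using exp_ge_add_one_self[of "- (y - x)"] by linarith
    qed (use that in auto)
    finally show ?thesis by simp
  qed
  show ?thesis
  proof (cases "x \<le> y")
    case True
    then show ?thesis using *[of x y] assms by simp
  next
    case False
    then show ?thesis using *[of y x] assms by simp
  qed
qed

lemma norm_square_le: "\<bar>y\<bar> \<le> B \<Longrightarrow> norm (y\<^sup>2) \<le> B\<^sup>2" for y B :: real
  using power_mono[of "\<bar>y\<bar>" B 2] by simp

lemma sum_squares_bound3: "(u + y + s)\<^sup>2 \<le> 3 * (u\<^sup>2 + y\<^sup>2 + s\<^sup>2)" for u y s :: real
proof -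
  have "0 \<le> (u - y)\<^sup>2 + (y - s)\<^sup>2 + (u - s)\<^sup>2" by simp
  then show ?thesis by (simp add: power2_eq_square algebra_simps)
qed

lemma norm_iexp_minus_one: "norm (iexp y - 1) \<le> \<bar>y\<bar>"
  using iexp_approx1[of y 0] by simp

context rank_model
begin

abbreviation J :: "nat \<Rightarrow> ((nat \<Rightarrow> real) \<times> (nat \<Rightarrow> real)) measure" where "J n \<equiv> SX n \<Otimes>\<^sub>M SE n"

definition Z :: "nat \<Rightarrow> (nat \<Rightarrow> real) \<Rightarrow> (nat \<Rightarrow> real) \<Rightarrow> real" where
  "Z n x e = T n x e - real n * (hbar - a / 2 * D n)"

lemma pair_prob_space_J: "pair_prob_space (SX n) (SE n)"
  using prob_SX prob_SE by (simp add: pair_prob_space_def pair_sigma_finite_def prob_space_imp_sigma_finite)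

lemma prob_J: "prob_space (J n)"
proof -
  interpret J: pair_prob_space "SX n" "SE n" by (rule pair_prob_space_J)
  show ?thesis by unfold_locales
qed

lemma integral_J:
  fixes F :: "(nat \<Rightarrow> real) \<times> (nat \<Rightarrow> real) \<Rightarrow> 'b::{banach, second_countable_topology}"
  assumes "F \<in> borel_measurable (J n)" "\<And>p. norm (F p) \<le> B"
  shows "(\<integral>p. F p \<partial>J n) = (\<integral>x. (\<integral>e. F (x, e) \<partial>SE n) \<partial>SX n)"
    and "(\<lambda>x. \<integral>e. F (x, e) \<partial>SE n) \<in> borel_measurable (SX n)"
proof -
  interpret J: pair_prob_space "SX n" "SE n" by (rule pair_prob_space_J)
  have i: "integrable (J n) F" using assms by (rule prob_space.integrable_bounded[OF prob_J])
  show "(\<integral>p. F p \<partial>J n) = (\<integral>x. (\<integral>e. F (x, e) \<partial>SE n) \<partial>SX n)"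
    using J.integral_fst'[OF i] by simp
  show "(\<lambda>x. \<integral>e. F (x, e) \<partial>SE n) \<in> borel_measurable (SX n)"
    using assms(1) by (intro J.M2.borel_measurable_lebesgue_integral) (simp add: case_prod_unfold)
qed

lemma integral_J_fst:
  fixes F :: "(nat \<Rightarrow> real) \<Rightarrow> real"
  assumes [measurable]: "F \<in> borel_measurable (SX n)" and "\<And>x. \<bar>F x\<bar> \<le> B"
  shows "(\<integral>p. F (fst p) \<partial>J n) = (\<integral>x. F x \<partial>SX n)"
proof -
  interpret S: prob_space "SE n" by (rule prob_SE)
  show ?thesis using assms S.prob_space by (subst integral_J(1)[where B = B]) auto
qed

lemma Z_meas [measurable]: "(\<lambda>p. Z n (fst p) (snd p)) \<in> borel_measurable (J n)"
  unfolding Z_def by (intro borel_measurable_diff T_meas borel_measurable_const)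

definition EQ :: "nat \<Rightarrow> real" where "EQ n = (\<integral>x. Q n x \<partial>SX n)"

lemma EQ_D: "EQ n = real n * D n"
  by (cases "n = 0") (simp_all add: EQ_def D_def Q_def)

lemma Z_split: "Z n x e = Bn n x e + ((\<Sum>i = 1..n. h (x i)) - real n * hbar) + (- (a / 2 * (Q n x - EQ n)))"
  unfolding Z_def Bn_def EQ_D by (simp add: algebra_simps)

lemma EQ_nonneg: "0 \<le> EQ n" unfolding EQ_D using D_nonneg by simp

lemma EQ_bound: "EQ n \<le> real n * (4 * (L * L))"
  unfolding EQ_D using D_bound by (intro mult_left_mono) auto

lemma Q_dev_bound: "\<bar>Q n x - EQ n\<bar> \<le> real n * (4 * (L * L))"
  using Q_bound[of n x] Q_nonneg[of n x] EQ_nonneg[of n] EQ_bound[of n] by linarith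

lemma sum_h_dev_bound: "\<bar>(\<Sum>i = 1..n. h (x i)) - real n * hbar\<bar> \<le> real n * (2 * Kh)"
  unfolding sum_h_centred using sum_norm_bound[of "{1..n}" "\<lambda>i. h (x i) - hbar" "2 * Kh"] h_centred by simp

definition KZ :: "nat \<Rightarrow> real" where
  "KZ n = KB n + real n * (2 * Kh) + \<bar>a / 2\<bar> * (real n * (4 * (L * L)))"

lemma Z_bound: "\<bar>Z n x e\<bar> \<le> KZ n"
proof -
  have "\<bar>- (a / 2 * (Q n x - EQ n))\<bar> \<le> \<bar>a / 2\<bar> * (real n * (4 * (L * L)))"
    unfolding abs_minus_cancel abs_mult[of "a / 2"] by (intro mult_left_mono Q_dev_bound) simp
  then show ?thesis unfolding Z_split KZ_def
    by (intro order_trans[OF abs_triangle_ineq] add_mono Bn_bound sum_h_dev_bound)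
qed

lemma Vn_integral:
  assumes n: "n \<ge> 3"
  shows "(\<integral>p. (Bn n (fst p) (snd p))\<^sup>2 \<partial>J n) \<le> real n * KU\<^sup>2"
proof -
  interpret S: prob_space "SX n" by (rule prob_SX)
  have "(\<integral>p. (Bn n (fst p) (snd p))\<^sup>2 \<partial>J n) = (\<integral>x. (\<integral>e. (Bn n x e)\<^sup>2 \<partial>SE n) \<partial>SX n)"
    using integral_J(1)[OF borel_measurable_power[OF Bn_meas] norm_square_le[OF Bn_bound]] by simp
  also have "\<dots> = (\<integral>x. real n * Vn n x \<partial>SX n)" using n by (simp add: Vn_def)
  also have "\<dots> \<le> (\<integral>x. real n * KU\<^sup>2 \<partial>SX n)"
  proof (rule integral_mono_AE)
    have ae: "AE x in SX n. norm (Vn n x) \<le> KU\<^sup>2"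
      using X.AE_inj_on_sample[OF finite_atLeastAtMost] by eventually_elim (use Vn_bound n in auto)
    show "integrable (SX n) (\<lambda>x. real n * Vn n x)"
      by (intro integrable_mult_right S.integrable_const_bound[OF ae] Vn_meas)
    show "AE x in SX n. real n * Vn n x \<le> real n * KU\<^sup>2"
      using ae by eventually_elim (simp add: mult_left_mono)
  qed simp
  also have "\<dots> = real n * KU\<^sup>2" using S.prob_space by simp
  finally show ?thesis .
qed

definition K2 :: real where "K2 = 3 * (KU\<^sup>2 + V0 + \<bar>a / 2\<bar>\<^sup>2 * (16 * (L * L) * (4 * (L * L))))"

lemma Z_square_integrable: "integrable (J n) (\<lambda>p. (Z n (fst p) (snd p))\<^sup>2)"
  by (intro prob_space.integrable_bounded[OF prob_J, where B = "(KZ n)\<^sup>2"] norm_square_le Z_bound) simp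

theorem second_moment:
  assumes n: "n \<ge> 3"
  shows "(\<integral>p. (Z n (fst p) (snd p))\<^sup>2 \<partial>J n) \<le> K2 * real n"
proof -
  interpret J: prob_space "J n" by (rule prob_J)
  let ?S = "\<lambda>x. ((\<Sum>i = 1..n. h (x i)) - real n * hbar)\<^sup>2"
  let ?Q = "\<lambda>x. (Q n x - EQ n)\<^sup>2"
  have sb: "\<bar>?S x\<bar> \<le> (real n * (2 * Kh))\<^sup>2" for x
    using power_mono[OF sum_h_dev_bound[of x n], of 2] by simp
  have qb: "\<bar>?Q x\<bar> \<le> (real n * (4 * (L * L)))\<^sup>2" for x
    using power_mono[OF Q_dev_bound[of n x], of 2] by simp
  have sm: "?S \<in> borel_measurable (SX n)" by (intro borel_measurable_power borel_measurable_diff sum_h_meas) simp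
  have qm: "?Q \<in> borel_measurable (SX n)" by measurable
  have iB: "integrable (J n) (\<lambda>p. (Bn n (fst p) (snd p))\<^sup>2)"
    by (intro J.integrable_bounded[where B = "(KB n)\<^sup>2"] norm_square_le Bn_bound borel_measurable_power Bn_meas)
  have iS: "integrable (J n) (\<lambda>p. ?S (fst p))"
    using sb by (intro J.integrable_bounded[where B = "(real n * (2 * Kh))\<^sup>2"] measurable_compose[OF measurable_fst sm]) simp
  have iQ: "integrable (J n) (\<lambda>p. ?Q (fst p))"
    using qb by (intro J.integrable_bounded[where B = "(real n * (4 * (L * L)))\<^sup>2"] measurable_compose[OF measurable_fst qm]) simp
  have "(\<integral>p. (Z n (fst p) (snd p))\<^sup>2 \<partial>J n)
    \<le> (\<integral>p. 3 * ((Bn n (fst p) (snd p))\<^sup>2 + ?S (fst p) + \<bar>a / 2\<bar>\<^sup>2 * ?Q (fst p)) \<partial>J n)"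
  proof (intro integral_mono Z_square_integrable integrable_mult_right Bochner_Integration.integrable_add iB iS iQ)
    fix p
    show "(Z n (fst p) (snd p))\<^sup>2 \<le> 3 * ((Bn n (fst p) (snd p))\<^sup>2 + ?S (fst p) + \<bar>a / 2\<bar>\<^sup>2 * ?Q (fst p))"
      using sum_squares_bound3[of "Bn n (fst p) (snd p)" "(\<Sum>i = 1..n. h (fst p i)) - real n * hbar" "- (a / 2 * (Q n (fst p) - EQ n))"]
      unfolding Z_split by (simp add: power_mult_distrib power_divide)
  qed
  also have "\<dots> = 3 * ((\<integral>p. (Bn n (fst p) (snd p))\<^sup>2 \<partial>J n) + (\<integral>p. ?S (fst p) \<partial>J n) + \<bar>a / 2\<bar>\<^sup>2 * (\<integral>p. ?Q (fst p) \<partial>J n))"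
    using iB iS iQ by simp
  also have "(\<integral>p. ?S (fst p) \<partial>J n) = real n * V0"
    using integral_J_fst[OF sm sb] variance_sum_h by simp
  also have "(\<integral>p. ?Q (fst p) \<partial>J n) = (\<integral>x. ?Q x \<partial>SX n)"
    using integral_J_fst[OF qm qb] by simp
  also have "3 * ((\<integral>p. (Bn n (fst p) (snd p))\<^sup>2 \<partial>J n) + real n * V0 + \<bar>a / 2\<bar>\<^sup>2 * (\<integral>x. ?Q x \<partial>SX n))
      \<le> 3 * (real n * KU\<^sup>2 + real n * V0 + \<bar>a / 2\<bar>\<^sup>2 * (16 * (L * L) * (real n * (4 * (L * L)))))"
  proof -
    have "(\<integral>x. ?Q x \<partial>SX n) \<le> 16 * (L * L) * EQ n"
      using variance_Q[of n] n unfolding EQ_def by simp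
    also have "\<dots> \<le> 16 * (L * L) * (real n * (4 * (L * L)))"
      by (intro mult_left_mono EQ_bound) (simp add: L_def)
    finally have "\<bar>a / 2\<bar>\<^sup>2 * (\<integral>x. ?Q x \<partial>SX n) \<le> \<bar>a / 2\<bar>\<^sup>2 * (16 * (L * L) * (real n * (4 * (L * L))))"
      by (intro mult_left_mono) auto
    moreover have "3 * (A + B + C) \<le> 3 * (A' + B + C')" if "C \<le> C'" "A \<le> A'" for A A' B C C' :: real
      using that by simp
    ultimately show ?thesis using Vn_integral[OF n] by blast
  qed
  also have "\<dots> = K2 * real n" unfolding K2_def by (simp add: algebra_simps)
  finally show ?thesis .
qed

definition V1 :: real where "V1 = (\<integral>u. lim_var u \<partial>P)"

lemma Vn_dev_integrable:
  assumes n: "n \<ge> 3"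
  shows "integrable (SX n) (\<lambda>x. \<bar>Vn n x - V1\<bar>)"
proof -
  have "AE x in SX n. norm (\<bar>Vn n x - V1\<bar>) \<le> KU\<^sup>2 + \<bar>V1\<bar>"
    using X.AE_inj_on_sample[OF finite_atLeastAtMost]
  proof eventually_elim
    case (elim x)
    then show ?case using Vn_bound[OF n elim] by simp
  qed
  then show ?thesis by (intro finite_measure.integrable_const_bound prob_space.finite_measure prob_SX) measurable
qed

lemma Vn_dev_tendsto: "(\<lambda>n. \<integral>x. \<bar>Vn n x - V1\<bar> \<partial>SX n) \<longlonglongrightarrow> 0"
proof -
  obtain K where K: "\<And>u. \<bar>lim_var u\<bar> \<le> K" using lim_var_bound by blast
  have iL: "integrable P lim_var" using K by (intro X.integrable_bounded[where B = K]) auto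
  have V1K: "\<bar>V1\<bar> \<le> K" unfolding V1_def using X.norm_integral_le_bound[of lim_var K] K by simp
  have gb: "\<bar>lim_var u - V1\<bar> \<le> 2 * K" for u using K[of u] V1K by linarith
  have g0: "(\<integral>u. lim_var u - V1 \<partial>P) = 0" using iL X.prob_space by (simp add: V1_def)
  have K0: "0 \<le> K" using V1K by linarith
  have bound: "(\<integral>x. \<bar>Vn n x - V1\<bar> \<partial>SX n) \<le> KV * (X.neighbour_dev v n + 2 * X.neighbour_dev m n) + 2 * K / sqrt (real n)"
    if n: "n \<ge> 3" for n
  proof -
    interpret S: prob_space "SX n" by (rule prob_SX)
    let ?g = "\<lambda>x. (\<Sum>i = 1..n. lim_var (x i) - V1) / real n"
    let ?Nv = "\<lambda>x. \<Sum>i = 1..n. \<bar>v (x i) - v (x (nx n x i))\<bar>" and ?Nm = "\<lambda>x. \<Sum>i = 1..n. \<bar>m (x i) - m (x (nx n x i))\<bar>"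
    have gm: "(\<lambda>x. \<Sum>i = 1..n. lim_var (x i) - V1) \<in> borel_measurable (SX n)"
      by (intro borel_measurable_sum borel_measurable_diff borel_measurable_const
            measurable_compose[OF X.measurable_coordinate lim_var_meas])
    have g1: "\<bar>\<Sum>i = 1..n. lim_var (x i) - V1\<bar> \<le> real n * (2 * K)" for x
      using sum_norm_bound[of "{1..n}" "\<lambda>i. lim_var (x i) - V1" "2 * K"] gb by simp
    have g2: "\<bar>?g x\<bar> \<le> 2 * K" for x
      using g1[of x] n by (simp add: divide_le_eq mult.commute)
    have ig: "integrable (SX n) (\<lambda>x. \<bar>?g x\<bar>)"
      using g2 gm by (intro S.integrable_bounded[where B = "2 * K"]) auto
    have iN: "integrable (SX n) ?Nv" "integrable (SX n) ?Nm"
      by (intro X.integrable_neighbour_sum integrable_P)+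
    have ae: "AE x in SX n. \<bar>Vn n x - V1\<bar> \<le> KV / real n * (?Nv x + 2 * ?Nm x) + \<bar>?g x\<bar>"
      using X.AE_inj_on_sample[OF finite_atLeastAtMost]
    proof eventually_elim
      case (elim x)
      have "Vn n x - V1 = (\<Sum>i = 1..n. var_U n x i - lim_var (x i)) / real n + ?g x"
        using n by (simp add: Vn_eq[OF n elim] sum_subtractf diff_divide_distrib)
      moreover have "\<bar>\<Sum>i = 1..n. var_U n x i - lim_var (x i)\<bar> \<le> KV * (?Nv x + 2 * ?Nm x)"
      proof -
        have "\<bar>\<Sum>i = 1..n. var_U n x i - lim_var (x i)\<bar> \<le> (\<Sum>i = 1..n. KV * (\<bar>v (x i) - v (x (nx n x i))\<bar>
            + (\<bar>m (x (prv n x i)) - m (x i)\<bar> + \<bar>m (x i) - m (x (nx n x i))\<bar>)))"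
          by (intro order_trans[OF sum_abs] sum_mono var_U_approx)
        also have "\<dots> = KV * (?Nv x + ((\<Sum>i = 1..n. \<bar>m (x (prv n x i)) - m (x i)\<bar>) + ?Nm x))"
          by (simp add: sum_distrib_left[symmetric] sum.distrib)
        also have "(\<Sum>i = 1..n. \<bar>m (x (prv n x i)) - m (x i)\<bar>) = ?Nm x"
          using sum_prv[OF n elim, of "\<lambda>i j. \<bar>m (x i) - m (x j)\<bar>"] .
        finally show ?thesis by simp
      qed
      then have "\<bar>(\<Sum>i = 1..n. var_U n x i - lim_var (x i)) / real n\<bar> \<le> KV / real n * (?Nv x + 2 * ?Nm x)"
        using divide_right_mono[of _ _ "real n"] by simp
      ultimately show ?case by linarith
    qed
    have "(\<integral>x. \<bar>Vn n x - V1\<bar> \<partial>SX n) \<le> (\<integral>x. KV / real n * (?Nv x + 2 * ?Nm x) + \<bar>?g x\<bar> \<partial>SX n)"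
      by (intro integral_mono_AE ae Bochner_Integration.integrable_add integrable_mult_right iN ig Vn_dev_integrable n)
    also have "\<dots> = KV / real n * ((\<integral>x. ?Nv x \<partial>SX n) + 2 * (\<integral>x. ?Nm x \<partial>SX n)) + (\<integral>x. \<bar>?g x\<bar> \<partial>SX n)"
    proof -
      have i2: "integrable (SX n) (\<lambda>x. ?Nv x + 2 * ?Nm x)"
        by (intro Bochner_Integration.integrable_add integrable_mult_right iN)
      have "(\<integral>x. ?Nv x + 2 * ?Nm x \<partial>SX n) = (\<integral>x. ?Nv x \<partial>SX n) + 2 * (\<integral>x. ?Nm x \<partial>SX n)"
        using Bochner_Integration.integral_add[OF iN(1) integrable_mult_right[OF iN(2), of 2]] by simp
      then show ?thesis using Bochner_Integration.integral_add[OF integrable_mult_right[OF i2, of "KV / real n"] ig] by simp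
    qed
    also have "KV / real n * ((\<integral>x. ?Nv x \<partial>SX n) + 2 * (\<integral>x. ?Nm x \<partial>SX n))
        = KV * (X.neighbour_dev v n + 2 * X.neighbour_dev m n)"
      unfolding X.neighbour_dev_def by (simp add: add_divide_distrib algebra_simps)
    also have "(\<integral>x. \<bar>?g x\<bar> \<partial>SX n) \<le> sqrt (\<integral>x. (?g x)\<^sup>2 \<partial>SX n)"
      using gm g2 by (intro S.integral_abs_le_sqrt[where B = "2 * K"]) auto
    also have "(\<integral>x. (?g x)\<^sup>2 \<partial>SX n) = (\<integral>u. (lim_var u - V1)\<^sup>2 \<partial>P) / real n"
      using X.integral_sum_square[of "{1..n}" "\<lambda>u. lim_var u - V1" "2 * K"] gb g0 n
      by (simp add: power_divide power2_eq_square)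
    also have "sqrt \<dots> \<le> sqrt ((2 * K)\<^sup>2 / real n)"
    proof -
      have "(\<integral>u. (lim_var u - V1)\<^sup>2 \<partial>P) \<le> norm (\<integral>u. (lim_var u - V1)\<^sup>2 \<partial>P)" by simp
      also have "\<dots> \<le> (2 * K)\<^sup>2"
      proof (rule X.norm_integral_le_bound)
        show "norm ((lim_var u - V1)\<^sup>2) \<le> (2 * K)\<^sup>2" for u using power_mono[OF gb[of u], of 2] by simp
      qed simp
      finally show ?thesis by (intro real_sqrt_le_mono divide_right_mono) auto
    qed
    also have "sqrt ((2 * K)\<^sup>2 / real n) = 2 * K / sqrt (real n)"
      using K0 by (simp add: real_sqrt_divide real_sqrt_mult)
    finally show ?thesis by simp
  qed
  have lim: "(\<lambda>n. KV * (X.neighbour_dev v n + 2 * X.neighbour_dev m n) + 2 * K / sqrt (real n)) \<longlonglongrightarrow> KV * (0 + 2 * 0) + 0"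
    by (intro tendsto_add tendsto_mult tendsto_const X.neighbour_dev_tendsto_0 integrable_P tendsto_divide_0[OF tendsto_const]
          filterlim_at_top_imp_at_infinity filterlim_compose[OF sqrt_at_top] filterlim_real_sequentially)
  show ?thesis
  proof (rule tendsto_sandwich[OF _ _ tendsto_const])
    show "\<forall>\<^sub>F n in sequentially. 0 \<le> (\<integral>x. \<bar>Vn n x - V1\<bar> \<partial>SX n)" by simp
    show "\<forall>\<^sub>F n in sequentially. (\<integral>x. \<bar>Vn n x - V1\<bar> \<partial>SX n)
        \<le> KV * (X.neighbour_dev v n + 2 * X.neighbour_dev m n) + 2 * K / sqrt (real n)"
      by (rule eventually_sequentiallyI[of 3]) (rule bound)
  qed (use lim in simp)
qed

lemma Q_dev_tendsto: "(\<lambda>n. (\<integral>x. \<bar>Q n x - EQ n\<bar> \<partial>SX n) / sqrt (real n)) \<longlonglongrightarrow> 0"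
proof (rule tendsto_sandwich[OF _ _ tendsto_const])
  show "\<forall>\<^sub>F n in sequentially. 0 \<le> (\<integral>x. \<bar>Q n x - EQ n\<bar> \<partial>SX n) / sqrt (real n)" by simp
  have "(\<integral>x. \<bar>Q n x - EQ n\<bar> \<partial>SX n) / sqrt (real n) \<le> 4 * L * sqrt (D n)" if n: "n \<ge> 2" for n
  proof -
    interpret S: prob_space "SX n" by (rule prob_SX)
    have "(\<integral>x. \<bar>Q n x - EQ n\<bar> \<partial>SX n) \<le> sqrt (\<integral>x. (Q n x - EQ n)\<^sup>2 \<partial>SX n)"
      using Q_dev_bound by (intro S.integral_abs_le_sqrt[where B = "real n * (4 * (L * L))"]) auto
    also have "\<dots> \<le> sqrt (16 * (L * L) * EQ n)"
      using variance_Q[OF n] unfolding EQ_def by (intro real_sqrt_le_mono)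
    also have "16 * (L * L) * EQ n = (4 * L)\<^sup>2 * (real n * D n)" by (simp add: EQ_D power2_eq_square)
    also have "sqrt \<dots> = 4 * L * sqrt (D n) * sqrt (real n)"
      using L_ge by (simp add: real_sqrt_mult)
    finally show ?thesis using n by (simp add: divide_le_eq)
  qed
  then show "\<forall>\<^sub>F n in sequentially. (\<integral>x. \<bar>Q n x - EQ n\<bar> \<partial>SX n) / sqrt (real n) \<le> 4 * L * sqrt (D n)"
    by (intro eventually_sequentiallyI[of 2]) 
  have "(\<lambda>n. sqrt (D n)) \<longlonglongrightarrow> sqrt 0" by (intro tendsto_real_sqrt D_tendsto_0)
  then show "(\<lambda>n. 4 * L * sqrt (D n)) \<longlonglongrightarrow> 0" by (intro tendsto_mult_right_zero) simp
qed

lemma V1_nonneg: "0 \<le> V1"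
proof (rule ccontr)
  assume neg: "\<not> 0 \<le> V1"
  have "\<bar>V1\<bar> \<le> (\<integral>x. \<bar>Vn n x - V1\<bar> \<partial>SX n)" if n: "n \<ge> 3" for n
  proof -
    interpret S: prob_space "SX n" by (rule prob_SX)
    have "(\<integral>x. \<bar>V1\<bar> \<partial>SX n) \<le> (\<integral>x. \<bar>Vn n x - V1\<bar> \<partial>SX n)"
    proof (rule integral_mono_AE)
      show "integrable (SX n) (\<lambda>x. \<bar>Vn n x - V1\<bar>)" by (rule Vn_dev_integrable[OF n])
      have "0 \<le> Vn n x" for x unfolding Vn_def by (intro divide_nonneg_nonneg integral_nonneg_AE) auto
      then show "AE x in SX n. \<bar>V1\<bar> \<le> \<bar>Vn n x - V1\<bar>" using neg by (intro AE_I2) (smt (verit))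
    qed simp
    then show ?thesis using S.prob_space by simp
  qed
  then have "\<bar>V1\<bar> \<le> 0"
    by (intro tendsto_lowerbound[OF Vn_dev_tendsto]) (auto intro: eventually_sequentiallyI[of 3])
  then show False using neg by simp
qed

theorem char_tendsto:
  "(\<lambda>n. \<integral>p. iexp (t * (Z n (fst p) (snd p) / sqrt (real n))) \<partial>J n) \<longlonglongrightarrow> exp (- (t\<^sup>2 * (V0 + V1) / 2))"
proof -
  let ?r = "\<lambda>n. sqrt (real n)"
  let ?S = "\<lambda>n x. (\<Sum>i = 1..n. h (x i) - hbar) / ?r n"
  let ?q = "\<lambda>n x. - (a / 2 * (Q n x - EQ n)) / ?r n"
  let ?Kt = "\<bar>t\<bar> * (16 * KU ^ 3 * t\<^sup>2 + \<bar>t\<bar> * (16 * KU\<^sup>2))"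
  define \<psi> where "\<psi> n x = (\<integral>e. iexp (t * (Bn n x e / ?r n)) \<partial>SE n)" for n x
  define ch where "ch n = (\<integral>x. iexp (t * ?S n x) \<partial>SX n)" for n
  define e1 where "e1 = exp (- (t\<^sup>2 * V1 / 2))"
  have Sm [measurable]: "?S n \<in> borel_measurable (SX n)" for n
    by (intro borel_measurable_divide borel_measurable_sum borel_measurable_diff borel_measurable_const
            measurable_compose[OF X.measurable_coordinate h_meas])
  have \<psi>m [measurable]: "\<psi> n \<in> borel_measurable (SX n)" for n
  proof -
    have "(\<lambda>p. iexp (t * (Bn n (fst p) (snd p) / ?r n))) \<in> borel_measurable (J n)" using Bn_meas by measurable
    from integral_J(2)[OF this, of 1] show ?thesis unfolding \<psi>_def[abs_def] by simp
  qed
  have \<psi>1: "norm (\<psi> n x) \<le> 1" for n x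
  proof -
    interpret S: prob_space "SE n" by (rule prob_SE)
    have "norm (\<psi> n x) \<le> (\<integral>e. norm (iexp (t * (Bn n x e / ?r n))) \<partial>SE n)"
      unfolding \<psi>_def by (rule integral_norm_bound)
    also have "\<dots> = 1" using S.prob_space by simp
    finally show ?thesis .
  qed
  have main: "(\<integral>p. iexp (t * (Z n (fst p) (snd p) / ?r n)) \<partial>J n) = (\<integral>x. iexp (t * ?S n x) * iexp (t * ?q n x) * \<psi> n x \<partial>SX n)" for n
  proof -
    have mm: "(\<lambda>p. iexp (t * (Z n (fst p) (snd p) / ?r n))) \<in> borel_measurable (J n)" by measurable
    have "(\<integral>p. iexp (t * (Z n (fst p) (snd p) / ?r n)) \<partial>J n) = (\<integral>x. (\<integral>e. iexp (t * (Z n x e / ?r n)) \<partial>SE n) \<partial>SX n)"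
      using integral_J(1)[OF mm, of 1] by simp
    also have "\<dots> = (\<integral>x. iexp (t * ?S n x) * iexp (t * ?q n x) * \<psi> n x \<partial>SX n)"
    proof (intro Bochner_Integration.integral_cong refl)
      fix x
      have "iexp (t * (Z n x e / ?r n)) = iexp (t * ?S n x) * iexp (t * ?q n x) * iexp (t * (Bn n x e / ?r n))" for e
      proof -
        have "t * ((B + S + q) / r) = t * (S / r) + t * (q / r) + t * (B / r)" for B S q r :: real
          by (simp add: add_divide_distrib algebra_simps)
        then have "t * (Z n x e / ?r n) = t * ?S n x + t * ?q n x + t * (Bn n x e / ?r n)"
          unfolding Z_split sum_h_centred .
        then show ?thesis by (simp only: of_real_add distrib_left exp_add)
      qed
      then show "(\<integral>e. iexp (t * (Z n x e / ?r n)) \<partial>SE n) = iexp (t * ?S n x) * iexp (t * ?q n x) * \<psi> n x"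
        unfolding \<psi>_def by simp
    qed
    finally show ?thesis .
  qed
  have err: "norm ((\<integral>p. iexp (t * (Z n (fst p) (snd p) / ?r n)) \<partial>J n) - e1 * ch n)
      \<le> ?Kt / ?r n + t\<^sup>2 / 2 * (\<integral>x. \<bar>Vn n x - V1\<bar> \<partial>SX n) + \<bar>t\<bar> * \<bar>a / 2\<bar> * ((\<integral>x. \<bar>Q n x - EQ n\<bar> \<partial>SX n) / ?r n)"
    if n: "n \<ge> 3" for n
  proof -
    interpret S: prob_space "SX n" by (rule prob_SX)
    let ?w = "\<lambda>x. ?Kt / ?r n + t\<^sup>2 / 2 * \<bar>Vn n x - V1\<bar> + \<bar>t\<bar> * \<bar>a / 2\<bar> * (\<bar>Q n x - EQ n\<bar> / ?r n)"
    note i1 = Vn_dev_integrable[OF n]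
    have i2: "integrable (SX n) (\<lambda>x. \<bar>Q n x - EQ n\<bar>)"
      using Q_dev_bound by (intro S.integrable_bounded[where B = "real n * (4 * (L * L))"]) auto
    have iw: "integrable (SX n) ?w" using i1 i2 by (intro Bochner_Integration.integrable_add integrable_mult_right integrable_divide) auto
    have ia: "integrable (SX n) (\<lambda>x. iexp (t * ?S n x) * iexp (t * ?q n x) * \<psi> n x)"
      using \<psi>1 by (intro S.integrable_bounded[where B = 1]) (auto simp: norm_mult)
    have ib: "integrable (SX n) (\<lambda>x. e1 * iexp (t * ?S n x))"
      by (intro integrable_mult_right S.integrable_bounded[where B = 1]) auto
    have eq: "(\<integral>p. iexp (t * (Z n (fst p) (snd p) / ?r n)) \<partial>J n) - e1 * ch n
       = (\<integral>x. iexp (t * ?S n x) * iexp (t * ?q n x) * \<psi> n x - e1 * iexp (t * ?S n x) \<partial>SX n)"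
      unfolding main ch_def using ia ib by simp
    have le: "(\<integral>x. norm (iexp (t * ?S n x) * iexp (t * ?q n x) * \<psi> n x - e1 * iexp (t * ?S n x)) \<partial>SX n)
      \<le> (\<integral>x. ?w x \<partial>SX n)"
    proof (intro integral_mono_AE integrable_norm Bochner_Integration.integrable_diff ia ib iw)
      show "AE x in SX n. norm (iexp (t * ?S n x) * iexp (t * ?q n x) * \<psi> n x - e1 * iexp (t * ?S n x)) \<le> ?w x"
        using X.AE_inj_on_sample[OF finite_atLeastAtMost]
      proof eventually_elim
        case (elim x)
        have Vn0: "0 \<le> Vn n x" unfolding Vn_def by (intro divide_nonneg_nonneg integral_nonneg_AE) auto
        have "norm (\<psi> n x - exp (- (t\<^sup>2 * Vn n x / 2))) \<le> ?Kt / ?r n"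
          unfolding \<psi>_def Vn_eq[OF n elim] by (rule char_Bn[OF n elim])
        moreover have "norm (complex_of_real (exp (- (t\<^sup>2 * Vn n x / 2))) - e1) \<le> t\<^sup>2 / 2 * \<bar>Vn n x - V1\<bar>"
        proof -
          have "norm (complex_of_real (exp (- (t\<^sup>2 * Vn n x / 2))) - e1) = \<bar>exp (- (t\<^sup>2 * Vn n x / 2)) - e1\<bar>"
            by (simp only: of_real_diff[symmetric] norm_of_real)
          also have "\<dots> \<le> \<bar>t\<^sup>2 * Vn n x / 2 - t\<^sup>2 * V1 / 2\<bar>"
            unfolding e1_def using Vn0 V1_nonneg by (intro exp_minus_diff_le) auto
          also have "t\<^sup>2 * Vn n x / 2 - t\<^sup>2 * V1 / 2 = t\<^sup>2 / 2 * (Vn n x - V1)" by (simp add: algebra_simps)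
          also have "\<bar>\<dots>\<bar> = t\<^sup>2 / 2 * \<bar>Vn n x - V1\<bar>" by (simp add: abs_mult)
          finally show ?thesis .
        qed
        moreover have "norm (iexp (t * ?q n x) - 1) \<le> \<bar>t\<bar> * \<bar>a / 2\<bar> * (\<bar>Q n x - EQ n\<bar> / ?r n)"
          using norm_iexp_minus_one[of "t * ?q n x"] by (simp add: abs_mult)
        moreover have "norm (iexp (t * ?S n x) * iexp (t * ?q n x) * \<psi> n x - e1 * iexp (t * ?S n x))
          \<le> norm (\<psi> n x - exp (- (t\<^sup>2 * Vn n x / 2))) + norm (complex_of_real (exp (- (t\<^sup>2 * Vn n x / 2))) - e1)
             + norm (iexp (t * ?q n x) - 1)"
        proof -
          have "iexp (t * ?S n x) * iexp (t * ?q n x) * \<psi> n x - e1 * iexp (t * ?S n x)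
            = iexp (t * ?S n x) * ((iexp (t * ?q n x) - 1) * \<psi> n x + (\<psi> n x - e1))"
            by (simp add: algebra_simps)
          also have "norm \<dots> = norm ((iexp (t * ?q n x) - 1) * \<psi> n x + (\<psi> n x - e1))"
            by (simp only: norm_mult norm_exp_i_times mult_1)
          also have "\<dots> \<le> norm (iexp (t * ?q n x) - 1) * norm (\<psi> n x) + norm (\<psi> n x - e1)"
            by (rule order_trans[OF norm_triangle_ineq]) (simp add: norm_mult)
          also have "norm (iexp (t * ?q n x) - 1) * norm (\<psi> n x) \<le> norm (iexp (t * ?q n x) - 1) * 1"
            by (intro mult_left_mono \<psi>1) simp
          also have "norm (\<psi> n x - e1) \<le> norm (\<psi> n x - exp (- (t\<^sup>2 * Vn n x / 2)))
              + norm (complex_of_real (exp (- (t\<^sup>2 * Vn n x / 2))) - e1)"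
            using norm_triangle_ineq[of "\<psi> n x - exp (- (t\<^sup>2 * Vn n x / 2))" "complex_of_real (exp (- (t\<^sup>2 * Vn n x / 2))) - e1"]
            by simp
          finally show ?thesis by simp
        qed
        ultimately show ?case by linarith
      qed
    qed
    have w: "(\<integral>x. ?w x \<partial>SX n) = ?Kt / ?r n + t\<^sup>2 / 2 * (\<integral>x. \<bar>Vn n x - V1\<bar> \<partial>SX n) + \<bar>t\<bar> * \<bar>a / 2\<bar> * ((\<integral>x. \<bar>Q n x - EQ n\<bar> \<partial>SX n) / ?r n)"
    proof -
      have j1: "integrable (SX n) (\<lambda>x. t\<^sup>2 / 2 * \<bar>Vn n x - V1\<bar>)" by (rule integrable_mult_right[OF i1])
      have j2: "integrable (SX n) (\<lambda>x. \<bar>t\<bar> * \<bar>a / 2\<bar> * (\<bar>Q n x - EQ n\<bar> / ?r n))"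
        by (intro integrable_mult_right integrable_divide i2)
      have j0: "integrable (SX n) (\<lambda>x. ?Kt / ?r n)" by simp
      show ?thesis
        unfolding Bochner_Integration.integral_add[OF Bochner_Integration.integrable_add[OF j0 j1] j2]
          Bochner_Integration.integral_add[OF j0 j1]
        using S.prob_space by simp
    qed
    show ?thesis unfolding eq w[symmetric] by (rule order_trans[OF integral_norm_bound le])
  qed
  have rlim: "(\<lambda>n. c / ?r n) \<longlonglongrightarrow> 0" for c :: real
    by (intro tendsto_divide_0[OF tendsto_const] filterlim_at_top_imp_at_infinity
          filterlim_compose[OF sqrt_at_top] filterlim_real_sequentially)
  have "(\<lambda>n. ?Kt / ?r n + t\<^sup>2 / 2 * (\<integral>x. \<bar>Vn n x - V1\<bar> \<partial>SX n) + \<bar>t\<bar> * \<bar>a / 2\<bar> * ((\<integral>x. \<bar>Q n x - EQ n\<bar> \<partial>SX n) / ?r n))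
      \<longlonglongrightarrow> 0 + t\<^sup>2 / 2 * 0 + \<bar>t\<bar> * \<bar>a / 2\<bar> * 0"
    by (intro tendsto_add tendsto_mult tendsto_const rlim Vn_dev_tendsto Q_dev_tendsto)
  then have lim0: "(\<lambda>n. ?Kt / ?r n + t\<^sup>2 / 2 * (\<integral>x. \<bar>Vn n x - V1\<bar> \<partial>SX n) + \<bar>t\<bar> * \<bar>a / 2\<bar> * ((\<integral>x. \<bar>Q n x - EQ n\<bar> \<partial>SX n) / ?r n))
      \<longlonglongrightarrow> 0" by simp
  have A: "(\<lambda>n. (\<integral>p. iexp (t * (Z n (fst p) (snd p) / ?r n)) \<partial>J n) - e1 * ch n) \<longlonglongrightarrow> 0"
    by (rule Lim_null_comparison[OF _ lim0]) (rule eventually_sequentiallyI[of 3], rule err)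
  have B: "(\<lambda>n. ch n - exp (- (t\<^sup>2 * V0 / 2))) \<longlonglongrightarrow> 0"
  proof (rule Lim_null_comparison[OF _ rlim])
    show "\<forall>\<^sub>F n in sequentially. norm (ch n - exp (- (t\<^sup>2 * V0 / 2)))
      \<le> (\<bar>t\<bar> * ((2 * Kh) ^ 3 * t\<^sup>2 + \<bar>t\<bar> * (2 * (2 * Kh)\<^sup>2))) / ?r n"
      unfolding ch_def V0_def
      using h_centred by (intro eventually_sequentiallyI[of 1] X.char_sum) auto
  qed
  define e0 where "e0 = complex_of_real (exp (- (t\<^sup>2 * V0 / 2)))"
  have "(\<lambda>n. ((\<integral>p. iexp (t * (Z n (fst p) (snd p) / ?r n)) \<partial>J n) - e1 * ch n)
      + (complex_of_real e1 * (ch n - e0) + complex_of_real e1 * e0)) \<longlonglongrightarrow> 0 + (complex_of_real e1 * 0 + complex_of_real e1 * e0)"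
    by (intro tendsto_add tendsto_mult tendsto_const A B[folded e0_def])
  moreover have "complex_of_real e1 * e0 = exp (- (t\<^sup>2 * (V0 + V1) / 2))"
    unfolding e1_def e0_def of_real_mult[symmetric] exp_add[symmetric] by (simp add: algebra_simps add_divide_distrib)
  ultimately show ?thesis by (simp add: algebra_simps)
qed

end

section \<open>Weak convergence and linearisation of a ratio\<close>

lemma normal_law_scaled:
  assumes v: "v > 0"
  shows "normal_law 0 v = distr std_normal_distribution borel (\<lambda>x. sqrt v * x)"
proof -
  interpret N: prob_space std_normal_distribution
    using real_dist_normal_dist by (rule real_distribution.axioms)
  have std: "distributed std_normal_distribution lborel (\<lambda>x. x) std_normal_density"
    unfolding distributed_def by (simp add: distr_id2)
  have "distributed std_normal_distribution lborel (\<lambda>x. 0 + sqrt v * x) (normal_density (0 + sqrt v * 0) (\<bar>sqrt v\<bar> * 1))"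
    using v by (intro N.normal_density_affine[OF std]) auto
  then have "distr std_normal_distribution lborel (\<lambda>x. sqrt v * x) = density lborel (normal_density 0 (sqrt v))"
    using v by (simp add: distributed_def)
  moreover have "distr std_normal_distribution lborel (\<lambda>x. sqrt v * x) = distr std_normal_distribution borel (\<lambda>x. sqrt v * x)"
    by (rule distr_cong) auto
  ultimately show ?thesis using v by (simp add: normal_law_def)
qed

lemma real_distribution_normal_law:
  assumes "v \<ge> 0"
  shows "real_distribution (normal_law 0 v)"
proof (cases "v = 0")
  case True
  then show ?thesis
    by (simp add: normal_law_def real_distribution_def real_distribution_axioms_def prob_space_return)
next
  case False
  interpret N: real_distribution std_normal_distribution by (rule real_dist_normal_dist)
  have "prob_space (normal_law 0 v)"
    using False assms by (subst normal_law_scaled) (auto intro!: N.prob_space_distr)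
  then show ?thesis
    using False assms by (simp add: normal_law_scaled real_distribution_def real_distribution_axioms_def)
qed

lemma char_normal_law:
  assumes "v \<ge> 0"
  shows "char (normal_law 0 v) t = exp (- (t\<^sup>2 * v / 2))"
proof (cases "v = 0")
  case True
  then show ?thesis by (simp add: normal_law_def char_def integral_return)
next
  case False
  then have v: "v > 0" using assms by simp
  have "char (normal_law 0 v) t = (\<integral>x. iexp (t * (sqrt v * x)) \<partial>std_normal_distribution)"
    unfolding char_def normal_law_scaled[OF v] by (subst integral_distr) auto
  also have "\<dots> = char std_normal_distribution (t * sqrt v)"
    unfolding char_def by (simp add: mult.assoc)
  also have "\<dots> = exp (- (t\<^sup>2 * v / 2))"
    using v by (simp add: char_std_normal_distribution power_mult_distrib)
  finally show ?thesis .
qed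

lemma (in prob_space) weak_conv_normal_lawI:
  fixes W :: "nat \<Rightarrow> 'a \<Rightarrow> real"
  assumes W [measurable]: "\<And>n. W n \<in> borel_measurable M" and v: "v \<ge> 0"
    and conv: "\<And>t. (\<lambda>n. \<integral>\<omega>. iexp (t * W n \<omega>) \<partial>M) \<longlonglongrightarrow> exp (- (t\<^sup>2 * v / 2))"
  shows "weak_conv_m (\<lambda>n. distr M borel (W n)) (normal_law 0 v)"
proof (rule levy_continuity)
  show "real_distribution (distr M borel (W n))" for n
    by (intro real_distribution_distr) simp
  show "real_distribution (normal_law 0 v)" using v by (rule real_distribution_normal_law)
  show "(\<lambda>n. char (distr M borel (W n)) t) \<longlonglongrightarrow> char (normal_law 0 v) t" for t
    unfolding char_normal_law[OF v] using conv[of t] by (simp add: char_def integral_distr)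
qed

lemma norm_iexp_diff_le: "norm (iexp x - iexp y) \<le> \<bar>x - y\<bar>"
proof -
  have "iexp x - iexp y = iexp y * (iexp (x - y) - 1)"
    by (simp add: algebra_simps exp_add[symmetric])
  then show ?thesis using norm_iexp_minus_one[of "x - y"] by (simp only: norm_mult norm_exp_i_times mult_1)
qed

lemma ratio_linearization:
  fixes p q \<mu> d V \<rho> y s u W den :: real
  assumes V: "V = q - \<mu>\<^sup>2" "V > 0" and \<rho>: "\<rho> = (p - \<mu>\<^sup>2) / V"
    and W: "W = (u + 2 * \<mu> * (\<rho> - 1) * y - \<rho> * s) / V"
    and den: "den = (q + s) - (\<mu> + y)\<^sup>2" "den \<noteq> 0"
  shows "((p - d / 2 + u) - (\<mu> + y)\<^sup>2) / den - (\<rho> - d / (2 * V)) - W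
    = ((V - den) * W - (1 - \<rho>) * y\<^sup>2 - d / (2 * V) * (2 * \<mu> * y + y\<^sup>2 - s)) / den"
proof -
  have p: "p = \<rho> * V + \<mu>\<^sup>2" using \<rho> V(2) by simp
  have u: "u = V * W - 2 * \<mu> * (\<rho> - 1) * y + \<rho> * s" using W V(2) by (simp add: field_simps)
  define e where "e = d / (2 * V)"
  have d: "d = 2 * V * e" using V(2) by (simp add: e_def)
  have q: "q = V + \<mu>\<^sup>2" using V(1) by simp
  have eq: "(p - d / 2 + u) - (\<mu> + y)\<^sup>2 - (\<rho> - e) * den - W * den
     = (V - den) * W - (1 - \<rho>) * y\<^sup>2 - e * (2 * \<mu> * y + y\<^sup>2 - s)"
    unfolding den(1) p u d q by (simp add: power2_eq_square algebra_simps)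
  have "A / den - (\<rho> - e) - W = (A - (\<rho> - e) * den - W * den) / den" for A
    using den(2) by (simp add: diff_divide_distrib)
  then show ?thesis unfolding e_def[symmetric] eq[symmetric] .
qed

lemma ratio_linearization_bound:
  fixes p q \<mu> V \<rho> B :: real
  assumes V: "V = q - \<mu>\<^sup>2" "V > 0" and \<rho>: "\<rho> = (p - \<mu>\<^sup>2) / V" and B: "0 \<le> B"
  obtains c where "0 \<le> c"
    "\<And>d y s u W den. 0 \<le> d \<Longrightarrow> \<bar>y\<bar> \<le> B \<Longrightarrow> W = (u + 2 * \<mu> * (\<rho> - 1) * y - \<rho> * s) / V \<Longrightarrow>
      den = (q + s) - (\<mu> + y)\<^sup>2 \<Longrightarrow> V / 2 < den \<Longrightarrow>
      \<bar>((p - d / 2 + u) - (\<mu> + y)\<^sup>2) / den - (\<rho> - d / (2 * V)) - W\<bar>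
        \<le> c * (u\<^sup>2 + y\<^sup>2 + s\<^sup>2) + c * d * (\<bar>y\<bar> + \<bar>s\<bar>)"
    "\<And>y s den. \<bar>y\<bar> \<le> B \<Longrightarrow> den = (q + s) - (\<mu> + y)\<^sup>2 \<Longrightarrow> \<not> V / 2 < den \<Longrightarrow>
      1 \<le> c * (y\<^sup>2 + s\<^sup>2)"
proof -
  define k where "k = 1 + B + 2 * \<bar>\<mu>\<bar>"
  define l where "l = (1 + \<bar>2 * \<mu> * (\<rho> - 1)\<bar> + \<bar>\<rho>\<bar>) / V"
  define c1 where "c1 = 2 / V * (3 * (k * l) + \<bar>1 - \<rho>\<bar>)"
  define c2 where "c2 = 2 / V * (1 / (2 * V)) * k"
  define c3 where "c3 = 8 * k\<^sup>2 / V\<^sup>2"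
  define c where "c = c1 + c2 + c3"
  have k: "1 \<le> k" "0 \<le> k" using B by (auto simp: k_def)
  have l: "0 \<le> l" using V(2) by (simp add: l_def)
  have c123: "0 \<le> c1" "0 \<le> c2" "0 \<le> c3" using k l V(2) by (simp_all add: c1_def c2_def c3_def)
  have quad: "\<bar>2 * \<mu> * y + y\<^sup>2 - s\<bar> \<le> k * (\<bar>y\<bar> + \<bar>s\<bar>)" if "\<bar>y\<bar> \<le> B" for y s
  proof -
    have "\<bar>2 * \<mu> * y\<bar> = 2 * \<bar>\<mu>\<bar> * \<bar>y\<bar>" by (simp add: abs_mult)
    moreover have "\<bar>y\<^sup>2\<bar> \<le> B * \<bar>y\<bar>"
      using mult_right_mono[OF that, of "\<bar>y\<bar>"] by (simp add: power2_eq_square)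
    moreover have "\<bar>s\<bar> \<le> k * \<bar>s\<bar>" using k mult_right_mono[of 1 k "\<bar>s\<bar>"] by simp
    moreover have "k * \<bar>y\<bar> = \<bar>y\<bar> + B * \<bar>y\<bar> + 2 * \<bar>\<mu>\<bar> * \<bar>y\<bar>" by (simp add: k_def algebra_simps)
    ultimately show ?thesis unfolding distrib_left by linarith
  qed
  have denV: "V - den = 2 * \<mu> * y + y\<^sup>2 - s" if "den = (q + s) - (\<mu> + y)\<^sup>2" for y s den
    using that V(1) by (simp add: power2_eq_square algebra_simps)
  have 1: "\<bar>((p - d / 2 + u) - (\<mu> + y)\<^sup>2) / den - (\<rho> - d / (2 * V)) - W\<bar>
        \<le> c * (u\<^sup>2 + y\<^sup>2 + s\<^sup>2) + c * d * (\<bar>y\<bar> + \<bar>s\<bar>)"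
    if d: "0 \<le> d" and y: "\<bar>y\<bar> \<le> B" and W: "W = (u + 2 * \<mu> * (\<rho> - 1) * y - \<rho> * s) / V"
      and den: "den = (q + s) - (\<mu> + y)\<^sup>2" "V / 2 < den" for d y s u W den
  proof -
    let ?m = "2 * \<mu> * y + y\<^sup>2 - s" and ?r = "\<bar>u\<bar> + \<bar>y\<bar> + \<bar>s\<bar>" and ?e = "d / (2 * V)"
    have pos: "0 < den" using den(2) V(2) by linarith
    have m: "\<bar>?m\<bar> \<le> k * (\<bar>y\<bar> + \<bar>s\<bar>)" by (rule quad[OF y])
    have m': "\<bar>?m\<bar> \<le> k * ?r" 
      by (rule order_trans[OF m mult_left_mono]) (use k in auto)
    have W': "\<bar>W\<bar> \<le> l * ?r"
    proof -
      have "\<bar>u + 2 * \<mu> * (\<rho> - 1) * y - \<rho> * s\<bar> \<le> \<bar>u\<bar> + \<bar>2 * \<mu> * (\<rho> - 1)\<bar> * \<bar>y\<bar> + \<bar>\<rho>\<bar> * \<bar>s\<bar>"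
        using abs_mult[of "2 * \<mu> * (\<rho> - 1)" y] abs_mult[of \<rho> s] by linarith
      also have "\<dots> \<le> 1 * ?r + \<bar>2 * \<mu> * (\<rho> - 1)\<bar> * ?r + \<bar>\<rho>\<bar> * ?r"
        by (intro add_mono mult_left_mono) auto
      also have "\<dots> = (1 + \<bar>2 * \<mu> * (\<rho> - 1)\<bar> + \<bar>\<rho>\<bar>) * ?r" by (simp add: distrib_right)
      finally show ?thesis unfolding W l_def using V(2) by (simp add: abs_divide divide_right_mono)
    qed
    have r2: "?r * ?r \<le> 3 * (u\<^sup>2 + y\<^sup>2 + s\<^sup>2)"
      using sum_squares_bound3[of "\<bar>u\<bar>" "\<bar>y\<bar>" "\<bar>s\<bar>"] by (simp add: power2_eq_square)
    have a1: "\<bar>?m * W\<bar> \<le> (k * l) * (3 * (u\<^sup>2 + y\<^sup>2 + s\<^sup>2))"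
    proof -
      have "\<bar>?m * W\<bar> \<le> (k * ?r) * (l * ?r)" unfolding abs_mult using m' W' k by (intro mult_mono) auto
      also have "\<dots> = (k * l) * (?r * ?r)" by simp
      also have "\<dots> \<le> (k * l) * (3 * (u\<^sup>2 + y\<^sup>2 + s\<^sup>2))" using k l by (intro mult_left_mono r2) auto
      finally show ?thesis .
    qed
    have a2: "\<bar>(1 - \<rho>) * y\<^sup>2\<bar> \<le> \<bar>1 - \<rho>\<bar> * (u\<^sup>2 + y\<^sup>2 + s\<^sup>2)"
      unfolding abs_mult by (intro mult_left_mono) auto
    have a3: "\<bar>?e * ?m\<bar> \<le> ?e * (k * (\<bar>y\<bar> + \<bar>s\<bar>))"
      unfolding abs_mult using m d V(2) by (intro mult_mono) auto
    have "\<bar>((p - d / 2 + u) - (\<mu> + y)\<^sup>2) / den - (\<rho> - ?e) - W\<bar> = \<bar>?m * W - (1 - \<rho>) * y\<^sup>2 - ?e * ?m\<bar> / den"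
      using ratio_linearization[OF V \<rho> W den(1)] pos unfolding denV[OF den(1)] by simp
    also have "\<dots> \<le> ((k * l) * (3 * (u\<^sup>2 + y\<^sup>2 + s\<^sup>2)) + \<bar>1 - \<rho>\<bar> * (u\<^sup>2 + y\<^sup>2 + s\<^sup>2) + ?e * (k * (\<bar>y\<bar> + \<bar>s\<bar>))) / (V / 2)"
    proof (rule frac_le)
      have tri: "\<bar>x - y - z\<bar> \<le> x' + y' + z'" if "\<bar>x\<bar> \<le> x'" "\<bar>y\<bar> \<le> y'" "\<bar>z\<bar> \<le> z'" for x y z x' y' z' :: real
        using that by linarith
      show "\<bar>?m * W - (1 - \<rho>) * y\<^sup>2 - ?e * ?m\<bar>
        \<le> (k * l) * (3 * (u\<^sup>2 + y\<^sup>2 + s\<^sup>2)) + \<bar>1 - \<rho>\<bar> * (u\<^sup>2 + y\<^sup>2 + s\<^sup>2) + ?e * (k * (\<bar>y\<bar> + \<bar>s\<bar>))"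
        by (rule tri[OF a1 a2 a3])
    qed (use den(2) V(2) k l d in \<open>auto intro!: add_nonneg_nonneg mult_nonneg_nonneg\<close>)
    also have "\<dots> = c1 * (u\<^sup>2 + y\<^sup>2 + s\<^sup>2) + c2 * d * (\<bar>y\<bar> + \<bar>s\<bar>)"
      using V(2) by (simp add: c1_def c2_def field_simps)
    also have "\<dots> \<le> c * (u\<^sup>2 + y\<^sup>2 + s\<^sup>2) + c * d * (\<bar>y\<bar> + \<bar>s\<bar>)"
      using c123 d by (intro add_mono mult_right_mono) (auto simp: c_def)
    finally show ?thesis .
  qed
  have 2: "1 \<le> c * (y\<^sup>2 + s\<^sup>2)"
    if y: "\<bar>y\<bar> \<le> B" and den: "den = (q + s) - (\<mu> + y)\<^sup>2" "\<not> V / 2 < den" for y s den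
  proof -
    have "V / 2 \<le> V - den" using den(2) by linarith
    also have "\<dots> \<le> \<bar>2 * \<mu> * y + y\<^sup>2 - s\<bar>" unfolding denV[OF den(1)] by simp
    also have "\<dots> \<le> k * (\<bar>y\<bar> + \<bar>s\<bar>)" by (rule quad[OF y])
    finally have "(V / 2)\<^sup>2 \<le> (k * (\<bar>y\<bar> + \<bar>s\<bar>))\<^sup>2" using V(2) by (intro power_mono) auto
    also have "\<dots> = k\<^sup>2 * (\<bar>y\<bar> + \<bar>s\<bar>)\<^sup>2" by (simp add: power_mult_distrib)
    also have "\<dots> \<le> k\<^sup>2 * (2 * (y\<^sup>2 + s\<^sup>2))"
    proof (rule mult_left_mono)
      have "0 \<le> (\<bar>y\<bar> - \<bar>s\<bar>)\<^sup>2" by simp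
      then show "(\<bar>y\<bar> + \<bar>s\<bar>)\<^sup>2 \<le> 2 * (y\<^sup>2 + s\<^sup>2)" by (simp add: power2_eq_square algebra_simps)
    qed simp
    finally have "1 \<le> c3 * (y\<^sup>2 + s\<^sup>2)" using V(2) by (simp add: c3_def power_divide field_simps)
    also have "\<dots> \<le> c * (y\<^sup>2 + s\<^sup>2)" using c123 by (intro mult_right_mono) (auto simp: c_def)
    finally show ?thesis .
  qed
  show ?thesis using that[of c] 1 2 c123 by (simp add: c_def)
qed

lemma (in prob_space) char_ratio_linearization:
  fixes Pn Yn Sn :: "nat \<Rightarrow> 'a \<Rightarrow> real" and d :: "nat \<Rightarrow> real"
  assumes meas [measurable]: "\<And>n. Pn n \<in> borel_measurable M" "\<And>n. Yn n \<in> borel_measurable M" "\<And>n. Sn n \<in> borel_measurable M"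
    and bounds: "\<And>n \<omega>. \<bar>Pn n \<omega>\<bar> \<le> B" "\<And>n \<omega>. \<bar>Yn n \<omega>\<bar> \<le> B" "\<And>n \<omega>. \<bar>Sn n \<omega>\<bar> \<le> B"
    and V: "V = q - \<mu>\<^sup>2" "V > 0" and \<rho>: "\<rho> = (p - \<mu>\<^sup>2) / V"
    and d: "\<And>n. 0 \<le> d n" "d \<longlonglongrightarrow> 0"
    and mom: "\<And>n. n \<ge> N \<Longrightarrow> expectation (\<lambda>\<omega>. (Pn n \<omega> - (p - d n / 2))\<^sup>2) \<le> K / real n"
      "\<And>n. n \<ge> N \<Longrightarrow> expectation (\<lambda>\<omega>. (Yn n \<omega> - \<mu>)\<^sup>2) \<le> K / real n"
      "\<And>n. n \<ge> N \<Longrightarrow> expectation (\<lambda>\<omega>. (Sn n \<omega> - q)\<^sup>2) \<le> K / real n"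
    and \<rho>hat: "\<And>n \<omega>. \<rho>hat n \<omega> = (Pn n \<omega> - (Yn n \<omega>)\<^sup>2) / (Sn n \<omega> - (Yn n \<omega>)\<^sup>2)"
    and W: "\<And>n \<omega>. W n \<omega> = ((Pn n \<omega> - (p - d n / 2)) + 2 * \<mu> * (\<rho> - 1) * (Yn n \<omega> - \<mu>) - \<rho> * (Sn n \<omega> - q)) / V"
  shows "(\<lambda>n. (\<integral>\<omega>. iexp (t * (sqrt (real n) * (\<rho>hat n \<omega> - (\<rho> - d n / (2 * V))))) \<partial>M)
      - (\<integral>\<omega>. iexp (t * (sqrt (real n) * W n \<omega>)) \<partial>M)) \<longlonglongrightarrow> 0"
proof -
  have B0: "0 \<le> B" using bounds(1)[of 0 undefined] by linarith
  define B' where "B' = B + \<bar>\<mu>\<bar>"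
  have B': "0 \<le> B'" using B0 by (simp add: B'_def)
  obtain c where c: "0 \<le> c"
    and good: "\<And>d y s u W den. 0 \<le> d \<Longrightarrow> \<bar>y\<bar> \<le> B' \<Longrightarrow> W = (u + 2 * \<mu> * (\<rho> - 1) * y - \<rho> * s) / V \<Longrightarrow>
      den = (q + s) - (\<mu> + y)\<^sup>2 \<Longrightarrow> V / 2 < den \<Longrightarrow>
      \<bar>((p - d / 2 + u) - (\<mu> + y)\<^sup>2) / den - (\<rho> - d / (2 * V)) - W\<bar>
        \<le> c * (u\<^sup>2 + y\<^sup>2 + s\<^sup>2) + c * d * (\<bar>y\<bar> + \<bar>s\<bar>)"
    and bad: "\<And>y s den. \<bar>y\<bar> \<le> B' \<Longrightarrow> den = (q + s) - (\<mu> + y)\<^sup>2 \<Longrightarrow> \<not> V / 2 < den \<Longrightarrow> 1 \<le> c * (y\<^sup>2 + s\<^sup>2)"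
    using ratio_linearization_bound[OF V \<rho> B'] by blast
  let ?r = "\<lambda>n. sqrt (real n)"
  define u where "u n \<omega> = Pn n \<omega> - (p - d n / 2)" for n \<omega>
  define y where "y n \<omega> = Yn n \<omega> - \<mu>" for n \<omega>
  define s where "s n \<omega> = Sn n \<omega> - q" for n \<omega>
  define R where "R n \<omega> = ?r n * (\<rho>hat n \<omega> - (\<rho> - d n / (2 * V)))" for n \<omega>
  have mu [measurable]: "u n \<in> borel_measurable M" "y n \<in> borel_measurable M" "s n \<in> borel_measurable M" for n
    unfolding u_def y_def s_def by measurable
  have mR [measurable]: "R n \<in> borel_measurable M" "W n \<in> borel_measurable M" for n
    unfolding R_def \<rho>hat W by measurable
  have ub: "\<bar>u n \<omega>\<bar> \<le> B + \<bar>p - d n / 2\<bar>" and yb: "\<bar>y n \<omega>\<bar> \<le> B'" and sb: "\<bar>s n \<omega>\<bar> \<le> B + \<bar>q\<bar>" for n \<omega>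
    unfolding u_def y_def s_def B'_def using bounds[of n \<omega>] by linarith+
  have iu: "integrable M (\<lambda>\<omega>. (u n \<omega>)\<^sup>2)" for n
    by (intro integrable_bounded[OF _ norm_square_le[OF ub]]) simp
  have iy: "integrable M (\<lambda>\<omega>. (y n \<omega>)\<^sup>2)" for n
    by (intro integrable_bounded[OF _ norm_square_le[OF yb]]) simp
  have iss: "integrable M (\<lambda>\<omega>. (s n \<omega>)\<^sup>2)" for n
    by (intro integrable_bounded[OF _ norm_square_le[OF sb]]) simp
  have ay: "integrable M (\<lambda>\<omega>. \<bar>y n \<omega>\<bar>)" for n using yb by (intro integrable_bounded[where B = B']) auto
  have as: "integrable M (\<lambda>\<omega>. \<bar>s n \<omega>\<bar>)" for n using sb by (intro integrable_bounded[where B = "B + \<bar>q\<bar>"]) auto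
  define F where "F n \<omega> = \<bar>t\<bar> * (?r n * (c * ((u n \<omega>)\<^sup>2 + (y n \<omega>)\<^sup>2 + (s n \<omega>)\<^sup>2) + c * d n * (\<bar>y n \<omega>\<bar> + \<bar>s n \<omega>\<bar>)))
      + 2 * (c * ((y n \<omega>)\<^sup>2 + (s n \<omega>)\<^sup>2))" for n \<omega>
  have F1: "norm (iexp (t * R n \<omega>) - iexp (t * (?r n * W n \<omega>))) \<le> F n \<omega>" for n \<omega>
  proof -
    define den where "den = (q + s n \<omega>) - (\<mu> + y n \<omega>)\<^sup>2"
    have F0: "0 \<le> \<bar>t\<bar> * (?r n * (c * ((u n \<omega>)\<^sup>2 + (y n \<omega>)\<^sup>2 + (s n \<omega>)\<^sup>2) + c * d n * (\<bar>y n \<omega>\<bar> + \<bar>s n \<omega>\<bar>)))"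
      using c d(1) by (intro mult_nonneg_nonneg add_nonneg_nonneg) auto
    have F00: "0 \<le> 2 * (c * ((y n \<omega>)\<^sup>2 + (s n \<omega>)\<^sup>2))" using c by simp
    show ?thesis
    proof (cases "V / 2 < den")
      case True
      have "norm (iexp (t * R n \<omega>) - iexp (t * (?r n * W n \<omega>))) \<le> \<bar>t * R n \<omega> - t * (?r n * W n \<omega>)\<bar>"
        by (rule norm_iexp_diff_le)
      also have "t * R n \<omega> - t * (?r n * W n \<omega>) = t * (?r n * (\<rho>hat n \<omega> - (\<rho> - d n / (2 * V)) - W n \<omega>))"
        by (simp add: R_def algebra_simps)
      also have "\<bar>\<dots>\<bar> = \<bar>t\<bar> * (?r n * \<bar>\<rho>hat n \<omega> - (\<rho> - d n / (2 * V)) - W n \<omega>\<bar>)" by (simp add: abs_mult)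
      also have "\<rho>hat n \<omega> = ((p - d n / 2 + u n \<omega>) - (\<mu> + y n \<omega>)\<^sup>2) / den"
        unfolding \<rho>hat den_def u_def y_def s_def by simp
      also have "\<bar>t\<bar> * (?r n * \<bar>((p - d n / 2 + u n \<omega>) - (\<mu> + y n \<omega>)\<^sup>2) / den - (\<rho> - d n / (2 * V)) - W n \<omega>\<bar>)
        \<le> \<bar>t\<bar> * (?r n * (c * ((u n \<omega>)\<^sup>2 + (y n \<omega>)\<^sup>2 + (s n \<omega>)\<^sup>2) + c * d n * (\<bar>y n \<omega>\<bar> + \<bar>s n \<omega>\<bar>)))"
        by (intro mult_left_mono good d yb True den_def) (auto simp: W u_def y_def s_def)
      finally show ?thesis unfolding F_def using F00 by linarith
    next
      case False
      have "norm (iexp (t * R n \<omega>) - iexp (t * (?r n * W n \<omega>))) \<le> norm (iexp (t * R n \<omega>)) + norm (iexp (t * (?r n * W n \<omega>)))"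
        by (rule norm_triangle_ineq4)
      also have "\<dots> = 2" by (simp only: norm_exp_i_times)
      also have "\<dots> \<le> 2 * (c * ((y n \<omega>)\<^sup>2 + (s n \<omega>)\<^sup>2))" using bad[OF yb den_def False] by simp
      finally show ?thesis unfolding F_def using F0 by linarith
    qed
  qed
  have EF: "expectation (F n) = \<bar>t\<bar> * (?r n * (c * (expectation (\<lambda>\<omega>. (u n \<omega>)\<^sup>2) + expectation (\<lambda>\<omega>. (y n \<omega>)\<^sup>2) + expectation (\<lambda>\<omega>. (s n \<omega>)\<^sup>2))
      + c * d n * (expectation (\<lambda>\<omega>. \<bar>y n \<omega>\<bar>) + expectation (\<lambda>\<omega>. \<bar>s n \<omega>\<bar>)))) + 2 * (c * (expectation (\<lambda>\<omega>. (y n \<omega>)\<^sup>2) + expectation (\<lambda>\<omega>. (s n \<omega>)\<^sup>2)))" for n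
    unfolding F_def using iu iy iss ay as by simp
  have iF: "integrable M (F n)" for n
    unfolding F_def using iu iy iss ay as by simp
  have EFle: "expectation (F n) \<le> (3 * \<bar>t\<bar> * c * K) * (1 / ?r n) + 2 * \<bar>t\<bar> * c * sqrt K * d n + 4 * c * K * (1 / real n)"
    if n: "n \<ge> max N 1" for n
  proof -
    have nN: "n \<ge> N" "real n > 0" using n by auto
    note mom' = mom(1)[OF nN(1), folded u_def] mom(2)[OF nN(1), folded y_def] mom(3)[OF nN(1), folded s_def]
    have ey: "expectation (\<lambda>\<omega>. \<bar>y n \<omega>\<bar>) \<le> sqrt K / ?r n"
      using mom'(2)
      by (intro order_trans[OF integral_abs_le_sqrt[of "y n" B', OF _ yb]]) (simp_all add: real_sqrt_divide[symmetric])
    have es: "expectation (\<lambda>\<omega>. \<bar>s n \<omega>\<bar>) \<le> sqrt K / ?r n"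
      using mom'(3)
      by (intro order_trans[OF integral_abs_le_sqrt[of "s n" "B + \<bar>q\<bar>", OF _ sb]]) (simp_all add: real_sqrt_divide[symmetric])
    have "expectation (F n) \<le> \<bar>t\<bar> * (?r n * (c * (K / real n + K / real n + K / real n)
      + c * d n * (sqrt K / ?r n + sqrt K / ?r n))) + 2 * (c * (K / real n + K / real n))"
      unfolding EF using c d(1)
      by (intro add_mono mult_left_mono mom' ey es) (auto intro!: mult_nonneg_nonneg)
    also have "\<dots> = (3 * \<bar>t\<bar> * c * K) * (1 / ?r n) + 2 * \<bar>t\<bar> * c * sqrt K * d n + 4 * c * K * (1 / real n)"
    proof -
      have r: "?r n \<noteq> 0" "real n = ?r n * ?r n" using nN by auto
      have "\<bar>t\<bar> * (?r n * (c * (K / real n + K / real n + K / real n)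
        + c * d n * (sqrt K / ?r n + sqrt K / ?r n))) = (3 * \<bar>t\<bar> * c * K) * (?r n / real n) + 2 * \<bar>t\<bar> * c * sqrt K * d n"
        using r(1) by (simp add: field_simps del: real_sqrt_eq_zero_cancel_iff)
      moreover have "?r n / real n = 1 / ?r n" using r by (metis divide_divide_eq_left divide_self)
      ultimately show ?thesis by simp
    qed
    finally show ?thesis .
  qed
  have rlim: "(\<lambda>n. 1 / ?r n) \<longlonglongrightarrow> 0" "(\<lambda>n. 1 / real n) \<longlonglongrightarrow> 0"
    by (intro tendsto_divide_0[OF tendsto_const] filterlim_at_top_imp_at_infinity
          filterlim_compose[OF sqrt_at_top] filterlim_real_sequentially)+
  have "(\<lambda>n. (3 * \<bar>t\<bar> * c * K) * (1 / ?r n) + 2 * \<bar>t\<bar> * c * sqrt K * d n + 4 * c * K * (1 / real n))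
      \<longlonglongrightarrow> (3 * \<bar>t\<bar> * c * K) * 0 + 2 * \<bar>t\<bar> * c * sqrt K * 0 + 4 * c * K * 0"
    by (intro tendsto_add tendsto_mult tendsto_const rlim d)
  then have lim0: "(\<lambda>n. (3 * \<bar>t\<bar> * c * K) * (1 / ?r n) + 2 * \<bar>t\<bar> * c * sqrt K * d n + 4 * c * K * (1 / real n)) \<longlonglongrightarrow> 0"
    by simp
  show ?thesis
  proof (rule Lim_null_comparison[OF _ lim0], rule eventually_sequentiallyI[of "max N 1"])
    fix n assume n: "max N 1 \<le> n"
    have i1: "integrable M (\<lambda>\<omega>. iexp (t * R n \<omega>))" and i2: "integrable M (\<lambda>\<omega>. iexp (t * (?r n * W n \<omega>)))"
      by (intro integrable_bounded[where B = 1]; simp)+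
    have eq: "(\<integral>\<omega>. iexp (t * (?r n * (\<rho>hat n \<omega> - (\<rho> - d n / (2 * V))))) \<partial>M) - (\<integral>\<omega>. iexp (t * (?r n * W n \<omega>)) \<partial>M)
        = (\<integral>\<omega>. iexp (t * R n \<omega>) - iexp (t * (?r n * W n \<omega>)) \<partial>M)"
      unfolding R_def[symmetric] using Bochner_Integration.integral_diff[OF i1 i2] by simp
    have le: "(\<integral>\<omega>. norm (iexp (t * R n \<omega>) - iexp (t * (?r n * W n \<omega>))) \<partial>M) \<le> expectation (F n)"
      by (intro integral_mono integrable_norm Bochner_Integration.integrable_diff i1 i2 iF F1)
    show "norm ((\<integral>\<omega>. iexp (t * (?r n * (\<rho>hat n \<omega> - (\<rho> - d n / (2 * V))))) \<partial>M) - (\<integral>\<omega>. iexp (t * (?r n * W n \<omega>)) \<partial>M))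
      \<le> (3 * \<bar>t\<bar> * c * K) * (1 / ?r n) + 2 * \<bar>t\<bar> * c * sqrt K * d n + 4 * c * K * (1 / real n)"
      unfolding eq by (rule order_trans[OF integral_norm_bound order_trans[OF le EFle[OF n]]])
  qed
qed

section \<open>Transfer to the sample\<close>

locale rank_setup = prob_space M for M :: "'a measure" +
  fixes X eps :: "'a \<Rightarrow> real" and Xs es :: "nat \<Rightarrow> 'a \<Rightarrow> real" and f :: "real \<times> real \<Rightarrow> real" and C :: real
  assumes f_meas [measurable]: "f \<in> borel_measurable (borel \<Otimes>\<^sub>M borel)"
    and indep_X_eps: "indep_var borel X borel eps"
    and indep_Xs: "indep_vars (\<lambda>_. borel) Xs {1..}"
    and distr_Xs: "\<And>i. i \<ge> 1 \<Longrightarrow> distr M borel (Xs i) = distr M borel X"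
    and indep_es: "indep_vars (\<lambda>_. borel) es {1..}"
    and distr_es: "\<And>i. i \<ge> 1 \<Longrightarrow> distr M borel (es i) = distr M borel eps"
    and indep_Xs_es: "indep_var
          (\<Pi>\<^sub>M i\<in>{1..}. borel) (\<lambda>\<omega>. \<lambda>i\<in>{1..}. Xs i \<omega>)
          (\<Pi>\<^sub>M i\<in>{1..}. borel) (\<lambda>\<omega>. \<lambda>i\<in>{1..}. es i \<omega>)"
    and f_bound: "\<And>z. \<bar>f z\<bar> \<le> C" and C: "1 \<le> C"
    and no_atoms: "\<And>x. measure M {\<omega> \<in> space M. X \<omega> = x} = 0"
begin

abbreviation P :: "real measure" where "P \<equiv> distr M borel X"
abbreviation R :: "real measure" where "R \<equiv> distr M borel eps"

lemma X_meas [measurable]: "X \<in> borel_measurable M" and eps_meas [measurable]: "eps \<in> borel_measurable M"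
  using indep_X_eps by (auto dest: indep_var_rv1 indep_var_rv2)

lemma model: "rank_model P R f C"
proof -
  have "measure P {x} = 0" for x
    using no_atoms[of x] by (simp add: measure_distr vimage_def Int_def conj_commute)
  moreover have "real_distribution P" "real_distribution R" by (auto intro: real_distribution_distr)
  ultimately show ?thesis
    using f_meas f_bound C
    by (simp add: rank_model_def rank_model_axioms_def atomless_distribution_def atomless_distribution_axioms_def)
qed

lemma Xs_meas: "i \<ge> 1 \<Longrightarrow> Xs i \<in> borel_measurable M" and es_meas: "i \<ge> 1 \<Longrightarrow> es i \<in> borel_measurable M"
  using indep_Xs indep_es by (auto simp: indep_vars_def)

abbreviation x :: "'a \<Rightarrow> nat \<Rightarrow> real" where "x \<omega> \<equiv> \<lambda>i. Xs i \<omega>"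
abbreviation e :: "'a \<Rightarrow> nat \<Rightarrow> real" where "e \<omega> \<equiv> \<lambda>i. es i \<omega>"
abbreviation SP :: "nat \<Rightarrow> (nat \<Rightarrow> real) measure" where "SP n \<equiv> Pi\<^sub>M {1..n} (\<lambda>_. P)"
abbreviation SR :: "nat \<Rightarrow> (nat \<Rightarrow> real) measure" where "SR n \<equiv> Pi\<^sub>M {1..n} (\<lambda>_. R)"

lemma sample_law:
  assumes n: "n \<ge> 1"
  shows "(\<lambda>\<omega>. restrict (x \<omega>) {1..n}) \<in> measurable M (SP n)"
    and "distr M (SP n) (\<lambda>\<omega>. restrict (x \<omega>) {1..n}) = SP n"
    and "(\<lambda>\<omega>. (restrict (x \<omega>) {1..n}, restrict (e \<omega>) {1..n})) \<in> measurable M (SP n \<Otimes>\<^sub>M SR n)"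
    and "distr M (SP n \<Otimes>\<^sub>M SR n) (\<lambda>\<omega>. (restrict (x \<omega>) {1..n}, restrict (e \<omega>) {1..n})) = SP n \<Otimes>\<^sub>M SR n"
proof -
  let ?B = "Pi\<^sub>M {1..n} (\<lambda>_. borel :: real measure)"
  let ?x = "\<lambda>\<omega>. restrict (x \<omega>) {1..n}" and ?e = "\<lambda>\<omega>. restrict (e \<omega>) {1..n}"
  have ne: "{1..n} \<noteq> {}" using n by auto
  have sets: "sets (SP n) = sets ?B" "sets (SR n) = sets ?B" by (intro sets_PiM_cong; simp)+
  have "distr M ?B ?x = Pi\<^sub>M {1..n} (\<lambda>i. distr M borel (Xs i))"
  proof (rule iffD1[OF indep_vars_iff_distr_eq_PiM'[OF ne]])
    show "indep_vars (\<lambda>_. borel) Xs {1..n}" by (rule indep_vars_subset[OF indep_Xs]) auto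
  qed (use Xs_meas in auto)
  also have "\<dots> = SP n" by (intro PiM_cong distr_Xs) auto
  finally have lx: "distr M ?B ?x = SP n" .
  have "distr M ?B ?e = Pi\<^sub>M {1..n} (\<lambda>i. distr M borel (es i))"
  proof (rule iffD1[OF indep_vars_iff_distr_eq_PiM'[OF ne]])
    show "indep_vars (\<lambda>_. borel) es {1..n}" by (rule indep_vars_subset[OF indep_es]) auto
  qed (use es_meas in auto)
  also have "\<dots> = SR n" by (intro PiM_cong distr_es) auto
  finally have le: "distr M ?B ?e = SR n" .
  have mr: "(\<lambda>y. restrict y {1..n}) \<in> measurable (\<Pi>\<^sub>M i\<in>{1..}. borel :: real measure) ?B"
    by (rule measurable_restrict_subset) auto
  have cx: "(\<lambda>y. restrict y {1..n}) \<circ> (\<lambda>\<omega>. \<lambda>i\<in>{1..}. Xs i \<omega>) = ?x"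
    and ce: "(\<lambda>y. restrict y {1..n}) \<circ> (\<lambda>\<omega>. \<lambda>i\<in>{1..}. es i \<omega>) = ?e"
    by (auto simp: fun_eq_iff restrict_def)
  have "indep_var ?B ?x ?B ?e"
    using indep_var_compose[OF indep_Xs_es mr mr] unfolding cx ce .
  then have rv: "?x \<in> measurable M ?B" "?e \<in> measurable M ?B"
    and j: "distr M (?B \<Otimes>\<^sub>M ?B) (\<lambda>\<omega>. (?x \<omega>, ?e \<omega>)) = distr M ?B ?x \<Otimes>\<^sub>M distr M ?B ?e"
    unfolding indep_var_distribution_eq by auto
  show m1: "?x \<in> measurable M (SP n)"
    using rv(1) measurable_cong_sets[OF refl sets(1)] by blast
  have m2: "?e \<in> measurable M (SR n)"
    using rv(2) measurable_cong_sets[OF refl sets(2)] by blast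
  show "distr M (SP n) ?x = SP n"
    using lx distr_cong[OF refl sets(1), of M ?x ?x] by simp
  show "(\<lambda>\<omega>. (?x \<omega>, ?e \<omega>)) \<in> measurable M (SP n \<Otimes>\<^sub>M SR n)"
    using m1 m2 by (rule measurable_Pair)
  show "distr M (SP n \<Otimes>\<^sub>M SR n) (\<lambda>\<omega>. (?x \<omega>, ?e \<omega>)) = SP n \<Otimes>\<^sub>M SR n"
    using j lx le distr_cong[OF refl sets_pair_measure_cong[OF sets], of M "\<lambda>\<omega>. (?x \<omega>, ?e \<omega>)" "\<lambda>\<omega>. (?x \<omega>, ?e \<omega>)"]
    by simp
qed

lemma integral_pair_sample:
  fixes F :: "(nat \<Rightarrow> real) \<times> (nat \<Rightarrow> real) \<Rightarrow> 'b::{banach, second_countable_topology}"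
  assumes n: "n \<ge> 1" and F: "F \<in> borel_measurable (SP n \<Otimes>\<^sub>M SR n)"
  shows "(\<integral>\<omega>. F (restrict (x \<omega>) {1..n}, restrict (e \<omega>) {1..n}) \<partial>M) = (\<integral>p. F p \<partial>(SP n \<Otimes>\<^sub>M SR n))"
    and "integrable M (\<lambda>\<omega>. F (restrict (x \<omega>) {1..n}, restrict (e \<omega>) {1..n})) \<longleftrightarrow> integrable (SP n \<Otimes>\<^sub>M SR n) F"
  using integral_distr[OF sample_law(3)[OF n] F] integrable_distr_eq[OF sample_law(3)[OF n] F]
  unfolding sample_law(4)[OF n] by simp_all

lemma integral_sample:
  fixes F :: "(nat \<Rightarrow> real) \<Rightarrow> 'b::{banach, second_countable_topology}"
  assumes n: "n \<ge> 1" and F: "F \<in> borel_measurable (SP n)"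
  shows "(\<integral>\<omega>. F (restrict (x \<omega>) {1..n}) \<partial>M) = (\<integral>y. F y \<partial>SP n)"
  using integral_distr[OF sample_law(1)[OF n] F] unfolding sample_law(2)[OF n] by simp

lemma AE_inj: "AE \<omega> in M. \<forall>n. inj_on (x \<omega>) {1..n}"
proof -
  interpret rank_model P R f C 0 0 0 by (rule model)
  have "AE \<omega> in M. inj_on (x \<omega>) {1..n}" for n
  proof (cases "n = 0")
    case False
    then have n: "n \<ge> 1" by simp
    have "AE y in distr M (SP n) (\<lambda>\<omega>. restrict (x \<omega>) {1..n}). inj_on y {1..n}"
      unfolding sample_law(2)[OF n] by (rule X.AE_inj_on_sample) simp
    from AE_distrD[OF sample_law(1)[OF n] this] show ?thesis
    proof eventually_elim
      case (elim \<omega>)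
      have "inj_on (restrict (x \<omega>) {1..n}) {1..n} \<longleftrightarrow> inj_on (x \<omega>) {1..n}"
        by (rule inj_on_cong) simp
      with elim show ?case by blast
    qed
  qed simp
  then show ?thesis unfolding AE_all_countable by (rule allI)
qed

lemma nx_restrict:
  assumes "i \<in> {1..n}"
  shows "cyc_next {1..n} (restrict y {1..n}) i = cyc_next {1..n} y i"
    and "cyc_next {1..n} y i \<in> {1..n}"
proof -
  show "cyc_next {1..n} (restrict y {1..n}) i = cyc_next {1..n} y i"
    using assms by (intro cyc_next_cong) auto
  show "cyc_next {1..n} y i \<in> {1..n}" using assms by (intro cyc_next_in) auto
qed

lemma T_restrict:
  "rank_model.T f a b c n (restrict y {1..n}) (restrict z {1..n}) = rank_model.T f a b c n y z"
proof -
  interpret rank_model P R f C a b c by (rule model)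
  show ?thesis unfolding T_def
    by (intro sum.cong refl) (simp only: nx_restrict restrict_apply if_True)
qed

abbreviation TM :: "real \<Rightarrow> real \<Rightarrow> real \<Rightarrow> nat \<Rightarrow> 'a \<Rightarrow> real" where
  "TM a b c n \<omega> \<equiv> rank_model.T f a b c n (x \<omega>) (e \<omega>)"
abbreviation ZM :: "real \<Rightarrow> real \<Rightarrow> real \<Rightarrow> nat \<Rightarrow> 'a \<Rightarrow> real" where
  "ZM a b c n \<omega> \<equiv> rank_model.Z P R f a b c n (x \<omega>) (e \<omega>)"

lemma TM_meas [measurable]: "TM a b c n \<in> borel_measurable M"
proof (cases "n = 0")
  case True
  interpret rank_model P R f C a b c by (rule model)
  show ?thesis using True by (simp add: T_def)
next
  case False
  then have n: "n \<ge> 1" by simp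
  interpret rank_model P R f C a b c by (rule model)
  have "(\<lambda>\<omega>. T n (restrict (x \<omega>) {1..n}) (restrict (e \<omega>) {1..n})) \<in> borel_measurable M"
    using measurable_compose[OF sample_law(3)[OF n] T_meas] by simp
  then show ?thesis unfolding T_restrict .
qed

lemma Z_restrict:
  "rank_model.Z P R f a b c n (restrict y {1..n}) (restrict z {1..n}) = rank_model.Z P R f a b c n y z"
proof -
  interpret rank_model P R f C a b c by (rule model)
  show ?thesis unfolding Z_def T_restrict ..
qed

lemma ZM_meas [measurable]: "ZM a b c n \<in> borel_measurable M"
proof -
  interpret rank_model P R f C a b c by (rule model)
  show ?thesis unfolding Z_def by measurable
qed

lemma ZM_second_moment:
  assumes n: "n \<ge> 3"
  shows "integrable M (\<lambda>\<omega>. (ZM a b c n \<omega>)\<^sup>2)"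
    and "expectation (\<lambda>\<omega>. (ZM a b c n \<omega>)\<^sup>2) \<le> rank_model.K2 P R f C a b c * real n"
proof -
  interpret rank_model P R f C a b c by (rule model)
  have n1: "n \<ge> 1" using n by simp
  have m: "(\<lambda>p. (Z n (fst p) (snd p))\<^sup>2) \<in> borel_measurable (J n)" by measurable
  show "integrable M (\<lambda>\<omega>. (ZM a b c n \<omega>)\<^sup>2)"
    using integral_pair_sample(2)[OF n1 m] Z_square_integrable[of n] by (simp add: Z_restrict)
  show "expectation (\<lambda>\<omega>. (ZM a b c n \<omega>)\<^sup>2) \<le> K2 * real n"
    using integral_pair_sample(1)[OF n1 m] second_moment[OF n] by (simp add: Z_restrict)
qed

lemma ZM_char:
  "(\<lambda>n. \<integral>\<omega>. iexp (t * (ZM a b c n \<omega> / sqrt (real n))) \<partial>M)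
    \<longlonglongrightarrow> exp (- (t\<^sup>2 * (rank_model.V0 P R f a b c + rank_model.V1 P R f a b c) / 2))"
proof -
  interpret rank_model P R f C a b c by (rule model)
  have eq: "(\<integral>p. iexp (t * (Z n (fst p) (snd p) / sqrt (real n))) \<partial>J n)
      = (\<integral>\<omega>. iexp (t * (ZM a b c n \<omega> / sqrt (real n))) \<partial>M)" if n: "n \<ge> 1" for n
  proof -
    have m: "(\<lambda>p. iexp (t * (Z n (fst p) (snd p) / sqrt (real n)))) \<in> borel_measurable (J n)" by measurable
    show ?thesis using integral_pair_sample(1)[OF n m] by (simp add: Z_restrict)
  qed
  show ?thesis
    by (rule Lim_transform_eventually[OF char_tendsto]) (rule eventually_sequentiallyI[of 1], rule eq)
qed

lemma TM_AE_lim: "AE \<omega> in M. (\<lambda>n. TM a b c n \<omega> / real n) \<longlonglongrightarrow> rank_model.hbar P R f a b c"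
proof -
  interpret rank_model P R f C a b c by (rule model)
  have "AE \<omega> in M. \<forall>n\<ge>1. \<bar>TM a b c (Suc n) \<omega> - TM a b c n \<omega>\<bar> \<le> 3 * (\<bar>a\<bar> * (L * L)) + (\<bar>b\<bar> * L + \<bar>c\<bar> * L)"
    using AE_inj by eventually_elim (use T_increment in auto)
  moreover have "(\<lambda>n. hbar - a / 2 * D n) \<longlonglongrightarrow> hbar - a / 2 * 0"
    by (intro tendsto_diff tendsto_mult tendsto_const D_tendsto_0)
  then have "(\<lambda>n. hbar - a / 2 * D n) \<longlonglongrightarrow> hbar" by simp
  ultimately show ?thesis
    using ZM_second_moment[of _ a b c] unfolding Z_def
    by (intro AE_tendsto_of_second_moments[where N = 3]) (auto intro: TM_meas)
qed

lemma exp_eps_eq: "exp_eps M eps f = rank_model.m R f" "exp_eps M eps (\<lambda>z. (f z)\<^sup>2) = rank_model.s R f"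
proof -
  interpret rank_model P R f C 0 0 0 by (rule model)
  show "exp_eps M eps f = m" "exp_eps M eps (\<lambda>z. (f z)\<^sup>2) = s"
    unfolding exp_eps_def m_def s_def by (auto simp: fun_eq_iff integral_distr)
qed

lemma right_neighbour_in: "i \<in> {1..n} \<Longrightarrow> right_neighbour n y i \<in> {1..n}"
  using right_neighbour_eq[of i n y] nx_restrict(2)[of i n y] by auto

lemma right_neighbour_meas:
  assumes i: "i \<in> {1..n}"
  shows "(\<lambda>\<omega>. right_neighbour n (x \<omega>) i) \<in> measurable M (count_space UNIV)"
proof -
  have eq: "Measurable.pred M (\<lambda>\<omega>. x \<omega> k = x \<omega> l)" if "k \<in> {1..n}" "l \<in> {1..n}" for k l
  proof -
    have [measurable]: "Xs k \<in> borel_measurable M" "Xs l \<in> borel_measurable M" using Xs_meas that by auto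
    show ?thesis by measurable
  qed
  have [measurable]: "Measurable.pred M (\<lambda>\<omega>. inj_on (x \<omega>) {1..n})"
    unfolding inj_on_def
    by (intro pred_intros_finite(3) pred_intros_logic(4) eq) auto
  have [measurable]: "(\<lambda>\<omega>. cyc_next {1..n} (x \<omega>) i) \<in> measurable M (count_space UNIV)"
    using i Xs_meas by (intro measurable_cyc_next) auto
  show ?thesis unfolding right_neighbour_eq[OF i] by measurable
qed

lemma at_right_neighbour_meas:
  fixes g :: "nat \<Rightarrow> 'a \<Rightarrow> real"
  assumes i: "i \<in> {1..n}" and g: "\<And>k. k \<in> {1..n} \<Longrightarrow> g k \<in> borel_measurable M"
  shows "(\<lambda>\<omega>. g (right_neighbour n (x \<omega>) i) \<omega>) \<in> borel_measurable M"
proof -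
  note [measurable] = right_neighbour_meas[OF i]
  have "g (right_neighbour n (x \<omega>) i) \<omega> = (\<Sum>k = 1..n. if right_neighbour n (x \<omega>) i = k then g k \<omega> else 0)" for \<omega>
    using right_neighbour_in[OF i, of "x \<omega>"] by simp
  moreover have "(\<lambda>\<omega>. \<Sum>k = 1..n. if right_neighbour n (x \<omega>) i = k then g k \<omega> else 0) \<in> borel_measurable M"
  proof (intro borel_measurable_sum)
    fix k assume "k \<in> {1..n}"
    note [measurable] = g[OF this]
    show "(\<lambda>\<omega>. if right_neighbour n (x \<omega>) i = k then g k \<omega> else 0) \<in> borel_measurable M"
      by measurable
  qed
  ultimately show ?thesis by simp
qed

text \<open>By exchangeability every observation contributes the same amount to the mean of \<open>Q\<close>.\<close>

lemma Delta_eq: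
  assumes n: "n \<ge> 1"
  shows "Delta M Xs (rank_model.m R f) n = rank_model.D P R f n"
    and "rank_model.D P R f n = 1 / real n * expectation (\<lambda>\<omega>. \<Sum>i = 1..n.
      (rank_model.m R f (Xs (sort_perm_periodic n (x \<omega>) (i - 1)) \<omega>) - rank_model.m R f (Xs (sort_perm_periodic n (x \<omega>) i) \<omega>))\<^sup>2)"
proof -
  interpret rank_model P R f C 0 0 0 by (rule model)
  define F where "F i y = (m (y i) - m (y (nx n y i)))\<^sup>2" for i and y :: "nat \<Rightarrow> real"
  have Fm: "F i \<in> borel_measurable (SX n)" for i
  proof -
    have "(\<lambda>x. m (x (nx n x i))) \<in> borel_measurable (SX n)"
      by (rule measurable_compose[OF X.measurable_next_coordinate m_meas]) simp
    moreover have "(\<lambda>x. m (x i)) \<in> borel_measurable (SX n)"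
      by (rule measurable_compose[OF X.measurable_coordinate m_meas])
    ultimately show ?thesis unfolding F_def[abs_def]
      by (intro borel_measurable_power borel_measurable_diff)
  qed
  have Fi: "integrable (SX n) (F i)" for i
    using m_diff_square(1) Fm
    by (intro prob_space.integrable_bounded[OF prob_SX, where B = "4 * (L * L)"]) (auto simp: F_def)
  have Fr: "F i (restrict y {1..n}) = F i y" if "i \<in> {1..n}" for i y
    unfolding F_def using nx_restrict[OF that] that by simp
  have exch: "(\<integral>y. F j y \<partial>SX n) = (\<integral>y. F 1 y \<partial>SX n)" if j: "j \<in> {1..n}" for j
  proof -
    define p where "p = Transposition.transpose (1::nat) j"
    have p: "p permutes {1..n}" unfolding p_def using j n by (intro permutes_swap_id) auto
    have p1: "p 1 = j" by (simp add: p_def)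
    have pin: "p k \<in> {1..n}" if "k \<in> {1..n}" for k using permutes_in_image[OF p] that by simp
    let ?t = "\<lambda>y. \<lambda>k\<in>{1..n}. y (p k)"
    have d: "distr (SX n) (SX n) ?t = SX n"
      using distr_PiM_reindex[of "{1..n}" "\<lambda>_. P" p "{1..n}"] permutes_inj_on[OF p] pin X.prob_space_axioms by auto
    have tm: "?t \<in> measurable (SX n) (SX n)"
    proof (rule measurable_restrict)
      fix k assume "k \<in> {1..n}"
      then show "(\<lambda>y. y (p k)) \<in> measurable (SX n) P" by (intro measurable_component_singleton pin)
    qed
    have "(\<integral>y. F 1 y \<partial>SX n) = (\<integral>y. F 1 (?t y) \<partial>SX n)"
      using integral_distr[OF tm Fm[of 1]] unfolding d .
    also have "\<dots> = (\<integral>y. F j y \<partial>SX n)"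
    proof (rule integral_cong_AE)
      show "AE y in SX n. F 1 (?t y) = F j y"
        using X.AE_inj_on_sample[OF finite_atLeastAtMost]
      proof eventually_elim
        case (elim y)
        have "F 1 (?t y) = F 1 (\<lambda>k. y (p k))" using Fr[of 1 "\<lambda>k. y (p k)"] n by (simp add: restrict_def)
        also have "\<dots> = F j y"
          unfolding F_def using cyc_next_permute[OF finite_atLeastAtMost elim p, of 1] n p1 by simp
        finally show ?case .
      qed
      show "(\<lambda>y. F 1 (?t y)) \<in> borel_measurable (SX n)" by (rule measurable_compose[OF tm Fm])
    qed (rule Fm)
    finally show ?thesis by simp
  qed
  have sumF: "(\<integral>y. Q n y \<partial>SX n) = (\<Sum>i = 1..n. \<integral>y. F i y \<partial>SX n)"
    unfolding Q_def F_def[symmetric] using Fi by (rule Bochner_Integration.integral_sum)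
  also have "\<dots> = (\<Sum>i = 1..n. \<integral>y. F 1 y \<partial>SX n)" by (intro sum.cong refl exch)
  finally have "(\<integral>y. Q n y \<partial>SX n) = real n * (\<integral>y. F 1 y \<partial>SX n)" by simp
  then have D1: "D n = (\<integral>y. F 1 y \<partial>SX n)" using n by (simp add: D_def)
  have trans: "expectation (\<lambda>\<omega>. F i (x \<omega>)) = (\<integral>y. F i y \<partial>SX n)" if "i \<in> {1..n}" for i
    using integral_sample[OF n Fm[of i]] Fr[OF that] by simp
  have rn: "AE \<omega> in M. right_neighbour n (x \<omega>) i = nx n (x \<omega>) i" if "i \<in> {1..n}" for i
    using AE_inj by eventually_elim (use right_neighbour_eq[OF that] in simp)
  have rm: "(\<lambda>\<omega>. F i (x \<omega>)) \<in> borel_measurable M" if "i \<in> {1..n}" for i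
    using measurable_compose[OF sample_law(1)[OF n] Fm[of i]] Fr[OF that] by simp
  define G where "G i \<omega> = (m (Xs i \<omega>) - m (Xs (right_neighbour n (x \<omega>) i) \<omega>))\<^sup>2" for i \<omega>
  have Gm: "G i \<in> borel_measurable M" if i: "i \<in> {1..n}" for i
  proof -
    have "(\<lambda>\<omega>. m (Xs k \<omega>)) \<in> borel_measurable M" if "k \<in> {1..n}" for k
      using that by (intro measurable_compose[OF Xs_meas m_meas]) auto
    then show ?thesis unfolding G_def[abs_def]
      using at_right_neighbour_meas[OF i, of "\<lambda>k \<omega>. m (Xs k \<omega>)"] i by simp
  qed
  have EG: "expectation (G i) = (\<integral>y. F i y \<partial>SX n)" if i: "i \<in> {1..n}" for i
  proof -
    have "expectation (G i) = expectation (\<lambda>\<omega>. F i (x \<omega>))"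
    proof (rule integral_cong_AE[OF Gm[OF i] rm[OF i]])
      show "AE \<omega> in M. G i \<omega> = F i (x \<omega>)"
        using rn[OF i] by eventually_elim (simp add: G_def F_def)
    qed
    then show ?thesis using trans[OF i] by simp
  qed
  have iG: "integrable M (G i)" if i: "i \<in> {1..n}" for i
    using m_diff_square(1) Gm[OF i] by (intro integrable_bounded[where B = "4 * (L * L)"]) (auto simp: G_def)
  show "Delta M Xs m n = D n"
    using EG[of 1] n unfolding Delta_def D1 G_def by simp
  have "expectation (\<lambda>\<omega>. \<Sum>i = 1..n. (m (Xs (sort_perm_periodic n (x \<omega>) (i - 1)) \<omega>) - m (Xs (sort_perm_periodic n (x \<omega>) i) \<omega>))\<^sup>2)
    = expectation (\<lambda>\<omega>. \<Sum>i = 1..n. G i \<omega>)"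
    unfolding G_def using sum_sort_perm_periodic[OF n, of "\<lambda>i j. (m (Xs i _) - m (Xs j _))\<^sup>2"]
    by (intro Bochner_Integration.integral_cong refl)
       (rule sum_sort_perm_periodic[OF n])
  also have "\<dots> = (\<Sum>i = 1..n. expectation (G i))" using iG by (intro Bochner_Integration.integral_sum)
  also have "\<dots> = (\<Sum>i = 1..n. D n)" unfolding D1 by (intro sum.cong refl) (simp only: EG exch)
  also have "\<dots> = real n * D n" by simp
  finally show "D n = 1 / real n * expectation (\<lambda>\<omega>. \<Sum>i = 1..n.
      (m (Xs (sort_perm_periodic n (x \<omega>) (i - 1)) \<omega>) - m (Xs (sort_perm_periodic n (x \<omega>) i) \<omega>))\<^sup>2)"
    using n by simp
qed

lemma D_bounded_2_variation:
  assumes "bounded_2_variation (rank_model.m R f)"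
  shows "(\<lambda>n. sqrt (real n) * rank_model.D P R f n) \<longlonglongrightarrow> 0"
proof -
  interpret rank_model P R f C 0 0 0 by (rule model)
  obtain K where K: "\<And>n x. inj_on x {1..n} \<Longrightarrow> (\<Sum>i = 1..n. (m (x i) - m (x (cyc_next {1..n} x i)))\<^sup>2) \<le> K"
    using sum_cyc_next_bounded_2_variation[OF assms] by blast
  have le: "sqrt (real n) * D n \<le> K / sqrt (real n)" if n: "n \<ge> 1" for n
  proof -
    interpret S: prob_space "SX n" by (rule prob_SX)
    have "(\<integral>y. Q n y \<partial>SX n) \<le> (\<integral>y. K \<partial>SX n)"
    proof (intro integral_mono_AE Q_integrable)
      show "AE y in SX n. Q n y \<le> K"
        using X.AE_inj_on_sample[OF finite_atLeastAtMost] by eventually_elim (simp only: Q_def K)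
    qed simp
    then have "D n \<le> K / real n" using S.prob_space by (simp add: D_def divide_right_mono)
    then have "sqrt (real n) * D n \<le> sqrt (real n) * (K / real n)" by (rule mult_left_mono) simp
    also have "\<dots> = K / sqrt (real n)"
    proof -
      have "sqrt (real n) * (K / real n) = K * (sqrt (real n) / (sqrt (real n) * sqrt (real n)))" by simp
      then show ?thesis using n by (simp del: real_sqrt_mult_self)
    qed
    finally show ?thesis .
  qed
  show ?thesis
  proof (rule tendsto_sandwich[OF _ _ tendsto_const])
    show "\<forall>\<^sub>F n in sequentially. 0 \<le> sqrt (real n) * D n" by (simp add: D_nonneg)
    show "\<forall>\<^sub>F n in sequentially. sqrt (real n) * D n \<le> K / sqrt (real n)"
      by (rule eventually_sequentiallyI[of 1]) (rule le)
    show "(\<lambda>n. K / sqrt (real n)) \<longlonglongrightarrow> 0"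
      by (intro tendsto_divide_0[OF tendsto_const] filterlim_at_top_imp_at_infinity
          filterlim_compose[OF sqrt_at_top] filterlim_real_sequentially)
  qed
qed

end

section \<open>Identification of the limits\<close>

lemma quadratic_form: "u \<bullet> (A *v u) = (\<Sum>i\<in>UNIV. \<Sum>j\<in>UNIV. u $ i * u $ j * A $ i $ j)" for u :: "real ^ 'n" and A
  unfolding inner_vec_def matrix_vector_mult_def by (simp add: sum_distrib_left mult_ac)

definition bounded_borel :: "(real \<Rightarrow> real) \<Rightarrow> bool" where
  "bounded_borel g \<longleftrightarrow> g \<in> borel_measurable borel \<and> (\<exists>B. \<forall>z. \<bar>g z\<bar> \<le> B)"

lemma bounded_borel_const: "bounded_borel (\<lambda>z. k)"
  unfolding bounded_borel_def by auto

lemma bounded_borel_add: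
  assumes "bounded_borel g" "bounded_borel h"
  shows "bounded_borel (\<lambda>z. g z + h z)"
proof -
  obtain B B' where "\<And>z. \<bar>g z\<bar> \<le> B" "\<And>z. \<bar>h z\<bar> \<le> B'" using assms unfolding bounded_borel_def by blast
  then have "\<bar>g z + h z\<bar> \<le> B + B'" for z by (intro order_trans[OF abs_triangle_ineq] add_mono)
  then show ?thesis using assms unfolding bounded_borel_def by auto
qed

lemma bounded_borel_mult:
  assumes "bounded_borel g" "bounded_borel h"
  shows "bounded_borel (\<lambda>z. g z * h z)"
proof -
  obtain B B' where B: "\<And>z. \<bar>g z\<bar> \<le> B" "\<And>z. \<bar>h z\<bar> \<le> B'" using assms unfolding bounded_borel_def by blast
  then have "\<bar>g z * h z\<bar> \<le> B * B'" for z
    unfolding abs_mult by (intro mult_mono) (auto intro: order_trans[OF abs_ge_zero])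
  then show ?thesis using assms unfolding bounded_borel_def by auto
qed

lemma average_bound:
  fixes g :: "nat \<Rightarrow> real"
  assumes "\<And>i. \<bar>g i\<bar> \<le> B" "0 \<le> B"
  shows "\<bar>1 / real n * (\<Sum>i = 1..n. g i)\<bar> \<le> B"
proof (cases "n = 0")
  case False
  have "\<bar>\<Sum>i = 1..n. g i\<bar> \<le> real n * B"
    using sum_norm_bound[of "{1..n}" g B] assms by simp
  then show ?thesis using False by (simp add: abs_mult divide_le_eq mult.commute)
qed (use assms in simp)

context rank_setup
begin

abbreviation m0 where "m0 \<equiv> rank_model.m R f"
abbreviation s0 where "s0 \<equiv> rank_model.s R f"
abbreviation D0 where "D0 \<equiv> rank_model.D P R f"
abbreviation Y :: "'a \<Rightarrow> real" where "Y \<omega> \<equiv> f (X \<omega>, eps \<omega>)"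

definition p0 :: real where "p0 = (\<integral>u. (m0 u)\<^sup>2 \<partial>P)"
definition \<mu>0 :: real where "\<mu>0 = (\<integral>u. m0 u \<partial>P)"
definition q0 :: real where "q0 = (\<integral>u. s0 u \<partial>P)"

lemma m_meas [measurable]: "m0 \<in> borel_measurable borel" and s_meas [measurable]: "s0 \<in> borel_measurable borel"
  and m_bound: "\<bar>m0 u\<bar> \<le> C" and s_bound: "\<bar>s0 u\<bar> \<le> C\<^sup>2"
proof -
  interpret rank_model P R f C 0 0 0 by (rule model)
  show "m0 \<in> borel_measurable borel" "s0 \<in> borel_measurable borel" "\<bar>m0 u\<bar> \<le> C" "\<bar>s0 u\<bar> \<le> C\<^sup>2"
    by (rule m_meas s_meas m_bound_C s_bound_C)+
qed

lemma prob_P: "prob_space P" and prob_R: "prob_space R"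
  by (rule prob_space_distr, simp)+

lemma integral_X: "h \<in> borel_measurable borel \<Longrightarrow> expectation (\<lambda>\<omega>. h (X \<omega>)) = (\<integral>u. h u \<partial>P)" for h :: "real \<Rightarrow> real"
  by (simp add: integral_distr)

lemma integral_X_eps:
  fixes F :: "real \<times> real \<Rightarrow> real"
  assumes [measurable]: "F \<in> borel_measurable (borel \<Otimes>\<^sub>M borel)" and b: "\<And>z. \<bar>F z\<bar> \<le> B"
  shows "expectation (\<lambda>\<omega>. F (X \<omega>, eps \<omega>)) = (\<integral>u. (\<integral>v. F (u, v) \<partial>R) \<partial>P)"
proof -
  interpret PR: pair_prob_space P R
    using prob_P prob_R by (simp add: pair_prob_space_def pair_sigma_finite_def prob_space_imp_sigma_finite)
  have law: "P \<Otimes>\<^sub>M R = distr M (borel \<Otimes>\<^sub>M borel) (\<lambda>\<omega>. (X \<omega>, eps \<omega>))"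
    using indep_X_eps unfolding indep_var_distribution_eq by simp
  have F: "F \<in> borel_measurable (P \<Otimes>\<^sub>M R)" by measurable
  have "integrable (P \<Otimes>\<^sub>M R) F"
    using F b by (intro PR.integrable_const_bound[where B = B]) auto
  from PR.integral_fst'[OF this] show ?thesis unfolding law by (simp add: integral_distr)
qed

lemma f2_meas: "(\<lambda>z. (f z)\<^sup>2) \<in> borel_measurable (borel \<Otimes>\<^sub>M borel)" by measurable

lemma f2_bound: "\<bar>(f z)\<^sup>2\<bar> \<le> C\<^sup>2"
  using power_mono[OF f_bound[of z], of 2] by simp

lemma Y_meas [measurable]: "Y \<in> borel_measurable M" by measurable

lemma Y_moments: "expectation Y = \<mu>0" "expectation (\<lambda>\<omega>. (Y \<omega>)\<^sup>2) = q0"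
proof -
  interpret rank_model P R f C 0 0 0 by (rule model)
  show "expectation Y = \<mu>0" unfolding \<mu>0_def m_def using integral_X_eps[OF f_meas f_bound] by simp
  show "expectation (\<lambda>\<omega>. (Y \<omega>)\<^sup>2) = q0" unfolding q0_def s_def using integral_X_eps[OF f2_meas f2_bound] by simp
qed

lemma Y_integrable: "integrable M Y" "integrable M (\<lambda>\<omega>. (Y \<omega>)\<^sup>2)"
  using f_bound f2_bound by (auto intro!: integrable_bounded)

lemma variance_Y: "variance Y = q0 - \<mu>0\<^sup>2"
  using variance_eq[OF Y_integrable] by (simp add: Y_moments)

lemma cond_exp_Y: "AE \<omega> in M. cond_exp_given M X Y \<omega> = m0 (X \<omega>)"
proof -
  let ?F = "vimage_algebra (space M) X borel"
  have setsF: "sets ?F = {X -` A \<inter> space M | A. A \<in> sets borel}"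
    by (rule sets_vimage_algebra2) simp
  have "subalgebra M ?F" unfolding subalgebra_def setsF using X_meas by (auto intro: measurable_sets)
  then interpret finite_measure_subalgebra M ?F by unfold_locales
  have XF: "X \<in> borel_measurable ?F" by (rule measurable_vimage_algebra1) simp
  have mi: "integrable M (\<lambda>\<omega>. m0 (X \<omega>))" using m_bound by (intro integrable_bounded[where B = C]) auto
  show ?thesis unfolding cond_exp_given_def
  proof (rule real_cond_exp_charact)
    fix A assume "A \<in> sets ?F"
    then obtain B where B [measurable]: "B \<in> sets borel" and A: "A = X -` B \<inter> space M" unfolding setsF by auto
    have "set_lebesgue_integral M A Y = expectation (\<lambda>\<omega>. indicator B (X \<omega>) * f (X \<omega>, eps \<omega>))"
      unfolding set_lebesgue_integral_def A by (intro Bochner_Integration.integral_cong) (auto simp: indicator_def)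
    also have "\<dots> = (\<integral>u. (\<integral>v. indicator B u * f (u, v) \<partial>R) \<partial>P)"
    proof -
      have "(\<lambda>z. indicator B (fst z) * f z) \<in> borel_measurable (borel \<Otimes>\<^sub>M borel)" by measurable
      moreover have "\<bar>indicator B (fst z) * f z\<bar> \<le> C" for z
        using f_bound[of z] C by (simp add: indicator_def)
      ultimately show ?thesis using integral_X_eps[of "\<lambda>z. indicator B (fst z) * f z" C] by simp
    qed
    also have "\<dots> = (\<integral>u. indicator B u * m0 u \<partial>P)"
    proof -
      interpret rank_model P R f C 0 0 0 by (rule model)
      show ?thesis unfolding m_def by simp
    qed
    also have "\<dots> = expectation (\<lambda>\<omega>. indicator B (X \<omega>) * m0 (X \<omega>))"
      by (rule integral_X[symmetric]) measurable
    also have "\<dots> = set_lebesgue_integral M A (\<lambda>\<omega>. m0 (X \<omega>))"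
      unfolding set_lebesgue_integral_def A by (intro Bochner_Integration.integral_cong) (auto simp: indicator_def)
    finally show "set_lebesgue_integral M A Y = set_lebesgue_integral M A (\<lambda>\<omega>. m0 (X \<omega>))" .
  qed (use Y_integrable mi measurable_compose[OF XF m_meas] in auto)
qed

lemma cond_exp_meas: "cond_exp_given M X Y \<in> borel_measurable M"
  unfolding cond_exp_given_def by simp

lemma cond_exp_moments:
  "expectation (cond_exp_given M X Y) = \<mu>0" "expectation (\<lambda>\<omega>. (cond_exp_given M X Y \<omega>)\<^sup>2) = p0"
  "variance (cond_exp_given M X Y) = p0 - \<mu>0\<^sup>2"
proof -
  have mm: "(\<lambda>\<omega>. m0 (X \<omega>)) \<in> borel_measurable M" by measurable
  show 1: "expectation (cond_exp_given M X Y) = \<mu>0"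
    unfolding \<mu>0_def integral_X[OF m_meas, symmetric] by (intro integral_cong_AE cond_exp_meas mm cond_exp_Y)
  show "expectation (\<lambda>\<omega>. (cond_exp_given M X Y \<omega>)\<^sup>2) = p0"
    unfolding p0_def integral_X[OF borel_measurable_power[OF m_meas], symmetric]
  proof (intro integral_cong_AE borel_measurable_power cond_exp_meas mm)
    show "AE \<omega> in M. (cond_exp_given M X Y \<omega>)\<^sup>2 = (m0 (X \<omega>))\<^sup>2"
      using cond_exp_Y by eventually_elim simp
  qed
  have mi: "integrable M (\<lambda>\<omega>. m0 (X \<omega>))" "integrable M (\<lambda>\<omega>. (m0 (X \<omega>))\<^sup>2)"
    using m_bound by (auto intro!: integrable_bounded[where B = C] integrable_bounded[OF _ norm_square_le])
  have "variance (cond_exp_given M X Y) = expectation (\<lambda>\<omega>. (m0 (X \<omega>) - \<mu>0)\<^sup>2)"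
    unfolding 1
  proof (intro integral_cong_AE borel_measurable_power borel_measurable_diff cond_exp_meas mm)
    show "AE \<omega> in M. (cond_exp_given M X Y \<omega> - \<mu>0)\<^sup>2 = (m0 (X \<omega>) - \<mu>0)\<^sup>2"
      using cond_exp_Y by eventually_elim simp
  qed simp_all
  also have "\<dots> = p0 - \<mu>0\<^sup>2"
    using variance_eq[OF mi] integral_X[OF m_meas] integral_X[OF borel_measurable_power[OF m_meas, of 2]]
    by (simp add: p0_def \<mu>0_def)
  finally show "variance (cond_exp_given M X Y) = p0 - \<mu>0\<^sup>2" .
qed

lemma sobol_index_eq: "sobol_index M X Y = (p0 - \<mu>0\<^sup>2) / (q0 - \<mu>0\<^sup>2)"
  by (simp only: sobol_index_def cond_exp_moments(3) variance_Y)

definition Pn :: "nat \<Rightarrow> 'a \<Rightarrow> real" where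
  "Pn n \<omega> = 1 / real n * (\<Sum>i = 1..n. f (Xs i \<omega>, es i \<omega>)
     * f (Xs (right_neighbour n (x \<omega>) i) \<omega>, es (right_neighbour n (x \<omega>) i) \<omega>))"
definition Yn :: "nat \<Rightarrow> 'a \<Rightarrow> real" where
  "Yn n \<omega> = 1 / real n * (\<Sum>i = 1..n. f (Xs i \<omega>, es i \<omega>))"
definition Sn :: "nat \<Rightarrow> 'a \<Rightarrow> real" where
  "Sn n \<omega> = 1 / real n * (\<Sum>i = 1..n. (f (Xs i \<omega>, es i \<omega>))\<^sup>2)"

abbreviation \<rho>hat :: "nat \<Rightarrow> 'a \<Rightarrow> real" where
  "\<rho>hat n \<omega> \<equiv> rank_estimator n (x \<omega>) (\<lambda>i. f (Xs i \<omega>, es i \<omega>))"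

lemma rank_estimator_eq: "\<rho>hat n \<omega> = (Pn n \<omega> - (Yn n \<omega>)\<^sup>2) / (Sn n \<omega> - (Yn n \<omega>)\<^sup>2)"
  unfolding rank_estimator_def Pn_def Yn_def Sn_def ..

lemma y_meas: "i \<in> {1..n} \<Longrightarrow> (\<lambda>\<omega>. f (Xs i \<omega>, es i \<omega>)) \<in> borel_measurable M"
  by (rule measurable_compose[OF measurable_Pair f_meas]) (auto intro: Xs_meas es_meas)

lemma averages_meas [measurable]:
  "Pn n \<in> borel_measurable M" "Yn n \<in> borel_measurable M" "Sn n \<in> borel_measurable M"
  unfolding Pn_def[abs_def] Yn_def[abs_def] Sn_def[abs_def]
  by (intro borel_measurable_times borel_measurable_const borel_measurable_sum borel_measurable_power y_meas
        at_right_neighbour_meas; assumption)+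

lemma averages_bound: "\<bar>Pn n \<omega>\<bar> \<le> C\<^sup>2" "\<bar>Yn n \<omega>\<bar> \<le> C\<^sup>2" "\<bar>Sn n \<omega>\<bar> \<le> C\<^sup>2"
proof -
  have "C \<le> C\<^sup>2" using C by (simp add: power2_eq_square)
  then have fC: "\<bar>f z\<bar> \<le> C\<^sup>2" for z using f_bound[of z] by linarith
  have "\<bar>f z * f z'\<bar> \<le> C * C" for z z' unfolding abs_mult using f_bound C by (intro mult_mono) auto
  then have ff: "\<bar>f z * f z'\<bar> \<le> C\<^sup>2" for z z' by (simp add: power2_eq_square)
  show "\<bar>Pn n \<omega>\<bar> \<le> C\<^sup>2" "\<bar>Yn n \<omega>\<bar> \<le> C\<^sup>2" "\<bar>Sn n \<omega>\<bar> \<le> C\<^sup>2"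
    unfolding Pn_def Yn_def Sn_def by (intro average_bound ff fC f2_bound zero_le_power2)+
qed

lemma averages_TM:
  shows "AE \<omega> in M. \<forall>n. Pn n \<omega> = TM 1 0 0 n \<omega> / real n"
    and "Yn n \<omega> = TM 0 1 0 n \<omega> / real n" and "Sn n \<omega> = TM 0 0 1 n \<omega> / real n"
proof -
  interpret A: rank_model P R f C 1 0 0 by (rule model)
  interpret B: rank_model P R f C 0 1 0 by (rule model)
  interpret S: rank_model P R f C 0 0 1 by (rule model)
  show "AE \<omega> in M. \<forall>n. Pn n \<omega> = TM 1 0 0 n \<omega> / real n"
    using AE_inj
  proof eventually_elim
    case (elim \<omega>)
    show ?case
    proof
      fix n
      have "right_neighbour n (x \<omega>) i = cyc_next {1..n} (x \<omega>) i" if "i \<in> {1..n}" for i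
        using right_neighbour_eq[OF that] elim by simp
      then show "Pn n \<omega> = TM 1 0 0 n \<omega> / real n" unfolding Pn_def A.T_def by simp
    qed
  qed
  show "Yn n \<omega> = TM 0 1 0 n \<omega> / real n" "Sn n \<omega> = TM 0 0 1 n \<omega> / real n"
    unfolding Yn_def Sn_def B.T_def S.T_def by simp_all
qed

lemma hbar_eq: "rank_model.hbar P R f a b c = a * p0 + b * \<mu>0 + c * q0"
proof -
  interpret rank_model P R f C a b c by (rule model)
  have "integrable P (\<lambda>u. (m0 u)\<^sup>2)" "integrable P m0" "integrable P s0"
    using m_bound s_bound
    by (auto intro!: prob_space.integrable_bounded[OF prob_P] norm_square_le[where B = C])
  then show ?thesis unfolding hbar_def h_def by (simp add: p0_def \<mu>0_def q0_def)
qed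

lemma averages_AE_lim:
  "AE \<omega> in M. (\<lambda>n. Pn n \<omega>) \<longlonglongrightarrow> p0" "AE \<omega> in M. (\<lambda>n. Yn n \<omega>) \<longlonglongrightarrow> \<mu>0" "AE \<omega> in M. (\<lambda>n. Sn n \<omega>) \<longlonglongrightarrow> q0"
proof -
  show "AE \<omega> in M. (\<lambda>n. Pn n \<omega>) \<longlonglongrightarrow> p0"
    using TM_AE_lim[of 1 0 0] averages_TM(1) by eventually_elim (simp add: hbar_eq)
  show "AE \<omega> in M. (\<lambda>n. Yn n \<omega>) \<longlonglongrightarrow> \<mu>0"
    using TM_AE_lim[of 0 1 0] by eventually_elim (simp add: hbar_eq averages_TM)
  show "AE \<omega> in M. (\<lambda>n. Sn n \<omega>) \<longlonglongrightarrow> q0"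
    using TM_AE_lim[of 0 0 1] by eventually_elim (simp add: hbar_eq averages_TM)
qed

lemma ZM_eq: "ZM a b c n \<omega> = TM a b c n \<omega> - real n * (a * p0 + b * \<mu>0 + c * q0 - a / 2 * D0 n)"
proof -
  interpret rank_model P R f C a b c by (rule model)
  show ?thesis unfolding Z_def hbar_eq ..
qed

lemma TM_linear: "TM a b c n \<omega> = a * TM 1 0 0 n \<omega> + b * TM 0 1 0 n \<omega> + c * TM 0 0 1 n \<omega>"
proof -
  interpret W: rank_model P R f C a b c by (rule model)
  interpret A: rank_model P R f C 1 0 0 by (rule model)
  interpret B: rank_model P R f C 0 1 0 by (rule model)
  interpret S: rank_model P R f C 0 0 1 by (rule model)
  show ?thesis unfolding W.T_def A.T_def B.T_def S.T_def
    by (simp add: sum.distrib sum_distrib_left)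
qed

lemma square_average_moment:
  fixes g :: "'a \<Rightarrow> real"
  assumes n: "n \<ge> 3" and [measurable]: "g \<in> borel_measurable M"
    and eq: "AE \<omega> in M. g \<omega> = ZM a b c n \<omega> / real n" and K: "rank_model.K2 P R f C a b c \<le> K"
  shows "expectation (\<lambda>\<omega>. (g \<omega>)\<^sup>2) \<le> K / real n"
proof -
  have n0: "0 < real n" using n by simp
  have "expectation (\<lambda>\<omega>. (g \<omega>)\<^sup>2) = expectation (\<lambda>\<omega>. (ZM a b c n \<omega> / real n)\<^sup>2)"
  proof (rule integral_cong_AE)
    show "AE \<omega> in M. (g \<omega>)\<^sup>2 = (ZM a b c n \<omega> / real n)\<^sup>2" using eq by eventually_elim simp
  qed measurable
  also have "\<dots> = expectation (\<lambda>\<omega>. (ZM a b c n \<omega>)\<^sup>2) / (real n)\<^sup>2" by (simp add: power_divide)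
  also have "\<dots> \<le> (rank_model.K2 P R f C a b c * real n) / (real n)\<^sup>2"
    using ZM_second_moment(2)[OF n] by (intro divide_right_mono) auto
  also have "\<dots> = rank_model.K2 P R f C a b c / real n" using n0 by (simp add: power2_eq_square)
  also have "\<dots> \<le> K / real n" using K n0 by (intro divide_right_mono) auto
  finally show ?thesis .
qed

lemma covariance_eps:
  fixes g h :: "real \<Rightarrow> real"
  assumes [measurable]: "g \<in> borel_measurable borel" "h \<in> borel_measurable borel"
  shows "covariance M (\<lambda>\<omega>. g (eps \<omega>)) (\<lambda>\<omega>. h (eps \<omega>)) = (\<integral>e. (g e - (\<integral>e. g e \<partial>R)) * (h e - (\<integral>e. h e \<partial>R)) \<partial>R)"
  unfolding covariance_def by (simp add: integral_distr)

lemma hadamard_Sigma_entries: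
  fixes z :: real
  defines "H \<equiv> hadamard (Sigma_a M eps z f f) (Sigma_b M eps z f f)"
    and "v \<equiv> rank_model.v R f z" and "q \<equiv> rank_model.q R f z" and "w \<equiv> rank_model.w R f z"
  shows "H $ 1 $ 1 = (4 * m0 z * m0 z + v) * v" "H $ 1 $ 2 = 2 * m0 z * v" "H $ 1 $ 3 = 2 * m0 z * q"
    "H $ 2 $ 1 = 2 * m0 z * v" "H $ 2 $ 2 = v" "H $ 2 $ 3 = q"
    "H $ 3 $ 1 = 2 * m0 z * q" "H $ 3 $ 2 = q" "H $ 3 $ 3 = w"
proof -
  interpret rank_model P R f C 0 0 0 by (rule model)
  have fm: "(\<lambda>e. f (z, e)) \<in> borel_measurable borel" "(\<lambda>e. (f (z, e))\<^sup>2) \<in> borel_measurable borel" by measurable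
  have cv: "covariance M (\<lambda>\<omega>. f (z, eps \<omega>)) (\<lambda>\<omega>. f (z, eps \<omega>)) = v"
    "covariance M (\<lambda>\<omega>. f (z, eps \<omega>)) (\<lambda>\<omega>. (f (z, eps \<omega>))\<^sup>2) = q"
    "covariance M (\<lambda>\<omega>. (f (z, eps \<omega>))\<^sup>2) (\<lambda>\<omega>. f (z, eps \<omega>)) = q"
    "covariance M (\<lambda>\<omega>. (f (z, eps \<omega>))\<^sup>2) (\<lambda>\<omega>. (f (z, eps \<omega>))\<^sup>2) = w"
    unfolding covariance_eps[OF fm(1) fm(1)] covariance_eps[OF fm(1) fm(2)] covariance_eps[OF fm(2) fm(1)] covariance_eps[OF fm(2) fm(2)]
    unfolding v_def q_def w_def \<eta>_def \<zeta>_def m_def s_def assms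
      rank_model.v_def[OF model] rank_model.q_def[OF model] rank_model.w_def[OF model] power2_eq_square
    by (simp_all only: mult.commute)
  show "H $ 1 $ 1 = (4 * m0 z * m0 z + v) * v" "H $ 1 $ 2 = 2 * m0 z * v" "H $ 1 $ 3 = 2 * m0 z * q"
    "H $ 2 $ 1 = 2 * m0 z * v" "H $ 2 $ 2 = v" "H $ 2 $ 3 = q"
    "H $ 3 $ 1 = 2 * m0 z * q" "H $ 3 $ 2 = q" "H $ 3 $ 3 = w"
    unfolding H_def hadamard_def Sigma_a_def Sigma_b_def cov_matrix_def outer_product_def exp_eps_eq
    by (simp_all add: vector_3 cv)
qed

lemma bounded_borel_hadamard:
  "bounded_borel (\<lambda>z. hadamard (Sigma_a M eps z f f) (Sigma_b M eps z f f) $ i $ j)"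
proof -
  interpret rank_model P R f C 0 0 0 by (rule model)
  have b: "bounded_borel m0" "bounded_borel v" "bounded_borel q" "bounded_borel w"
    unfolding bounded_borel_def using bounds m_meas v_meas q_meas w_meas by blast+
  have "\<forall>i j. bounded_borel (\<lambda>z. hadamard (Sigma_a M eps z f f) (Sigma_b M eps z f f) $ i $ j)"
    unfolding forall_3 hadamard_Sigma_entries
    by (intro conjI bounded_borel_add bounded_borel_mult bounded_borel_const b)
  then show ?thesis by blast
qed

lemma integrable_bounded_borel: "bounded_borel g \<Longrightarrow> integrable M (\<lambda>\<omega>. g (X \<omega>))"
  unfolding bounded_borel_def by (auto intro!: integrable_bounded measurable_compose[OF X_meas])

lemma quadratic_form_Sigma:
  fixes u :: "real ^ 3"
  shows "u \<bullet> ((Sigma_0 M X eps f f + Sigma_1 M X eps f f) *v u)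
    = rank_model.V0 P R f (u $ 1) (u $ 2) (u $ 3) + rank_model.V1 P R f (u $ 1) (u $ 2) (u $ 3)"
proof -
  interpret rank_model P R f C "u $ 1" "u $ 2" "u $ 3" by (rule model)
  define g :: "3 \<Rightarrow> 'a \<Rightarrow> real" where "g i \<omega> = (vector [(m0 (X \<omega>))\<^sup>2, m0 (X \<omega>), s0 (X \<omega>)] :: real ^ 3) $ i" for i \<omega>
  have g123: "g 1 = (\<lambda>\<omega>. (m0 (X \<omega>))\<^sup>2)" "g 2 = (\<lambda>\<omega>. m0 (X \<omega>))" "g 3 = (\<lambda>\<omega>. s0 (X \<omega>))"
    by (auto simp: g_def vector_3)
  have gmean: "expectation (g 1) = p0" "expectation (g 2) = \<mu>0" "expectation (g 3) = q0"
    unfolding g123 p0_def \<mu>0_def q0_def by (intro integral_X; measurable)+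
  define g0 where "g0 i \<omega> = g i \<omega> - expectation (g i)" for i \<omega>
  have gm: "\<forall>i. g i \<in> borel_measurable M" unfolding forall_3 g123 by measurable
  have CC: "C \<le> C\<^sup>2" using C by (simp add: power2_eq_square)
  have gb: "\<forall>i. \<forall>\<omega>. \<bar>g i \<omega>\<bar> \<le> C\<^sup>2" unfolding forall_3 g123
    using order_trans[OF m_bound_C CC] s_bound_C norm_square_le[OF m_bound_C, unfolded real_norm_def] by blast
  have g0b: "\<bar>g0 i \<omega>\<bar> \<le> C\<^sup>2 + \<bar>expectation (g i)\<bar>" for i \<omega>
    unfolding g0_def using gb abs_triangle_ineq4[of "g i \<omega>" "expectation (g i)"] by (meson add_right_mono order_trans)
  have g0m [measurable]: "g0 i \<in> borel_measurable M" for i 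
    unfolding g0_def[abs_def] by (intro borel_measurable_diff borel_measurable_const gm[rule_format])
  have gg: "integrable M (\<lambda>\<omega>. g0 i \<omega> * g0 j \<omega>)" for i j
  proof (rule integrable_bounded)
    show "norm (g0 i \<omega> * g0 j \<omega>) \<le> (C\<^sup>2 + \<bar>expectation (g i)\<bar>) * (C\<^sup>2 + \<bar>expectation (g j)\<bar>)" for \<omega>
      unfolding real_norm_def abs_mult by (intro mult_mono g0b) auto
  qed measurable
  have "u \<bullet> (Sigma_0 M X eps f f *v u) = (\<Sum>i\<in>UNIV. \<Sum>j\<in>UNIV. u $ i * u $ j * expectation (\<lambda>\<omega>. g0 i \<omega> * g0 j \<omega>))"
    unfolding quadratic_form Sigma_0_def cov_matrix_def covariance_def g0_def g_def exp_eps_eq by simp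
  also have "\<dots> = expectation (\<lambda>\<omega>. \<Sum>i\<in>UNIV. \<Sum>j\<in>UNIV. u $ i * u $ j * (g0 i \<omega> * g0 j \<omega>))"
    using gg by simp
  also have "\<dots> = expectation (\<lambda>\<omega>. (h (X \<omega>) - hbar)\<^sup>2)"
    unfolding g0_def h_def hbar_eq
    by (intro Bochner_Integration.integral_cong refl)
       (simp only: sum_3 gmean, simp only: g123, simp add: power2_eq_square algebra_simps)
  also have "\<dots> = V0" unfolding V0_def by (rule integral_X) measurable
  finally have 0: "u \<bullet> (Sigma_0 M X eps f f *v u) = V0" .
  let ?H = "\<lambda>z. hadamard (Sigma_a M eps z f f) (Sigma_b M eps z f f)"
  have "u \<bullet> (Sigma_1 M X eps f f *v u) = (\<Sum>i\<in>UNIV. \<Sum>j\<in>UNIV. u $ i * u $ j * expectation (\<lambda>\<omega>. ?H (X \<omega>) $ i $ j))"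
    unfolding quadratic_form Sigma_1_def by simp
  also have "\<dots> = expectation (\<lambda>\<omega>. \<Sum>i\<in>UNIV. \<Sum>j\<in>UNIV. u $ i * u $ j * ?H (X \<omega>) $ i $ j)"
    using integrable_bounded_borel[OF bounded_borel_hadamard] by simp
  also have "\<dots> = expectation (\<lambda>\<omega>. lim_var (X \<omega>))"
    unfolding lim_var_def
    by (intro Bochner_Integration.integral_cong refl)
       (simp add: sum_3 hadamard_Sigma_entries power2_eq_square algebra_simps)
  also have "\<dots> = V1" unfolding V1_def by (rule integral_X) measurable
  finally have 1: "u \<bullet> (Sigma_1 M X eps f f *v u) = V1" .
  show ?thesis unfolding matrix_vector_mult_add_rdistrib inner_add_right 0 1 ..
qed

end

section \<open>Consistency and fluctuations\<close>

context rank_setup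
begin

theorem consistency:
  assumes var: "variance Y > 0"
  shows "AE \<omega> in M. (\<lambda>n. \<rho>hat n \<omega>) \<longlonglongrightarrow> sobol_index M X Y"
  using averages_AE_lim
proof eventually_elim
  case (elim \<omega>)
  have "q0 - \<mu>0\<^sup>2 \<noteq> 0" using var variance_Y by simp
  with elim show ?case
    unfolding rank_estimator_eq sobol_index_eq by (intro tendsto_divide tendsto_diff tendsto_power)
qed

lemma sobol_variance_eq:
  "sobol_variance M X eps f
    = rank_model.V0 P R f (sobol_vec M X eps f $ 1) (sobol_vec M X eps f $ 2) (sobol_vec M X eps f $ 3)
    + rank_model.V1 P R f (sobol_vec M X eps f $ 1) (sobol_vec M X eps f $ 2) (sobol_vec M X eps f $ 3)"
  unfolding sobol_variance_def by (rule quadratic_form_Sigma)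

lemma sobol_variance_nonneg: "0 \<le> sobol_variance M X eps f"
proof -
  interpret rank_model P R f C "sobol_vec M X eps f $ 1" "sobol_vec M X eps f $ 2" "sobol_vec M X eps f $ 3"
    by (rule model)
  show ?thesis unfolding sobol_variance_eq using V1_nonneg by (simp add: V0_def)
qed

lemma estimator_meas [measurable]: "\<rho>hat n \<in> borel_measurable M"
  unfolding rank_estimator_eq by measurable

lemma char_estimator_tendsto:
  assumes var: "variance Y > 0"
  shows "(\<lambda>n. \<integral>\<omega>. iexp (t * (sqrt (real n) * (\<rho>hat n \<omega> - (sobol_index M X Y - D0 n / (2 * variance Y))))) \<partial>M)
    \<longlonglongrightarrow> exp (- (t\<^sup>2 * sobol_variance M X eps f / 2))"
proof -
  define V where "V = variance Y"
  define \<rho> where "\<rho> = sobol_index M X Y"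
  have V: "V = q0 - \<mu>0\<^sup>2" "V > 0" using var variance_Y by (simp_all add: V_def)
  have \<rho>: "\<rho> = (p0 - \<mu>0\<^sup>2) / V" by (simp add: \<rho>_def sobol_index_eq V)
  define W where "W n \<omega> = ((Pn n \<omega> - (p0 - D0 n / 2)) + 2 * \<mu>0 * (\<rho> - 1) * (Yn n \<omega> - \<mu>0) - \<rho> * (Sn n \<omega> - q0)) / V" for n \<omega>
  define w1 where "w1 = sobol_vec M X eps f $ 1"
  define w2 where "w2 = sobol_vec M X eps f $ 2"
  define w3 where "w3 = sobol_vec M X eps f $ 3"
  have w: "w1 = 1 / V" "w2 = 2 * \<mu>0 * (\<rho> - 1) / V" "w3 = - \<rho> / V"
    unfolding w1_def w2_def w3_def sobol_vec_def Let_def Y_moments V_def \<rho>_def by (simp_all add: vector_3)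
  define K where "K = max (rank_model.K2 P R f C 1 0 0) (max (rank_model.K2 P R f C 0 1 0) (rank_model.K2 P R f C 0 0 1))"
  have D: "0 \<le> D0 n" "D0 \<longlonglongrightarrow> 0" for n
  proof -
    interpret rank_model P R f C 0 0 0 by (rule model)
    show "0 \<le> D0 n" "D0 \<longlonglongrightarrow> 0" by (rule D_nonneg D_tendsto_0)+
  qed
  have diff: "(\<lambda>n. (\<integral>\<omega>. iexp (t * (sqrt (real n) * (\<rho>hat n \<omega> - (\<rho> - D0 n / (2 * V))))) \<partial>M)
      - (\<integral>\<omega>. iexp (t * (sqrt (real n) * W n \<omega>)) \<partial>M)) \<longlonglongrightarrow> 0"
  proof (rule char_ratio_linearization[OF averages_meas averages_bound V \<rho> D, where N = 3 and K = K])
    fix n :: nat assume n: "n \<ge> 3"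
    then have n0: "real n \<noteq> 0" by simp
    show "expectation (\<lambda>\<omega>. (Pn n \<omega> - (p0 - D0 n / 2))\<^sup>2) \<le> K / real n"
    proof (rule square_average_moment[OF n])
      show "AE \<omega> in M. Pn n \<omega> - (p0 - D0 n / 2) = ZM 1 0 0 n \<omega> / real n"
        using averages_TM(1) by eventually_elim (use n0 in \<open>simp add: ZM_eq field_simps\<close>)
    qed (simp_all add: K_def)
    show "expectation (\<lambda>\<omega>. (Yn n \<omega> - \<mu>0)\<^sup>2) \<le> K / real n"
    proof (rule square_average_moment[OF n])
      show "AE \<omega> in M. Yn n \<omega> - \<mu>0 = ZM 0 1 0 n \<omega> / real n"
        using n0 by (simp add: averages_TM ZM_eq field_simps)
    qed (simp_all add: K_def)
    show "expectation (\<lambda>\<omega>. (Sn n \<omega> - q0)\<^sup>2) \<le> K / real n"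
    proof (rule square_average_moment[OF n])
      show "AE \<omega> in M. Sn n \<omega> - q0 = ZM 0 0 1 n \<omega> / real n"
        using n0 by (simp add: averages_TM ZM_eq field_simps)
    qed (simp_all add: K_def)
  qed (simp_all only: rank_estimator_eq W_def)
  have W_meas [measurable]: "W n \<in> borel_measurable M" for n
    unfolding W_def[abs_def] by measurable
  have W_ZM: "(\<integral>\<omega>. iexp (t * (ZM w1 w2 w3 n \<omega> / sqrt (real n))) \<partial>M) = (\<integral>\<omega>. iexp (t * (sqrt (real n) * W n \<omega>)) \<partial>M)"
    if n: "n \<ge> 1" for n
  proof (rule integral_cong_AE)
    show "AE \<omega> in M. iexp (t * (ZM w1 w2 w3 n \<omega> / sqrt (real n))) = iexp (t * (sqrt (real n) * W n \<omega>))"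
      using averages_TM(1)
    proof eventually_elim
      case (elim \<omega>)
      have r: "sqrt (real n) \<noteq> 0" "real n = sqrt (real n) * sqrt (real n)" "real n \<noteq> 0" using n by auto
      have T: "TM 1 0 0 n \<omega> = real n * Pn n \<omega>" "TM 0 1 0 n \<omega> = real n * Yn n \<omega>" "TM 0 0 1 n \<omega> = real n * Sn n \<omega>"
        using elim r(3) averages_TM(2,3)[of n \<omega>] by simp_all
      have "ZM w1 w2 w3 n \<omega> = real n * W n \<omega>"
        unfolding ZM_eq TM_linear[of w1 w2 w3] T unfolding W_def w using V(2) by (simp add: field_simps)
      also have "\<dots> = sqrt (real n) * (sqrt (real n) * W n \<omega>)" by (metis r(2) mult.assoc)
      finally have "ZM w1 w2 w3 n \<omega> / sqrt (real n) = sqrt (real n) * W n \<omega>" using r(1) by simp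
      then show ?case by simp
    qed
  qed measurable
  have "(\<lambda>n. \<integral>\<omega>. iexp (t * (sqrt (real n) * W n \<omega>)) \<partial>M) \<longlonglongrightarrow> exp (- (t\<^sup>2 * sobol_variance M X eps f / 2))"
    unfolding sobol_variance_eq w1_def[symmetric] w2_def[symmetric] w3_def[symmetric]
    by (rule Lim_transform_eventually[OF ZM_char]) (rule eventually_sequentiallyI[of 1], rule W_ZM)
  from tendsto_add[OF diff this] show ?thesis by (simp add: \<rho>_def V_def)
qed

lemma fluctuations_centred:
  assumes var: "variance Y > 0"
  shows "weak_conv_m (\<lambda>n. distr M borel (\<lambda>\<omega>. sqrt (real n) * (\<rho>hat n \<omega> - (sobol_index M X Y - D0 n / (2 * variance Y)))))
    (normal_law 0 (sobol_variance M X eps f))"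
  by (rule weak_conv_normal_lawI[OF _ sobol_variance_nonneg char_estimator_tendsto[OF var]]) measurable

lemma fluctuations:
  assumes var: "variance Y > 0" and D: "(\<lambda>n. sqrt (real n) * D0 n) \<longlonglongrightarrow> 0"
  shows "weak_conv_m (\<lambda>n. distr M borel (\<lambda>\<omega>. sqrt (real n) * (\<rho>hat n \<omega> - sobol_index M X Y)))
    (normal_law 0 (sobol_variance M X eps f))"
proof (rule weak_conv_normal_lawI[OF _ sobol_variance_nonneg])
  fix t :: real
  define V where "V = variance Y"
  define \<rho> where "\<rho> = sobol_index M X Y"
  define k where "k n = t * (- (sqrt (real n) * D0 n / (2 * V)))" for n
  have "k \<longlonglongrightarrow> t * (- (0 / (2 * V)))"
    unfolding k_def using var by (intro tendsto_mult tendsto_minus tendsto_divide tendsto_const D) (simp add: V_def)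
  then have "(\<lambda>n. iexp (k n)) \<longlonglongrightarrow> iexp 0" by (intro tendsto_intros) simp
  from tendsto_mult[OF this char_estimator_tendsto[OF var, of t, folded V_def \<rho>_def]]
  have "(\<lambda>n. iexp (k n) * (\<integral>\<omega>. iexp (t * (sqrt (real n) * (\<rho>hat n \<omega> - (\<rho> - D0 n / (2 * V))))) \<partial>M))
    \<longlonglongrightarrow> exp (- (t\<^sup>2 * sobol_variance M X eps f / 2))" by simp
  moreover have "iexp (k n) * (\<integral>\<omega>. iexp (t * (sqrt (real n) * (\<rho>hat n \<omega> - (\<rho> - D0 n / (2 * V))))) \<partial>M)
    = (\<integral>\<omega>. iexp (t * (sqrt (real n) * (\<rho>hat n \<omega> - \<rho>))) \<partial>M)" for n
  proof -
    have "iexp (k n) * iexp (t * (sqrt (real n) * (\<rho>hat n \<omega> - (\<rho> - D0 n / (2 * V)))))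
      = iexp (t * (sqrt (real n) * (\<rho>hat n \<omega> - \<rho>)))" for \<omega>
    proof -
      have "t * (sqrt (real n) * (\<rho>hat n \<omega> - \<rho>)) = k n + t * (sqrt (real n) * (\<rho>hat n \<omega> - (\<rho> - D0 n / (2 * V))))"
        by (simp add: k_def algebra_simps)
      then show ?thesis by (simp only: of_real_add distrib_left exp_add)
    qed
    then show ?thesis by (simp flip: integral_mult_right_zero)
  qed
  ultimately show "(\<lambda>n. \<integral>\<omega>. iexp (t * (sqrt (real n) * (\<rho>hat n \<omega> - sobol_index M X Y))) \<partial>M)
    \<longlonglongrightarrow> exp (- (t\<^sup>2 * sobol_variance M X eps f / 2))" by (simp add: \<rho>_def)
qed measurable

end

theorem theorem2p1:
  fixes M :: "'a measure"
    and X eps :: "'a \<Rightarrow> real"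
    and Xs es :: "nat \<Rightarrow> 'a \<Rightarrow> real"
    and f :: "real \<times> real \<Rightarrow> real"
  assumes prob: "prob_space M"
    and f_meas: "f \<in> borel_measurable (borel \<Otimes>\<^sub>M borel)"
    and indep_X_eps: "prob_space.indep_var M borel X borel eps"
    and indep_Xs: "prob_space.indep_vars M (\<lambda>_. borel) Xs {1..}"
    and distr_Xs: "\<And>i. i \<ge> 1 \<Longrightarrow> distr M borel (Xs i) = distr M borel X"
    and indep_es: "prob_space.indep_vars M (\<lambda>_. borel) es {1..}"
    and distr_es: "\<And>i. i \<ge> 1 \<Longrightarrow> distr M borel (es i) = distr M borel eps"
    and indep_Xs_es: "prob_space.indep_var M
          (\<Pi>\<^sub>M i\<in>{1..}. borel) (\<lambda>\<omega>. \<lambda>i\<in>{1..}. Xs i \<omega>)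
          (\<Pi>\<^sub>M i\<in>{1..}. borel) (\<lambda>\<omega>. \<lambda>i\<in>{1..}. es i \<omega>)"
    and f_bounded: "bounded (range f)"
    and no_atoms: "\<And>x. measure M {\<omega> \<in> space M. X \<omega> = x} = 0"
    and var_pos: "prob_space.variance M (\<lambda>\<omega>. f (X \<omega>, eps \<omega>)) > 0"
  shows
    "let Y = (\<lambda>\<omega>. f (X \<omega>, eps \<omega>));
         \<phi> = exp_eps M eps f;
         \<rho> = sobol_index M X Y;
         \<rho>hat = (\<lambda>n \<omega>. rank_estimator n (\<lambda>i. Xs i \<omega>) (\<lambda>i. f (Xs i \<omega>, es i \<omega>)));
         \<sigma> = (\<lambda>n \<omega>. sort_perm_periodic n (\<lambda>i. Xs i \<omega>));
         \<Delta> = Delta M Xs \<phi>;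
         s2 = sobol_variance M X eps f
     in (AE \<omega> in M. (\<lambda>n. \<rho>hat n \<omega>) \<longlonglongrightarrow> \<rho>)
      \<and> \<rho> = (prob_space.expectation M (\<lambda>\<omega>. (cond_exp_given M X Y \<omega>)\<^sup>2)
               - (prob_space.expectation M Y)\<^sup>2)
             / (prob_space.expectation M (\<lambda>\<omega>. (Y \<omega>)\<^sup>2) - (prob_space.expectation M Y)\<^sup>2)
      \<and> (\<forall>n\<ge>1. \<Delta> n = 1 / real n * prob_space.expectation M
             (\<lambda>\<omega>. \<Sum>i = 1..n. (\<phi> (Xs (\<sigma> n \<omega> (i - 1)) \<omega>) - \<phi> (Xs (\<sigma> n \<omega> i) \<omega>))\<^sup>2))
      \<and> \<Delta> \<longlonglongrightarrow> 0
      \<and> 0 \<le> s2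
      \<and> weak_conv_m
           (\<lambda>n. distr M borel
              (\<lambda>\<omega>. sqrt (real n) * (\<rho>hat n \<omega> - (\<rho> - \<Delta> n / (2 * prob_space.variance M Y)))))
           (normal_law 0 s2)
      \<and> ((\<lambda>n. sqrt (real n) * \<Delta> n) \<longlonglongrightarrow> 0 \<longrightarrow>
           weak_conv_m
             (\<lambda>n. distr M borel (\<lambda>\<omega>. sqrt (real n) * (\<rho>hat n \<omega> - \<rho>)))
             (normal_law 0 s2))
      \<and> (bounded_2_variation \<phi> \<longrightarrow> (\<lambda>n. sqrt (real n) * \<Delta> n) \<longlonglongrightarrow> 0)"
proof -
  obtain B where B: "\<And>z. \<bar>f z\<bar> \<le> B" using f_bounded unfolding bounded_iff by auto
  define C where "C = max 1 B"
  have "\<bar>f z\<bar> \<le> C" for z using B[of z] by (simp add: C_def)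
  then interpret rank_setup M X eps Xs es f C
    using assms unfolding rank_setup_def rank_setup_axioms_def by (simp add: C_def)
  let ?\<Delta> = "Delta M Xs (exp_eps M eps f)"
  have \<Delta>: "?\<Delta> n = D0 n" if "n \<ge> 1" for n unfolding exp_eps_eq by (rule Delta_eq(1)[OF that])
  have r\<Delta>: "sqrt (real n) * ?\<Delta> n = sqrt (real n) * D0 n" for n using \<Delta>[of n] by (cases "n = 0") auto
  have D_lim: "D0 \<longlonglongrightarrow> 0"
  proof -
    interpret rank_model P R f C 0 0 0 by (rule model)
    show "D0 \<longlonglongrightarrow> 0" by (rule D_tendsto_0)
  qed
  have \<Delta>_lim: "?\<Delta> \<longlonglongrightarrow> 0"
    by (rule Lim_transform_eventually[OF D_lim]) (rule eventually_sequentiallyI[of 1], simp add: \<Delta>)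
  have \<Delta>_sum: "\<forall>n\<ge>1. ?\<Delta> n = 1 / real n * expectation (\<lambda>\<omega>. \<Sum>i = 1..n.
      (exp_eps M eps f (Xs (sort_perm_periodic n (x \<omega>) (i - 1)) \<omega>)
       - exp_eps M eps f (Xs (sort_perm_periodic n (x \<omega>) i) \<omega>))\<^sup>2)"
    unfolding exp_eps_eq(1)
  proof (intro allI impI)
    fix n :: nat assume n: "n \<ge> 1"
    show "Delta M Xs m0 n = 1 / real n * expectation (\<lambda>\<omega>. \<Sum>i = 1..n.
      (m0 (Xs (sort_perm_periodic n (x \<omega>) (i - 1)) \<omega>) - m0 (Xs (sort_perm_periodic n (x \<omega>) i) \<omega>))\<^sup>2)"
      by (rule trans[OF Delta_eq[OF n]])
  qed
  have \<rho>_eq: "sobol_index M X Y = (expectation (\<lambda>\<omega>. (cond_exp_given M X Y \<omega>)\<^sup>2) - (expectation Y)\<^sup>2)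
             / (expectation (\<lambda>\<omega>. (Y \<omega>)\<^sup>2) - (expectation Y)\<^sup>2)"
    unfolding sobol_index_eq cond_exp_moments(2) Y_moments ..
  have eq: "sqrt (real n) * (\<rho>hat n \<omega> - (sobol_index M X Y - D0 n / (2 * variance Y)))
      = sqrt (real n) * (\<rho>hat n \<omega> - (sobol_index M X Y - ?\<Delta> n / (2 * variance Y)))" for n \<omega>
    using \<Delta>[of n] by (cases "n = 0") auto
  have weak: "weak_conv_m (\<lambda>n. distr M borel (\<lambda>\<omega>. sqrt (real n) * (\<rho>hat n \<omega> - (sobol_index M X Y - ?\<Delta> n / (2 * variance Y)))))
    (normal_law 0 (sobol_variance M X eps f))"
    using fluctuations_centred[OF var_pos] unfolding eq .
  show ?thesis
    unfolding Let_def
  proof (intro conjI impI)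
    assume "(\<lambda>n. sqrt (real n) * ?\<Delta> n) \<longlonglongrightarrow> 0"
    then show "weak_conv_m (\<lambda>n. distr M borel (\<lambda>\<omega>. sqrt (real n) * (\<rho>hat n \<omega> - sobol_index M X Y)))
      (normal_law 0 (sobol_variance M X eps f))"
      unfolding r\<Delta> by (rule fluctuations[OF var_pos])
  next
    assume "bounded_2_variation (exp_eps M eps f)"
    then show "(\<lambda>n. sqrt (real n) * ?\<Delta> n) \<longlonglongrightarrow> 0"
      unfolding r\<Delta> unfolding exp_eps_eq(1) by (rule D_bounded_2_variation)
  qed (rule consistency[OF var_pos] \<rho>_eq \<Delta>_sum \<Delta>_lim sobol_variance_nonneg weak)+
qed

end
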